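(* Let $0<L<\infty$, $A=[-L,L]$ with the endpoints $\pm L$ identified, and let $\sigma,\mu:A\to\mathbb{R}$ be periodic functions with $\sigma(x)>0$ for all $x\in A$. Suppose that $\sigma^2\in\mathcal{C}^{k,\alpha}(A)$ and $\mu\in\mathcal{C}^{j,\beta}(A)$, where $k,j\in\{0,1,2,\dots\}$ and $\alpha,\beta\in(0,1]$, and let $$\gamma=\min\{2,\;k+\alpha,\;j+\beta\}.$$ Assume that $\gamma>0$. Let $t>0$. Then there is a constant $c>0$ such that for all $m'\ge m\ge m_0$ and all $x,y\in A_m$ the following hold: (i) $$|u_m(x,y;t)-u_{m'}(x,y;t)|\le c\,h_m^{\gamma};$$ (ii) $$|\partial_t u_m(x,y;t)-\partial_t u_{m'}(x,y;t)| = |\mathcal{L}^{m*}_y u_m(x,y;t)-\mathcal{L}^{m'*}_y u_{m'}(x,y;t)| = |\mathcal{L}^{m}_x u_m(x,y;t)-\mathcal{L}^{m'}_x u_{m'}(x,y;t)|\le c\,h_m^{\gamma}.$$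
   Context: Periodic boundary conditions are assumed throughout: $-L$ and $L$ are identified, and all functions are $2L$-periodic. The distance is $d(x,y)=\min_{n\in\mathbb{Z}}|x-y-2Ln|$. For $k\in\{0,1,2,\dots\}$ and $\alpha\in(0,1]$, $\mathcal{C}^{k,\alpha}(A)$ is the space of periodic functions $\phi$ on $A$ with $k$ continuous derivatives (for $k=0$, $\phi$ continuous) for which there is a constant $c>0$ with $|\phi^{(k)}(x)-\phi^{(k)}(y)|\le c\,d(x,y)^\alpha$ for all $x,y\in A$. For $m\in\{0,1,2,\dots\}$ let $h_m=L2^{-m}$ and $A_m=h_m\mathbb{Z}\cap A$ (with $\pm L$ identified, so $A_m$ has $2^{m+1}$ points, and $A_m\subset A_{m'}$ for $m'\ge m$). On periodic functions $f:A_m\to\mathbb{R}$ define $$\nabla^m_x f(x)=\frac{f(x+h_m)-f(x-h_m)}{2h_m},\qquad \Delta^m_x f(x)=\frac{f(x+h_m)+f(x-h_m)-2f(x)}{h_m^2},$$ $$\mathcal{L}^m_x=\frac{\sigma(x)^2}{2}\Delta^m_x+\mu(x)\nabla^m_x .$$ Write $\mathcal{L}^m(x,y)$, $x,y\in A_m$, for the matrix elements of this operator, i.e. $(\mathcal{L}^m_xf)(x)=\sum_{y\in A_m}\mathcal{L}^m(x,y)f(y)$, and let $\mathcal{L}^{m*}_y$ be the transposed operator acting on the $y$ variable, $(\mathcal{L}^{m*}_y\phi)(y)=\sum_{z\in A_m}\mathcal{L}^m(z,y)\phi(z)$. $m_0$ is the least integer such that $\frac{\sigma(x)^2}{2h_m^2}>\frac{|\mu(x)|}{2h_m}$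 for all $m\ge m_0$ and all $x\in A_m$. The kernel $u_m(x,y;t)$, $x,y\in A_m$, is the solution of $\partial_t u_m(x,y;t)=\mathcal{L}^{m*}_y u_m(x,y;t)$ with $\lim_{t\downarrow0}u_m(x,y;t)=\delta_m(x-y)$, where $\delta_m(x-y)=1/h_m$ if $x=y$ mod $2L$ and $0$ otherwise. Equivalently, $u_m(x,y;t)=\frac1{h_m}\exp(t\mathcal{L}^m)(x,y)$ (matrix exponential). *)

theory Defs
  imports "HOL-Analysis.Analysis" "HOL-Library.Periodic_Fun"
begin

text \<open>
  Functions on the circle [-L, L] with identified endpoints are 2L-periodic functions on the
  reals; derivatives and continuity on the circle are then those of the periodic function.
\<close>

definition per_dist :: "real \<Rightarrow> real \<Rightarrow> real \<Rightarrow> real" where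
  "per_dist L x y = (INF n::int. \<bar>x - y - 2 * L * of_int n\<bar>)"

text \<open>For \<open>L > 0\<close> the infimum is attained.\<close>

lemma per_dist_attained:
  assumes "L > 0"
  shows "\<exists>n::int. per_dist L x y = \<bar>x - y - 2 * L * of_int n\<bar>"
    and "per_dist L x y \<le> \<bar>x - y - 2 * L * of_int i\<bar>"
proof -
  let ?f = "\<lambda>n::int. \<bar>x - y - 2 * L * of_int n\<bar>"
  define n where "n = round ((x - y) / (2 * L))"
  have scale: "?f i = 2 * L * \<bar>(x - y) / (2 * L) - of_int i\<bar>" for i
  proof -
    have "x - y - 2 * L * of_int i = 2 * L * ((x - y) / (2 * L) - of_int i)"
      using assms by (simp add: field_simps)
    then show ?thesis using assms by (simp add: abs_mult)
  qed
  have min: "?f n \<le> ?f i" for i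
    unfolding scale n_def using assms round_diff_minimal[of "(x - y) / (2 * L)" i]
    by (intro mult_left_mono) auto
  have "per_dist L x y = ?f n"
    unfolding per_dist_def by (rule cInf_eq_minimum) (use min in auto)
  then show "\<exists>n::int. per_dist L x y = ?f n" "per_dist L x y \<le> ?f i"
    using min by auto
qed

definition Holder_space :: "real \<Rightarrow> nat \<Rightarrow> real \<Rightarrow> (real \<Rightarrow> real) set" where
  "Holder_space L k \<alpha> = {\<phi>. periodic_fun_simple \<phi> (2 * L) \<and>
     (\<forall>i<k. \<forall>x. (deriv ^^ i) \<phi> field_differentiable at x) \<and>
     continuous_on UNIV ((deriv ^^ k) \<phi>) \<and>
     (\<exists>c>0. \<forall>x y. \<bar>(deriv ^^ k) \<phi> x - (deriv ^^ k) \<phi> y\<bar> \<le> c * per_dist L x y powr \<alpha>)}"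

definition mesh :: "real \<Rightarrow> nat \<Rightarrow> real" where
  "mesh L m = L / 2 ^ m"

text \<open>Since \<open>-L\<close> and \<open>L\<close> are identified, only \<open>-L\<close> is kept as a representative.\<close>

definition grid :: "real \<Rightarrow> nat \<Rightarrow> real set" where
  "grid L m = {x. \<exists>n::int. x = mesh L m * of_int n} \<inter> {-L..<L}"

definition grad :: "real \<Rightarrow> nat \<Rightarrow> (real \<Rightarrow> real) \<Rightarrow> real \<Rightarrow> real" where
  "grad L m f x = (f (x + mesh L m) - f (x - mesh L m)) / (2 * mesh L m)"

definition lapl :: "real \<Rightarrow> nat \<Rightarrow> (real \<Rightarrow> real) \<Rightarrow> real \<Rightarrow> real" where
  "lapl L m f x = (f (x + mesh L m) + f (x - mesh L m) - 2 * f x) / (mesh L m)\<^sup>2"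

definition gen ::
  "real \<Rightarrow> (real \<Rightarrow> real) \<Rightarrow> (real \<Rightarrow> real) \<Rightarrow> nat \<Rightarrow> (real \<Rightarrow> real) \<Rightarrow> real \<Rightarrow> real" where
  "gen L \<sigma> \<mu> m f x = (\<sigma> x)\<^sup>2 / 2 * lapl L m f x + \<mu> x * grad L m f x"

definition per_unit :: "real \<Rightarrow> real \<Rightarrow> real \<Rightarrow> real" where
  "per_unit L y x = (if \<exists>n::int. x - y = 2 * L * of_int n then 1 else 0)"

text \<open>
  The matrix element at \<open>(x, y)\<close> is the value at \<open>x\<close> of the operator applied to the
  periodic unit function at \<open>y\<close>; lemma \<open>gen_eq_sum\<close> below is the defining property.
\<close>

definition gen_mat ::
  "real \<Rightarrow> (real \<Rightarrow> real) \<Rightarrow> (real \<Rightarrow> real) \<Rightarrow> nat \<Rightarrow> real \<Rightarrow> real \<Rightarrow> real" where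
  "gen_mat L \<sigma> \<mu> m x y = gen L \<sigma> \<mu> m (per_unit L y) x"

definition gen_adj ::
  "real \<Rightarrow> (real \<Rightarrow> real) \<Rightarrow> (real \<Rightarrow> real) \<Rightarrow> nat \<Rightarrow> (real \<Rightarrow> real) \<Rightarrow> real \<Rightarrow> real" where
  "gen_adj L \<sigma> \<mu> m \<phi> y = (\<Sum>z\<in>grid L m. gen_mat L \<sigma> \<mu> m z y * \<phi> z)"

definition min_level :: "real \<Rightarrow> (real \<Rightarrow> real) \<Rightarrow> (real \<Rightarrow> real) \<Rightarrow> nat" where
  "min_level L \<sigma> \<mu> = (LEAST m0. \<forall>m\<ge>m0. \<forall>x\<in>grid L m.
     (\<sigma> x)\<^sup>2 / (2 * (mesh L m)\<^sup>2) > \<bar>\<mu> x\<bar> / (2 * mesh L m))"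

definition delta_kernel :: "real \<Rightarrow> nat \<Rightarrow> real \<Rightarrow> real \<Rightarrow> real" where
  "delta_kernel L m x y = (if \<exists>n::int. x - y = 2 * L * of_int n then 1 / mesh L m else 0)"

text \<open>
  \<open>u x y t\<close> solves the forward equation in \<open>y\<close>. Periodicity extends the kernel from the
  representatives in \<open>grid L m\<close> to the neighbours used by the difference operators.
\<close>

definition is_kernel ::
  "real \<Rightarrow> (real \<Rightarrow> real) \<Rightarrow> (real \<Rightarrow> real) \<Rightarrow> nat \<Rightarrow> (real \<Rightarrow> real \<Rightarrow> real \<Rightarrow> real) \<Rightarrow> bool" where
  "is_kernel L \<sigma> \<mu> m u \<longleftrightarrow>
     (\<forall>t>0. (\<forall>y. periodic_fun_simple (\<lambda>x. u x y t) (2 * L)) \<and>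
            (\<forall>x. periodic_fun_simple (\<lambda>y. u x y t) (2 * L))) \<and>
     (\<forall>x\<in>grid L m. \<forall>y\<in>grid L m.
        (\<forall>t>0. ((\<lambda>s. u x y s) has_real_derivative
                  gen_adj L \<sigma> \<mu> m (\<lambda>z. u x z t) y) (at t)) \<and>
        ((\<lambda>t. u x y t) \<longlongrightarrow> delta_kernel L m x y) (at_right 0))"


lemma finite_grid: "finite (grid L m)"
proof (cases "L > 0")
  case False
  then show ?thesis by (auto simp: grid_def)
next
  case True
  have "grid L m \<subseteq> (\<lambda>n::int. mesh L m * of_int n) ` {-(2 ^ m)..2 ^ m}"
  proof
    fix x assume "x \<in> grid L m"
    then obtain n :: int where n: "x = mesh L m * of_int n" and b: "-L \<le> x" "x < L"
      by (auto simp: grid_def)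
    have "L * (- (2 ^ m)) \<le> L * of_int n" "L * of_int n \<le> L * 2 ^ m"
      using b True unfolding n mesh_def by (auto simp: field_simps)
    then have "real_of_int (- (2 ^ m)) \<le> of_int n" "real_of_int n \<le> of_int (2 ^ m)"
      using True by (simp_all only: mult_le_cancel_left_pos) auto
    then have "n \<in> {-(2 ^ m)..2 ^ m}" by (simp only: of_int_le_iff atLeastAtMost_iff)
    then show "x \<in> (\<lambda>n::int. mesh L m * of_int n) ` {-(2 ^ m)..2 ^ m}" using n by blast
  qed
  then show ?thesis by (rule finite_subset) simp
qed

lemma sum_per_unit:
  assumes L: "L > 0" and f: "periodic_fun_simple f (2 * L)"
    and x: "x = mesh L m * of_int i"
  shows "(\<Sum>y\<in>grid L m. per_unit L y x * f y) = f x"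
proof -
  interpret periodic_fun_simple f "2 * L" by (rule f)
  define q :: int where "q = \<lfloor>(x + L) / (2 * L)\<rfloor>"
  define w where "w = x - 2 * L * of_int q"
  have "real_of_int q \<le> (x + L) / (2 * L)" "(x + L) / (2 * L) < of_int q + 1"
    unfolding q_def by linarith+
  then have b: "-L \<le> w" "w < L" unfolding w_def using L by (auto simp: field_simps)
  have "w = mesh L m * of_int (i - 2 * 2 ^ m * q)"
    unfolding w_def x mesh_def using L by (simp add: field_simps)
  then have w: "w \<in> grid L m" unfolding grid_def
    by (simp only: Int_iff mem_Collect_eq atLeastLessThan_iff) (use b in blast)
  have uniq: "per_unit L y x = (if y = w then 1 else 0)" if y: "y \<in> grid L m" for y
  proof (cases "\<exists>n::int. x - y = 2 * L * of_int n")
    case True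
    then obtain n :: int where n: "x - y = 2 * L * of_int n" by blast
    have "\<bar>y - w\<bar> < 2 * L" using b y by (auto simp: grid_def)
    moreover have yw: "y - w = 2 * L * of_int (q - n)" unfolding w_def using n by (simp add: algebra_simps)
    ultimately have "2 * L * \<bar>of_int (q - n)\<bar> < 2 * L * 1" using L by (simp add: abs_mult)
    then have "\<bar>real_of_int (q - n)\<bar> < 1" using L by (simp only: mult_less_cancel_left_pos)
    then have "q - n = 0" by linarith
    then show ?thesis using True yw by (simp add: per_unit_def)
  next
    case False
    then have "y \<noteq> w" unfolding w_def by auto
    then show ?thesis using False by (simp add: per_unit_def)
  qed
  have "f (w + of_int q * (2 * L)) = f w" by (rule plus_of_int)
  then have "f w = f x" unfolding w_def by (simp add: algebra_simps)
  moreover have "(\<Sum>y\<in>grid L m. per_unit L y x * f y) = (\<Sum>y\<in>grid L m. if y = w then f y else 0)"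
    by (rule sum.cong) (auto simp: uniq)
  ultimately show ?thesis using w finite_grid by (simp add: sum.delta)
qed

lemma gen_eq_sum:
  assumes L: "L > 0" and f: "periodic_fun_simple f (2 * L)" and x: "x \<in> grid L m"
  shows "gen L \<sigma> \<mu> m f x = (\<Sum>y\<in>grid L m. gen_mat L \<sigma> \<mu> m x y * f y)"
proof -
  obtain i :: int where i: "x = mesh L m * of_int i" using x by (auto simp: grid_def)
  have s: "f x = (\<Sum>y\<in>grid L m. per_unit L y x * f y)"
    "f (x + mesh L m) = (\<Sum>y\<in>grid L m. per_unit L y (x + mesh L m) * f y)"
    "f (x - mesh L m) = (\<Sum>y\<in>grid L m. per_unit L y (x - mesh L m) * f y)"
    using sum_per_unit[OF L f, of x m i] sum_per_unit[OF L f, of "x + mesh L m" m "i + 1"]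
      sum_per_unit[OF L f, of "x - mesh L m" m "i - 1"] i by (simp_all add: algebra_simps)
  show ?thesis
    unfolding gen_mat_def gen_def lapl_def grad_def s
    by (simp add: sum_distrib_left sum_divide_distrib algebra_simps add_divide_distrib
        diff_divide_distrib sum.distrib sum_subtractf)
qed

text \<open>The kernel exists and is uniquely determined on the grid by \<open>is_kernel\<close>.\<close>

lemma is_kernel_exists: "\<exists>u. is_kernel L \<sigma> \<mu> m u"
proof -
  let ?M = "gen_mat L \<sigma> \<mu> m" and ?G = "grid L m"
  define P where "P = rec_nat (\<lambda>x y. per_unit L y x) (\<lambda>_ Q x y. \<Sum>z\<in>?G. ?M z y * Q x z)"
  have P0: "P 0 = (\<lambda>x y. per_unit L y x)"
    and PS: "P (Suc n) = (\<lambda>x y. \<Sum>z\<in>?G. ?M z y * P n x z)" for n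
    unfolding P_def by simp_all
  define C where "C = (\<Sum>z\<in>?G. \<Sum>y\<in>?G. \<bar>?M z y\<bar>)"
  have bound: "\<bar>P n x y\<bar> \<le> C ^ n" if "y \<in> ?G" for n x y
    using that
  proof (induction n arbitrary: y)
    case 0
    show ?case by (simp add: P0 per_unit_def)
  next
    case (Suc n)
    have "\<bar>P (Suc n) x y\<bar> \<le> (\<Sum>z\<in>?G. \<bar>?M z y\<bar> * \<bar>P n x z\<bar>)"
      unfolding PS by (rule order_trans[OF sum_abs]) (simp add: abs_mult)
    also have "\<dots> \<le> (\<Sum>z\<in>?G. (\<Sum>y\<in>?G. \<bar>?M z y\<bar>) * C ^ n)"
      using Suc finite_grid by (intro sum_mono mult_mono member_le_sum) (auto intro: sum_nonneg)
    also have "\<dots> = C ^ Suc n" by (simp add: C_def sum_distrib_right)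
    finally show ?case .
  qed
  define c where "c x y n = P n x y / fact n" for x y n
  have summ: "summable (\<lambda>n. c x y n * t ^ n)" if "y \<in> ?G" for x y and t :: real
  proof (rule summable_comparison_test')
    show "summable (\<lambda>n. inverse (fact n) * (C * \<bar>t\<bar>) ^ n)" by (rule summable_exp)
    fix n
    show "norm (c x y n * t ^ n) \<le> inverse (fact n) * (C * \<bar>t\<bar>) ^ n"
      using mult_right_mono[OF bound[OF that, of n x], of "\<bar>t\<bar> ^ n / fact n"]
      by (simp add: c_def abs_mult power_abs power_mult_distrib field_simps)
  qed
  define E where "E x y t = (\<Sum>n. c x y n * t ^ n)" for x y t
  have deriv: "((\<lambda>s. E x y s) has_real_derivative (\<Sum>z\<in>?G. ?M z y * E x z t)) (at t)"
    if y: "y \<in> ?G" for x y t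
  proof -
    have "((\<lambda>s. E x y s) has_real_derivative (\<Sum>n. diffs (c x y) n * t ^ n)) (at t)"
      unfolding E_def by (rule termdiffs_strong_converges_everywhere) (rule summ[OF y])
    also have "(\<lambda>n. diffs (c x y) n * t ^ n) = (\<lambda>n. \<Sum>z\<in>?G. ?M z y * (c x z n * t ^ n))"
    proof
      fix n
      have "diffs (c x y) n = P (Suc n) x y / fact n"
        unfolding diffs_def c_def fact_Suc by (simp del: of_nat_Suc)
      then show "diffs (c x y) n * t ^ n = (\<Sum>z\<in>?G. ?M z y * (c x z n * t ^ n))"
        by (simp add: c_def PS sum_distrib_right sum_divide_distrib mult.assoc)
    qed
    also have "(\<Sum>n. \<Sum>z\<in>?G. ?M z y * (c x z n * t ^ n)) = (\<Sum>z\<in>?G. ?M z y * E x z t)"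
      unfolding E_def by (subst suminf_sum) (auto intro!: summable_mult summ suminf_mult sum.cong)
    finally show ?thesis .
  qed
  have E0: "E x y 0 = per_unit L y x" for x y
    unfolding E_def powser_zero by (simp add: c_def P0)
  have shift: "(\<exists>n::int. a + 2 * L = 2 * L * of_int n) \<longleftrightarrow> (\<exists>n::int. a = 2 * L * of_int n)" for a
  proof
    assume "\<exists>n::int. a + 2 * L = 2 * L * of_int n"
    then obtain n :: int where "a + 2 * L = 2 * L * of_int n" by blast
    then have "a = 2 * L * of_int (n - 1)" by (simp add: algebra_simps)
    then show "\<exists>n::int. a = 2 * L * of_int n" by blast
  next
    assume "\<exists>n::int. a = 2 * L * of_int n"
    then obtain n :: int where "a = 2 * L * of_int n" by blast
    then have "a + 2 * L = 2 * L * of_int (n + 1)" by (simp add: algebra_simps)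
    then show "\<exists>n::int. a + 2 * L = 2 * L * of_int n" by blast
  qed
  have ux: "per_unit L y (x + 2 * L) = per_unit L y x" for x y
    using shift[of "x - y"] by (simp add: per_unit_def algebra_simps)
  have uy: "per_unit L (y + 2 * L) = per_unit L y" for y
  proof
    fix x
    have "x - (y + 2 * L) + 2 * L = x - y" by simp
    then show "per_unit L (y + 2 * L) x = per_unit L y x"
      using shift[of "x - (y + 2 * L)"] by (simp add: per_unit_def)
  qed
  have Px: "P n (x + 2 * L) y = P n x y" for n x y
    by (induction n arbitrary: y) (simp_all add: P0 PS ux)
  have Py: "P n x (y + 2 * L) = P n x y" for n x y
    by (cases n) (simp_all add: P0 PS uy gen_mat_def)
  define u where "u x y t = E x y t / mesh L m" for x y t
  have "is_kernel L \<sigma> \<mu> m u"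
    unfolding is_kernel_def
  proof (intro conjI ballI allI impI)
    show "periodic_fun_simple (\<lambda>x. u x y t) (2 * L)" for y t
      by standard (simp add: u_def E_def c_def Px)
    show "periodic_fun_simple (\<lambda>y. u x y t) (2 * L)" for x t
      by standard (simp add: u_def E_def c_def Py)
    fix x y assume y: "y \<in> ?G"
    show "((\<lambda>s. u x y s) has_real_derivative gen_adj L \<sigma> \<mu> m (\<lambda>z. u x z t) y) (at t)" for t
      using DERIV_cdivide[OF deriv[OF y], of x "mesh L m" t]
      by (simp add: u_def gen_adj_def sum_divide_distrib)
    have "isCont (\<lambda>s. E x y s) 0" by (rule DERIV_isCont[OF deriv[OF y]])
    then have "((\<lambda>s. E x y s) \<longlongrightarrow> per_unit L y x) (at_right 0)"
      unfolding isCont_def E0 by (rule tendsto_within_subset) simp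
    then have "((\<lambda>s. E x y s * (1 / mesh L m)) \<longlongrightarrow> per_unit L y x * (1 / mesh L m)) (at_right 0)"
      by (intro tendsto_intros)
    then show "((\<lambda>s. u x y s) \<longlongrightarrow> delta_kernel L m x y) (at_right 0)"
      by (simp add: u_def delta_kernel_def per_unit_def split: if_splits)
  qed
  then show ?thesis by blast
qed

lemma is_kernel_unique:
  assumes u: "is_kernel L \<sigma> \<mu> m u" and v: "is_kernel L \<sigma> \<mu> m v"
    and x: "x \<in> grid L m" and y: "y \<in> grid L m" and t: "t > 0"
  shows "u x y t = v x y t"
proof -
  let ?M = "gen_mat L \<sigma> \<mu> m" and ?G = "grid L m"
  define w where "w y s = u x y s - v x y s" for y s
  define C where "C = (\<Sum>z\<in>?G. \<Sum>y\<in>?G. \<bar>?M z y\<bar>)"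
  define F where "F s = (\<Sum>y\<in>?G. (w y s)\<^sup>2)" for s
  define F' where "F' s = (\<Sum>y\<in>?G. 2 * w y s * (\<Sum>z\<in>?G. ?M z y * w z s))" for s
  have C0: "C \<ge> 0" unfolding C_def by (intro sum_nonneg) auto
  have dw: "((\<lambda>s. w y s) has_real_derivative (\<Sum>z\<in>?G. ?M z y * w z s)) (at s)"
    if "y \<in> ?G" "s > 0" for y s
  proof -
    have "((\<lambda>s. w y s) has_real_derivative
        gen_adj L \<sigma> \<mu> m (\<lambda>z. u x z s) y - gen_adj L \<sigma> \<mu> m (\<lambda>z. v x z s) y) (at s)"
      unfolding w_def using u v x that unfolding is_kernel_def by (intro DERIV_diff) auto
    then show ?thesis
      by (simp add: gen_adj_def w_def algebra_simps sum_subtractf)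
  qed
  have w0: "((\<lambda>s. w y s) \<longlongrightarrow> 0) (at_right 0)" if "y \<in> ?G" for y
  proof -
    have "((\<lambda>s. w y s) \<longlongrightarrow> delta_kernel L m x y - delta_kernel L m x y) (at_right 0)"
      unfolding w_def using u v x that unfolding is_kernel_def by (intro tendsto_diff) auto
    then show ?thesis by simp
  qed
  have dF: "(F has_real_derivative F' s) (at s)" if "s > 0" for s
  proof -
    have "((\<lambda>s. \<Sum>y\<in>?G. (w y s)\<^sup>2) has_real_derivative F' s) (at s)"
      unfolding F'_def
      by (rule DERIV_sum) (auto intro!: derivative_eq_intros dw that)
    then show ?thesis unfolding F_def .
  qed
  have F'le: "F' s \<le> 2 * C * F s" for s
  proof -
    have le: "w y s * w z s \<le> F s" "- (w y s * w z s) \<le> F s" if "y \<in> ?G" "z \<in> ?G" for y z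
    proof -
      have sq: "(w y s)\<^sup>2 \<le> F s" "(w z s)\<^sup>2 \<le> F s"
        unfolding F_def using that finite_grid by (auto intro!: member_le_sum[where f = "\<lambda>y. (w y s)\<^sup>2"])
      have "0 \<le> (w y s - w z s)\<^sup>2" "0 \<le> (w y s + w z s)\<^sup>2" by simp_all
      then show "w y s * w z s \<le> F s" "- (w y s * w z s) \<le> F s"
        using sq by (auto simp: power2_eq_square algebra_simps)
    qed
    have "F' s = (\<Sum>y\<in>?G. \<Sum>z\<in>?G. 2 * (?M z y * (w y s * w z s)))"
      unfolding F'_def by (simp add: sum_distrib_left mult_ac)
    also have "\<dots> \<le> (\<Sum>y\<in>?G. \<Sum>z\<in>?G. 2 * (\<bar>?M z y\<bar> * F s))"
    proof (intro sum_mono mult_left_mono)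
      fix y z assume yz: "y \<in> ?G" "z \<in> ?G"
      have "?M z y * (w y s * w z s) \<le> \<bar>?M z y\<bar> * \<bar>w y s * w z s\<bar>"
        using abs_ge_self[of "?M z y * (w y s * w z s)"] by (simp add: abs_mult)
      also have "\<dots> \<le> \<bar>?M z y\<bar> * F s" using le[OF yz] by (intro mult_left_mono) auto
      finally show "?M z y * (w y s * w z s) \<le> \<bar>?M z y\<bar> * F s" .
    qed simp
    also have "\<dots> = (\<Sum>z\<in>?G. \<Sum>y\<in>?G. 2 * (\<bar>?M z y\<bar> * F s))" by (rule sum.swap)
    also have "\<dots> = 2 * C * F s" by (simp add: C_def sum_distrib_left sum_distrib_right mult_ac)
    finally show ?thesis .
  qed
  define H where "H s = F s * exp (- (2 * C * s))" for s
  have dH: "(H has_real_derivative (F' s - 2 * C * F s) * exp (- (2 * C * s))) (at s)" if "s > 0" for s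
    unfolding H_def by (auto intro!: derivative_eq_intros dF that simp: algebra_simps)
  have dec: "H t \<le> H s" if "0 < s" "s \<le> t" for s
  proof (rule DERIV_nonpos_imp_nonincreasing[OF that(2)])
    fix r assume "s \<le> r" "r \<le> t"
    then have "r > 0" using that by simp
    from dH[OF this] F'le[of r] show "\<exists>y. (H has_real_derivative y) (at r) \<and> y \<le> 0"
      by (intro exI conjI) (auto intro!: mult_nonpos_nonneg)
  qed
  have "((\<lambda>s. \<Sum>y\<in>?G. (w y s)\<^sup>2) \<longlongrightarrow> (\<Sum>y\<in>?G. 0\<^sup>2)) (at_right 0)"
    by (intro tendsto_sum tendsto_power w0)
  then have "(F \<longlongrightarrow> 0) (at_right 0)" unfolding F_def by simp
  moreover have "((\<lambda>s. exp (- (2 * C * s))) \<longlongrightarrow> exp (- (2 * C * 0))) (at_right 0)"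
    by (intro tendsto_intros)
  ultimately have "(H \<longlongrightarrow> 0 * exp (- (2 * C * 0))) (at_right 0)"
    unfolding H_def by (rule tendsto_mult)
  then have lim: "(H \<longlongrightarrow> 0) (at_right 0)" by simp
  have "\<forall>\<^sub>F s in at_right 0. H t \<le> H s"
    using eventually_at_right_less[of 0] eventually_at_right_real[OF t]
    by eventually_elim (auto intro: dec)
  then have "H t \<le> 0" by (intro tendsto_lowerbound[OF lim]) auto
  then have "F t \<le> 0" unfolding H_def by (simp add: mult_le_0_iff)
  moreover have "(w y t)\<^sup>2 \<le> F t"
    unfolding F_def using y finite_grid by (auto intro!: member_le_sum[where f = "\<lambda>y. (w y t)\<^sup>2"])
  ultimately have "(w y t)\<^sup>2 \<le> 0" by linarith
  then show ?thesis by (simp add: w_def)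
qed

end

theory Submission
  imports Defs
begin

text \<open>
  With \<open>a = \<sigma>\<^sup>2 / 2\<close> and \<open>b = \<mu> / a\<close> the generator is \<open>a (\<Delta> + b \<nabla>)\<close>. In the inner product with weight
  \<open>1 / a\<close>, the energies \<open>X v = \<parallel>v\<parallel>\<^sup>2\<close>, \<open>Y v = \<parallel>\<partial>v\<parallel>\<^sup>2\<close> of a solution of the backward equation satisfy
  \<open>X' \<le> \<kappa> X - Y\<close> and \<open>Y' \<le> \<kappa> Y - X (\<partial>\<^sub>t v)\<close>, with constants that do not depend on the mesh and
  without any regularity of the coefficients. Since \<open>\<partial>\<^sub>t v\<close> is again a solution, these inequalities
  bound all time derivatives of the kernels at positive times, and, applied to the time integral
  of a kernel, they control the singularity at time zero.

  To compare a coarse and a fine grid, average the backward equation \<open>(1 / a) \<partial>\<^sub>t u = \<Delta>u + b \<nabla>u\<close> of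
  the fine kernel against coarse hat functions: the average of the fine Laplacian is exactly the
  coarse Laplacian of the restriction, and the average of the fine delta function is the coarse one.
  What remains are errors of averaging products with \<open>1 / a\<close> and \<open>b\<close>, which are of order \<open>h\<^sup>\<gamma>\<close>.
  Pairing with the coarse kernel (Duhamel), the errors on the first half of \<open>[0, t]\<close> are integrated
  by parts in time onto the smooth coarse kernel; on the second half the fine kernel is smooth, and
  the coarse kernel has an integrable \<open>L\<^sup>1\<close> norm.
\<close>

section \<open>Periodic grid functions\<close>

text \<open>The obstacle is that the coefficients may be merely Hoelder continuous, so the equation
  cannot be differenced in space. This explains the non-divergence form with weight
  \<open>1 / a\<close>: testing with \<open>v / a\<close> leaves the bare Laplacian, and summation
  by parts never touches \<open>a\<close>. Smoothness in space is bought with time derivatives,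
  because the equation expresses \<open>lp\<close> through \<open>A v\<close> and the gradient. In
  the forward variable only the product of \<open>a\<close> and the kernel is Lipschitz, and norms
  come from duality. The order \<gamma>, up to 2, comes from symmetry: averaging over a hat sees a
  coefficient through its symmetric second differences, of order \<open>h\<^sup>\<gamma>\<close>,
  and through its increments, which are always multiplied by a second small factor. In one dimension
  the energy controls point values, so a delta source becomes admissible after one integration in
  time; the remaining singularities are of the integrable size \<open>1 / sqrt s\<close>. Grid
  functions are periodic functions on all integers, so neighbours and congruent points need no case
  distinction.\<close>

definition per :: "int \<Rightarrow> (int \<Rightarrow> real) \<Rightarrow> bool" where
  "per N f \<longleftrightarrow> (\<forall>i. f (i + N) = f i)"

text \<open>The one-sided difference carries the Dirichlet energy of \<open>lp\<close>; the central
  difference of the drift cannot, since it vanishes on oscillations of period two.\<close>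

definition fd :: "real \<Rightarrow> (int \<Rightarrow> real) \<Rightarrow> int \<Rightarrow> real" where
  "fd h f i = (f (i + 1) - f i) / h"

definition cd :: "real \<Rightarrow> (int \<Rightarrow> real) \<Rightarrow> int \<Rightarrow> real" where
  "cd h f i = (f (i + 1) - f (i - 1)) / (2 * h)"

definition lp :: "real \<Rightarrow> (int \<Rightarrow> real) \<Rightarrow> int \<Rightarrow> real" where
  "lp h f i = (f (i + 1) + f (i - 1) - 2 * f i) / h\<^sup>2"

lemma perD: "per N f \<Longrightarrow> f (i + N) = f i"
  by (simp add: per_def)

lemma per_shift: "per N f \<Longrightarrow> per N (\<lambda>i. f (i + k))"
  unfolding per_def by (metis add.assoc add.commute)

lemma per_shift': "per N f \<Longrightarrow> per N (\<lambda>i. f (i - k))"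
  using per_shift[of N f "- k"] by simp

lemma per_const: "per N (\<lambda>i. c)"
  by (simp add: per_def)

lemma per_comp2: "per N f \<Longrightarrow> per N g \<Longrightarrow> per N (\<lambda>i. F (f i) (g i))"
  by (simp add: per_def)

lemma per_comp1: "per N f \<Longrightarrow> per N (\<lambda>i. F (f i))"
  by (simp add: per_def)

lemma per_mult: "per N f \<Longrightarrow> per N g \<Longrightarrow> per N (\<lambda>i. f i * g i)"
  by (rule per_comp2)

lemma per_fd: "per N f \<Longrightarrow> per N (fd h f)"
  and per_cd: "per N f \<Longrightarrow> per N (cd h f)"
  and per_lp: "per N f \<Longrightarrow> per N (lp h f)"
proof -
  assume f: "per N f"
  have "f (i + N + 1) = f (i + 1)" "f (i + N - 1) = f (i - 1)" for i
    using perD[OF per_shift[OF f, of 1]] perD[OF per_shift'[OF f, of 1]] by simp_all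
  then show "per N (fd h f)" "per N (cd h f)" "per N (lp h f)"
    using f by (simp_all add: per_def fd_def cd_def lp_def)
qed

lemma per_mult_int: "per N f \<Longrightarrow> f (i + N * k) = f i"
proof (induction k rule: int_induct[where k = 0])
  case base
  then show ?case by simp
next
  case (step1 k)
  then have "f (i + N * k + N) = f i" by (metis perD)
  then show ?case by (simp add: algebra_simps)
next
  case (step2 k)
  have "f (i + N * (k - 1) + N) = f (i + N * (k - 1))" using step2(3) by (rule perD)
  then show ?case using step2 by (simp add: algebra_simps)
qed

lemma per_mod: "per N f \<Longrightarrow> f (i mod N) = f i"
  using per_mult_int[of N f "i mod N" "i div N"] by simp

section \<open>Sums over one period and summation by parts\<close>

lemma psum_shift:
  assumes "0 < N" "per N f"
  shows "(\<Sum>i\<in>{0..<N}. f (i + k)) = (\<Sum>i\<in>{0..<N}. f i)"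
proof (rule sum.reindex_bij_witness[of _ "\<lambda>j. (j - k) mod N" "\<lambda>i. (i + k) mod N"])
  fix i assume "i \<in> {0..<N}"
  then show "((i + k) mod N - k) mod N = i" "((i - k) mod N + k) mod N = i"
    by (simp_all add: mod_simps)
  show "(i + k) mod N \<in> {0..<N}" "(i - k) mod N \<in> {0..<N}" using assms by auto
  show "f ((i + k) mod N) = f (i + k)" using assms by (intro per_mod)
qed

lemma psum_shift':
  assumes "0 < N" "per N f"
  shows "(\<Sum>i\<in>{0..<N}. f (i - k)) = (\<Sum>i\<in>{0..<N}. f i)"
  using psum_shift[OF assms, of "- k"] by simp

text \<open>The difference of the two sides splits into two pairs of sums that are shifts of each
  other by one index, and shifts do not change a sum over a full period.\<close>

lemma psum_lp_parts:
  assumes N: "0 < N" and f: "per N f" and g: "per N g"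
  shows "(\<Sum>i\<in>{0..<N}. f i * lp h g i) = - (\<Sum>i\<in>{0..<N}. fd h f i * fd h g i)"
proof -
  have 1: "(\<Sum>i\<in>{0..<N}. f (i + 1) * g i) = (\<Sum>i\<in>{0..<N}. f i * g (i - 1))"
    using psum_shift[OF N per_mult[OF f per_shift'[OF g, of 1]], of 1] by simp
  have 2: "(\<Sum>i\<in>{0..<N}. f (i + 1) * g (i + 1)) = (\<Sum>i\<in>{0..<N}. f i * g i)"
    using psum_shift[OF N per_mult[OF f g], of 1] .
  have "(\<Sum>i\<in>{0..<N}. f i * lp h g i) + (\<Sum>i\<in>{0..<N}. fd h f i * fd h g i)
    = ((\<Sum>i\<in>{0..<N}. f i * g (i - 1)) - (\<Sum>i\<in>{0..<N}. f (i + 1) * g i)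
      + ((\<Sum>i\<in>{0..<N}. f (i + 1) * g (i + 1)) - (\<Sum>i\<in>{0..<N}. f i * g i))) / h\<^sup>2"
    unfolding sum_subtractf[symmetric] sum.distrib[symmetric] sum_divide_distrib
    by (rule sum.cong) (auto simp: lp_def fd_def power2_eq_square algebra_simps
        add_divide_distrib diff_divide_distrib)
  then show ?thesis using 1 2 by simp
qed

lemma psum_lp_sym:
  assumes "0 < N" "per N f" "per N g"
  shows "(\<Sum>i\<in>{0..<N}. f i * lp h g i) = (\<Sum>i\<in>{0..<N}. lp h f i * g i)"
  using psum_lp_parts[OF assms, of h] psum_lp_parts[OF assms(1,3,2), of h] by (simp add: mult.commute)

lemma psum_cd_parts:
  assumes N: "0 < N" and f: "per N f" and g: "per N g"
  shows "(\<Sum>i\<in>{0..<N}. f i * cd h g i) = - (\<Sum>i\<in>{0..<N}. cd h f i * g i)"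
proof -
  have 1: "(\<Sum>i\<in>{0..<N}. f (i + 1) * g i) = (\<Sum>i\<in>{0..<N}. f i * g (i - 1))"
    using psum_shift[OF N per_mult[OF f per_shift'[OF g, of 1]], of 1] by simp
  have 2: "(\<Sum>i\<in>{0..<N}. g (i + 1) * f i) = (\<Sum>i\<in>{0..<N}. g i * f (i - 1))"
    using psum_shift[OF N per_mult[OF g per_shift'[OF f, of 1]], of 1] by simp
  have "(\<Sum>i\<in>{0..<N}. f i * cd h g i) + (\<Sum>i\<in>{0..<N}. cd h f i * g i)
    = (((\<Sum>i\<in>{0..<N}. g (i + 1) * f i) - (\<Sum>i\<in>{0..<N}. g i * f (i - 1)))
      + ((\<Sum>i\<in>{0..<N}. f (i + 1) * g i) - (\<Sum>i\<in>{0..<N}. f i * g (i - 1)))) / (2 * h)"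
    unfolding sum_subtractf[symmetric] sum.distrib[symmetric] sum_divide_distrib
    by (rule sum.cong) (auto simp: cd_def algebra_simps add_divide_distrib diff_divide_distrib)
  then show ?thesis using 1 2 by simp
qed

text \<open>The central difference is the mean of two neighbouring one-sided ones, so convexity of
  the square suffices. The constant 1 matters: it lets the drift be absorbed by half of the
  dissipation.\<close>

lemma psum_cd_le_fd:
  assumes N: "0 < N" and f: "per N f"
  shows "(\<Sum>i\<in>{0..<N}. (cd h f i)\<^sup>2) \<le> (\<Sum>i\<in>{0..<N}. (fd h f i)\<^sup>2)"
proof -
  have "(cd h f i)\<^sup>2 \<le> ((fd h f i)\<^sup>2 + (fd h f (i - 1))\<^sup>2) / 2" for i
  proof -
    have e: "cd h f i = (fd h f i + fd h f (i - 1)) / 2"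
      by (simp add: cd_def fd_def add_divide_distrib[symmetric])
    have "0 \<le> (fd h f i - fd h f (i - 1))\<^sup>2" by simp
    then show ?thesis unfolding e by (simp add: power2_eq_square field_simps)
  qed
  then have "(\<Sum>i\<in>{0..<N}. (cd h f i)\<^sup>2) \<le> (\<Sum>i\<in>{0..<N}. ((fd h f i)\<^sup>2 + (fd h f (i - 1))\<^sup>2) / 2)"
    by (rule sum_mono)
  also have "\<dots> = ((\<Sum>i\<in>{0..<N}. (fd h f i)\<^sup>2) + (\<Sum>i\<in>{0..<N}. (fd h f (i - 1))\<^sup>2)) / 2"
    by (simp add: sum.distrib sum_divide_distrib[symmetric])
  also have "(\<Sum>i\<in>{0..<N}. (fd h f (i - 1))\<^sup>2) = (\<Sum>i\<in>{0..<N}. (fd h f i)\<^sup>2)"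
    using psum_shift'[OF N per_comp1[OF per_fd[OF f]], of "\<lambda>x. x\<^sup>2"] .
  finally show ?thesis by simp
qed

section \<open>Sup bounds by total variation\<close>

lemma telescope_abs_le:
  fixes f :: "int \<Rightarrow> real"
  assumes "i \<le> j"
  shows "\<bar>f j - f i\<bar> \<le> (\<Sum>l\<in>{i..<j}. \<bar>f (l + 1) - f l\<bar>)"
  using assms
proof (induction rule: int_ge_induct)
  case base
  then show ?case by simp
next
  case (step j)
  have "{i..<j + 1} = insert j {i..<j}" using step by auto
  then show ?case using step by simp
qed

lemma per_osc:
  assumes N: "0 < N" and f: "per N f"
  shows "\<bar>f i - f j\<bar> \<le> (\<Sum>l\<in>{0..<N}. \<bar>f (l + 1) - f l\<bar>)"
proof -
  have le: "\<bar>f y - f x\<bar> \<le> (\<Sum>l\<in>{0..<N}. \<bar>f (l + 1) - f l\<bar>)" if "0 \<le> x" "x \<le> y" "y < N" for x y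
  proof -
    have "\<bar>f y - f x\<bar> \<le> (\<Sum>l\<in>{x..<y}. \<bar>f (l + 1) - f l\<bar>)" by (rule telescope_abs_le[OF that(2)])
    also have "\<dots> \<le> (\<Sum>l\<in>{0..<N}. \<bar>f (l + 1) - f l\<bar>)" using that by (intro sum_mono2) auto
    finally show ?thesis .
  qed
  have "\<bar>f (i mod N) - f (j mod N)\<bar> \<le> (\<Sum>l\<in>{0..<N}. \<bar>f (l + 1) - f l\<bar>)"
    using le[of "i mod N" "j mod N"] le[of "j mod N" "i mod N"] N
    by (cases "i mod N \<le> j mod N") (auto simp: abs_minus_commute)
  then show ?thesis using per_mod[OF f] by simp
qed

text \<open>With mean zero, \<open>f i\<close> is the average over \<open>j\<close> of
  \<open>f i - f j\<close>, and each of these differences is at most the total variation.\<close>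

lemma per_mean_zero_bound:
  assumes N: "0 < N" and f: "per N f" and z: "(\<Sum>i\<in>{0..<N}. f i) = 0"
  shows "\<bar>f i\<bar> \<le> (\<Sum>l\<in>{0..<N}. \<bar>f (l + 1) - f l\<bar>)"
proof -
  let ?D = "\<Sum>l\<in>{0..<N}. \<bar>f (l + 1) - f l\<bar>"
  have "of_int N * f i = (\<Sum>j\<in>{0..<N}. f i - f j)" using z N by (simp add: sum_subtractf)
  then have "of_int N * \<bar>f i\<bar> = \<bar>\<Sum>j\<in>{0..<N}. f i - f j\<bar>" using N by (metis abs_mult abs_of_nonneg less_imp_le of_int_0_le_iff)
  also have "\<dots> \<le> (\<Sum>j\<in>{0..<N}. ?D)" by (rule order_trans[OF sum_abs sum_mono]) (rule per_osc[OF N f])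
  also have "\<dots> = of_int N * ?D" using N by simp
  finally show ?thesis using N by simp
qed

lemma psum_abs_sq_le:
  fixes f :: "int \<Rightarrow> real"
  assumes N: "0 < N"
  shows "(\<Sum>i\<in>{0..<N}. \<bar>f i\<bar>)\<^sup>2 \<le> of_int N * (\<Sum>i\<in>{0..<N}. (f i)\<^sup>2)"
  using sum_squared_le_sum_of_squares[of "\<lambda>i. \<bar>f i\<bar>" "{0..<N}"] N by (simp add: mult.commute)

text \<open>Discrete embedding of functions of bounded variation into bounded functions: mean of the
  absolute value plus total variation.\<close>

lemma per_sup_bound:
  assumes N: "0 < N" and f: "per N f"
  shows "\<bar>f i\<bar> \<le> (\<Sum>j\<in>{0..<N}. \<bar>f j\<bar>) / of_int N + (\<Sum>l\<in>{0..<N}. \<bar>f (l + 1) - f l\<bar>)"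
proof -
  let ?D = "\<Sum>l\<in>{0..<N}. \<bar>f (l + 1) - f l\<bar>"
  have "of_int N * \<bar>f i\<bar> = (\<Sum>j\<in>{0..<N}. \<bar>f i\<bar>)" using N by simp
  also have "\<dots> \<le> (\<Sum>j\<in>{0..<N}. \<bar>f j\<bar> + ?D)"
  proof (rule sum_mono)
    fix j show "\<bar>f i\<bar> \<le> \<bar>f j\<bar> + ?D" using per_osc[OF N f, of i j] by linarith
  qed
  also have "\<dots> = (\<Sum>j\<in>{0..<N}. \<bar>f j\<bar>) + of_int N * ?D" using N by (simp add: sum.distrib)
  finally show ?thesis using N by (simp add: field_simps)
qed

text \<open>The quantity \<open>exp (- c s) (x s + (s - s0) y s)\<close> is nonincreasing.\<close>

lemma dissipation_decay:
  fixes x y x' y' :: "real \<Rightarrow> real"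
  assumes le: "s0 \<le> s1"
    and cx: "continuous_on {s0..s1} x" and cy: "continuous_on {s0..s1} y"
    and dx: "\<And>s. s0 < s \<Longrightarrow> s < s1 \<Longrightarrow> (x has_real_derivative x' s) (at s)"
    and dy: "\<And>s. s0 < s \<Longrightarrow> s < s1 \<Longrightarrow> (y has_real_derivative y' s) (at s)"
    and ix: "\<And>s. s0 < s \<Longrightarrow> s < s1 \<Longrightarrow> x' s \<le> c * x s - y s"
    and iy: "\<And>s. s0 < s \<Longrightarrow> s < s1 \<Longrightarrow> y' s \<le> c * y s"
  shows "x s1 + (s1 - s0) * y s1 \<le> exp (c * (s1 - s0)) * x s0"
proof -
  define F where "F s = exp (- c * (s - s0)) * (x s + (s - s0) * y s)" for s
  have "F s1 \<le> F s0"
  proof (rule DERIV_nonpos_imp_decreasing_open[OF le])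
    show "continuous_on {s0..s1} F" unfolding F_def by (intro continuous_intros cx cy)
    fix s assume s: "s0 < s" "s < s1"
    \<comment> \<open>Differentiating the factor \<open>s - s0\<close> produces one extra
      \<open>y s\<close>, which the dissipation \<open>- y s\<close> in the assumption on
      \<open>x'\<close> pays for.\<close>
    have "(F has_real_derivative exp (- c * (s - s0)) *
        ((x' s - (c * x s - y s)) + (s - s0) * (y' s - c * y s))) (at s)"
      unfolding F_def by (auto intro!: derivative_eq_intros dx dy s simp: algebra_simps)
    moreover have "exp (- c * (s - s0)) *
        ((x' s - (c * x s - y s)) + (s - s0) * (y' s - c * y s)) \<le> 0"
      using ix[OF s] iy[OF s] s
      by (intro mult_nonneg_nonpos add_nonpos_nonpos) auto
    ultimately show "\<exists>y. (F has_real_derivative y) (at s) \<and> y \<le> 0" by blast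
  qed
  then have "exp (- c * (s1 - s0)) * (x s1 + (s1 - s0) * y s1) \<le> x s0" by (simp add: F_def)
  then have "exp (c * (s1 - s0)) * (exp (- c * (s1 - s0)) * (x s1 + (s1 - s0) * y s1))
      \<le> exp (c * (s1 - s0)) * x s0" by (rule mult_left_mono) simp
  then show ?thesis by (simp add: mult.assoc[symmetric] exp_add[symmetric])
qed

section \<open>Energy estimates for the backward equation\<close>

definition Aop :: "real \<Rightarrow> (int \<Rightarrow> real) \<Rightarrow> (int \<Rightarrow> real) \<Rightarrow> (int \<Rightarrow> real) \<Rightarrow> int \<Rightarrow> real" where
  "Aop h a b f i = a i * (lp h f i + b i * cd h f i)"

text \<open>Transpose of \<open>Aop\<close> for the unweighted sum over a period: the coefficients
  now stand inside the differences, which is why estimates are made for \<open>Aop\<close>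
  first.\<close>

definition Adj :: "real \<Rightarrow> (int \<Rightarrow> real) \<Rightarrow> (int \<Rightarrow> real) \<Rightarrow> (int \<Rightarrow> real) \<Rightarrow> int \<Rightarrow> real" where
  "Adj h a b f i = lp h (\<lambda>i. a i * f i) i - cd h (\<lambda>i. a i * b i * f i) i"

definition Xn :: "int \<Rightarrow> real \<Rightarrow> (int \<Rightarrow> real) \<Rightarrow> (int \<Rightarrow> real) \<Rightarrow> real" where
  "Xn N h a f = h * (\<Sum>i\<in>{0..<N}. (f i)\<^sup>2 / a i)"

definition Yn :: "int \<Rightarrow> real \<Rightarrow> (int \<Rightarrow> real) \<Rightarrow> real" where
  "Yn N h f = h * (\<Sum>i\<in>{0..<N}. (fd h f i)\<^sup>2)"

text \<open>The periodic delta function with mass one for sums weighted by \<open>h\<close>;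
  divisibility expresses equality of points on the circle.\<close>

definition unit_at :: "int \<Rightarrow> real \<Rightarrow> int \<Rightarrow> int \<Rightarrow> real" where
  "unit_at N h j i = (if N dvd i - j then 1 / h else 0)"

lemma per_unit_at: "per N (unit_at N h j)"
proof -
  have "N dvd i + N - j \<longleftrightarrow> N dvd i - j" for i
    using dvd_add_left_iff[of N N "i - j"] by (simp add: algebra_simps)
  then show ?thesis by (simp add: per_def unit_at_def)
qed

lemma unit_at_sym: "unit_at N h j i = unit_at N h i j"
  by (simp add: unit_at_def dvd_diff_commute)

lemma psum_unit_at:
  assumes N: "0 < N" and f: "per N f"
  shows "(\<Sum>i\<in>{0..<N}. unit_at N h j i * f i) = f j / h"
proof -
  have "unit_at N h j i * f i = (if i = j mod N then f j / h else 0)" if "i \<in> {0..<N}" for i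
  proof (cases "N dvd i - j")
    case True
    then have "i mod N = j mod N" by (simp add: mod_eq_dvd_iff)
    then have "i = j mod N" using that by simp
    then show ?thesis using True per_mod[OF f, of j] by (simp add: unit_at_def)
  next
    case False
    then have "i mod N \<noteq> j mod N" by (simp add: mod_eq_dvd_iff)
    then show ?thesis using False that by (auto simp: unit_at_def)
  qed
  then have "(\<Sum>i\<in>{0..<N}. unit_at N h j i * f i) = (\<Sum>i\<in>{0..<N}. if i = j mod N then f j / h else 0)"
    by (rule sum.cong[OF refl])
  also have "\<dots> = f j / h" using N by simp
  finally show ?thesis .
qed

text \<open>The mesh enters later bounds only through \<open>N h = len\<close>. Constants built from
  \<open>len\<close>, \<open>a0\<close>, \<open>a1\<close> and \<open>B\<close> therefore serve all
  grids at once.\<close>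

locale scheme =
  fixes N :: int and h len a0 a1 B :: real and a b :: "int \<Rightarrow> real"
  assumes N_pos: "0 < N" and h_pos: "0 < h" and len: "of_int N * h = len"
    and per_a: "per N a" and per_b: "per N b"
    and a0_pos: "0 < a0" and a_ge: "a0 \<le> a i" and a_le: "a i \<le> a1" and b_le: "\<bar>b i\<bar> \<le> B"
begin

lemma a_pos: "0 < a i"
  using a0_pos a_ge[of i] by linarith

lemma a_nz: "a i \<noteq> 0"
  using a_pos[of i] by simp

lemma a1_pos: "0 < a1"
  using a_pos[of 0] a_le[of 0] by linarith

lemma B_nonneg: "0 \<le> B"
  using b_le[of 0] by linarith

lemma len_pos: "0 < len"
  using len N_pos h_pos by (metis of_int_0_less_iff zero_less_mult_iff)

abbreviation A where "A \<equiv> Aop h a b"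
abbreviation A' where "A' \<equiv> Adj h a b"
abbreviation X where "X \<equiv> Xn N h a"
abbreviation Y where "Y \<equiv> Yn N h"
text \<open>The growth rate left over when Young's inequality absorbs the drift; it is the same in
  both energy inequalities.\<close>

abbreviation \<kappa> where "\<kappa> \<equiv> B\<^sup>2 * a1"

lemma per_A: "per N f \<Longrightarrow> per N (A f)"
  using per_a per_b per_lp[of N f h] per_cd[of N f h] by (simp add: per_def Aop_def)

lemma per_A': "per N f \<Longrightarrow> per N (A' f)"
  using per_lp[OF per_mult[OF per_a, of f], of h]
    per_cd[OF per_mult[OF per_mult[OF per_a per_b], of f], of h]
  by (simp add: per_def Adj_def)

lemma X_nonneg: "0 \<le> X f"
  unfolding Xn_def using h_pos a_pos by (intro mult_nonneg_nonneg sum_nonneg divide_nonneg_pos) auto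

lemma Y_nonneg: "0 \<le> Y f"
  unfolding Yn_def using h_pos by (intro mult_nonneg_nonneg sum_nonneg) auto

lemma adjoint:
  assumes f: "per N f" and g: "per N g"
  shows "(\<Sum>i\<in>{0..<N}. f i * A g i) = (\<Sum>i\<in>{0..<N}. A' f i * g i)"
proof -
  have "(\<Sum>i\<in>{0..<N}. f i * A g i) = (\<Sum>i\<in>{0..<N}. (a i * f i) * lp h g i)
      + (\<Sum>i\<in>{0..<N}. (a i * b i * f i) * cd h g i)"
    unfolding sum.distrib[symmetric] by (rule sum.cong) (auto simp: Aop_def algebra_simps)
  also have "(\<Sum>i\<in>{0..<N}. (a i * f i) * lp h g i) = (\<Sum>i\<in>{0..<N}. lp h (\<lambda>i. a i * f i) i * g i)"
    by (rule psum_lp_sym[OF N_pos per_mult[OF per_a f] g])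
  also have "(\<Sum>i\<in>{0..<N}. (a i * b i * f i) * cd h g i)
      = - (\<Sum>i\<in>{0..<N}. cd h (\<lambda>i. a i * b i * f i) i * g i)"
    by (rule psum_cd_parts[OF N_pos per_mult[OF per_mult[OF per_a per_b] f] g])
  finally show ?thesis
    by (simp add: Adj_def sum_subtractf[symmetric] algebra_simps)
qed

section \<open>Energy inequalities with a source term\<close>

lemma h_psum_sq_le: "h * (\<Sum>i\<in>{0..<N}. (f i)\<^sup>2) \<le> a1 * X f"
proof -
  have "(\<Sum>i\<in>{0..<N}. (f i)\<^sup>2) \<le> (\<Sum>i\<in>{0..<N}. a1 * ((f i)\<^sup>2 / a i))"
  proof (rule sum_mono)
    fix i
    have "a i * (f i)\<^sup>2 \<le> a1 * (f i)\<^sup>2" using a_le by (intro mult_right_mono) auto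
    then show "(f i)\<^sup>2 \<le> a1 * ((f i)\<^sup>2 / a i)" using a_pos[of i] by (simp add: field_simps)
  qed
  then show ?thesis using h_pos unfolding Xn_def sum_distrib_left[symmetric]
    by (simp add: mult.left_commute)
qed

lemma X_le_psum: "X f \<le> h * (\<Sum>i\<in>{0..<N}. (f i)\<^sup>2) / a0"
proof -
  have "(\<Sum>i\<in>{0..<N}. (f i)\<^sup>2 / a i) \<le> (\<Sum>i\<in>{0..<N}. (f i)\<^sup>2 / a0)"
    using a0_pos a_ge by (intro sum_mono divide_left_mono) (auto simp: a_pos)
  then have "h * (\<Sum>i\<in>{0..<N}. (f i)\<^sup>2 / a i) \<le> h * (\<Sum>i\<in>{0..<N}. (f i)\<^sup>2 / a0)"
    using h_pos by (intro mult_left_mono) auto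
  then show ?thesis unfolding Xn_def by (simp add: sum_divide_distrib[symmetric])
qed

text \<open>The weight cancels \<open>a\<close>, so the Laplacian contributes
  \<open>- 2 Y f\<close>. Young's inequality for the drift spends one \<open>Y f\<close> on the
  square of the central difference and puts the rest into \<open>X f\<close>.\<close>

lemma energy_X:
  assumes f: "per N f" and w: "\<And>i. w i = A f i + S i"
  shows "2 * h * (\<Sum>i\<in>{0..<N}. f i * w i / a i)
    \<le> \<kappa> * X f - Y f + 2 * h * (\<Sum>i\<in>{0..<N}. f i * S i / a i)"
proof -
  have e: "f i * w i / a i = f i * lp h f i + f i * (b i * cd h f i) + f i * S i / a i" for i
    using a_nz[of i] by (simp add: w Aop_def field_simps)
  have "2 * (f i * (b i * cd h f i)) \<le> (cd h f i)\<^sup>2 + B\<^sup>2 * (f i)\<^sup>2" for i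
  proof -
    have "0 \<le> (cd h f i - b i * f i)\<^sup>2" by simp
    moreover have "(b i)\<^sup>2 \<le> B\<^sup>2" using b_le[of i] B_nonneg by (metis abs_le_square_iff abs_of_nonneg)
    then have "(b i)\<^sup>2 * (f i)\<^sup>2 \<le> B\<^sup>2 * (f i)\<^sup>2" by (intro mult_right_mono) auto
    ultimately show ?thesis by (simp add: power2_eq_square algebra_simps)
  qed
  then have "(\<Sum>i\<in>{0..<N}. 2 * (f i * (b i * cd h f i)))
      \<le> (\<Sum>i\<in>{0..<N}. (cd h f i)\<^sup>2 + B\<^sup>2 * (f i)\<^sup>2)" by (rule sum_mono)
  also have "\<dots> \<le> (\<Sum>i\<in>{0..<N}. (fd h f i)\<^sup>2) + B\<^sup>2 * (\<Sum>i\<in>{0..<N}. (f i)\<^sup>2)"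
    using psum_cd_le_fd[OF N_pos f, of h] by (simp add: sum.distrib sum_distrib_left)
  finally have "2 * (\<Sum>i\<in>{0..<N}. f i * (b i * cd h f i))
      \<le> (\<Sum>i\<in>{0..<N}. (fd h f i)\<^sup>2) + B\<^sup>2 * (\<Sum>i\<in>{0..<N}. (f i)\<^sup>2)"
    by (simp add: sum_distrib_left)
  then have "h * (2 * (\<Sum>i\<in>{0..<N}. f i * (b i * cd h f i)))
      \<le> h * ((\<Sum>i\<in>{0..<N}. (fd h f i)\<^sup>2) + B\<^sup>2 * (\<Sum>i\<in>{0..<N}. (f i)\<^sup>2))"
    using h_pos by (intro mult_left_mono) auto
  moreover have "B\<^sup>2 * (h * (\<Sum>i\<in>{0..<N}. (f i)\<^sup>2)) \<le> B\<^sup>2 * (a1 * X f)"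
    by (intro mult_left_mono h_psum_sq_le) auto
  moreover have "(\<Sum>i\<in>{0..<N}. f i * lp h f i) = - (\<Sum>i\<in>{0..<N}. (fd h f i)\<^sup>2)"
    using psum_lp_parts[OF N_pos f f, of h] by (simp add: power2_eq_square)
  ultimately show ?thesis
    unfolding e sum.distrib Yn_def by (simp add: algebra_simps)
qed

text \<open>Summation by parts turns the left side into a sum of \<open>w\<close> against
  \<open>lp h f\<close>, and the equation replaces \<open>lp h f\<close> by \<open>w / a\<close>
  minus drift and source. Of the resulting \<open>- 2 X w\<close>, one half is spent on the
  drift.\<close>

lemma energy_Y:
  assumes f: "per N f" and pw: "per N w" and w: "\<And>i. w i = A f i + S i"
  shows "2 * h * (\<Sum>i\<in>{0..<N}. fd h f i * fd h w i)
    \<le> \<kappa> * Y f - X w + 2 * h * (\<Sum>i\<in>{0..<N}. w i * S i / a i)"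
proof -
  have l: "lp h f i = w i / a i - b i * cd h f i - S i / a i" for i
    using a_nz[of i] by (simp add: w Aop_def field_simps)
  have "2 * (w i * (b i * cd h f i)) \<le> (w i)\<^sup>2 / a i + \<kappa> * (cd h f i)\<^sup>2" for i
  proof -
    \<comment> \<open>Completing the square with weight \<open>1 / a\<close> makes the term in
      \<open>w\<close> match \<open>X w\<close> exactly.\<close>
    have "0 \<le> (w i - a i * b i * cd h f i)\<^sup>2 / a i" using a_pos[of i] by simp
    also have "\<dots> = (w i)\<^sup>2 / a i + (b i)\<^sup>2 * a i * (cd h f i)\<^sup>2 - 2 * (w i * (b i * cd h f i))"
      using a_nz[of i] by (simp add: power2_eq_square field_simps)
    finally have "2 * (w i * (b i * cd h f i)) \<le> (w i)\<^sup>2 / a i + (b i)\<^sup>2 * a i * (cd h f i)\<^sup>2"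
      by simp
    moreover have "(b i)\<^sup>2 \<le> B\<^sup>2" using b_le[of i] B_nonneg by (metis abs_le_square_iff abs_of_nonneg)
    then have "(b i)\<^sup>2 * a i \<le> \<kappa>" using a_le[of i] a_pos[of i] by (intro mult_mono) auto
    then have "(b i)\<^sup>2 * a i * (cd h f i)\<^sup>2 \<le> \<kappa> * (cd h f i)\<^sup>2" by (intro mult_right_mono) auto
    ultimately show ?thesis by linarith
  qed
  then have "(\<Sum>i\<in>{0..<N}. 2 * (w i * (b i * cd h f i)))
      \<le> (\<Sum>i\<in>{0..<N}. (w i)\<^sup>2 / a i + \<kappa> * (cd h f i)\<^sup>2)" by (rule sum_mono)
  also have "\<dots> = (\<Sum>i\<in>{0..<N}. (w i)\<^sup>2 / a i) + \<kappa> * (\<Sum>i\<in>{0..<N}. (cd h f i)\<^sup>2)"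
    by (simp add: sum.distrib sum_distrib_left)
  also have "\<dots> \<le> (\<Sum>i\<in>{0..<N}. (w i)\<^sup>2 / a i) + \<kappa> * (\<Sum>i\<in>{0..<N}. (fd h f i)\<^sup>2)"
    using a1_pos by (intro add_left_mono mult_left_mono psum_cd_le_fd[OF N_pos f]) auto
  finally have "h * (2 * (\<Sum>i\<in>{0..<N}. w i * (b i * cd h f i)))
      \<le> h * ((\<Sum>i\<in>{0..<N}. (w i)\<^sup>2 / a i) + \<kappa> * (\<Sum>i\<in>{0..<N}. (fd h f i)\<^sup>2))"
    using h_pos by (intro mult_left_mono) (auto simp: sum_distrib_left)
  moreover have eq: "(\<Sum>i\<in>{0..<N}. fd h f i * fd h w i) = - (\<Sum>i\<in>{0..<N}. (w i)\<^sup>2 / a i)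
      + (\<Sum>i\<in>{0..<N}. w i * (b i * cd h f i)) + (\<Sum>i\<in>{0..<N}. w i * S i / a i)"
  proof -
    have "(\<Sum>i\<in>{0..<N}. fd h f i * fd h w i) = - (\<Sum>i\<in>{0..<N}. w i * lp h f i)"
      using psum_lp_parts[OF N_pos pw f, of h] by (simp add: mult.commute)
    also have "\<dots> = - (\<Sum>i\<in>{0..<N}. (w i)\<^sup>2 / a i - w i * (b i * cd h f i) - w i * S i / a i)"
      unfolding l by (simp add: power2_eq_square algebra_simps)
    finally show ?thesis by (simp add: sum_subtractf)
  qed
  ultimately show ?thesis unfolding Yn_def Xn_def eq by (simp add: algebra_simps)
qed

lemma X_deriv:
  assumes "\<And>i. ((\<lambda>s. v s i) has_real_derivative w i) (at s)"
  shows "((\<lambda>s. X (v s)) has_real_derivative 2 * h * (\<Sum>i\<in>{0..<N}. v s i * w i / a i)) (at s)"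
proof -
  have "((\<lambda>s. h * (\<Sum>i\<in>{0..<N}. (v s i)\<^sup>2 / a i)) has_real_derivative
      h * (\<Sum>i\<in>{0..<N}. (2 * v s i * w i) / a i)) (at s)"
    by (intro DERIV_cmult DERIV_sum DERIV_cdivide) (auto intro!: derivative_eq_intros assms)
  then show ?thesis unfolding Xn_def by (simp add: sum_distrib_left mult_ac)
qed

lemma fd_deriv:
  assumes "\<And>i. ((\<lambda>s. v s i) has_real_derivative w i) (at s)"
  shows "((\<lambda>s. fd h (v s) i) has_real_derivative fd h w i) (at s)"
  unfolding fd_def by (intro DERIV_cdivide DERIV_diff assms)

lemma Y_deriv:
  assumes "\<And>i. ((\<lambda>s. v s i) has_real_derivative w i) (at s)"
  shows "((\<lambda>s. Y (v s)) has_real_derivative 2 * h * (\<Sum>i\<in>{0..<N}. fd h (v s) i * fd h w i)) (at s)"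
proof -
  have "((\<lambda>s. h * (\<Sum>i\<in>{0..<N}. (fd h (v s) i)\<^sup>2)) has_real_derivative
      h * (\<Sum>i\<in>{0..<N}. (2 * fd h (v s) i * fd h w i))) (at s)"
    by (intro DERIV_cmult DERIV_sum) (auto intro!: derivative_eq_intros fd_deriv assms)
  then show ?thesis unfolding Yn_def by (simp add: sum_distrib_left mult_ac)
qed

lemma A_deriv:
  assumes "\<And>i. ((\<lambda>s. v s i) has_real_derivative w i) (at s within T)"
  shows "((\<lambda>s. A (v s) i) has_real_derivative A w i) (at s within T)"
  unfolding Aop_def lp_def cd_def
  by (intro DERIV_cmult DERIV_cdivide DERIV_diff DERIV_add assms)

lemma A'_deriv:
  assumes "\<And>i. ((\<lambda>s. v s i) has_real_derivative w i) (at s within T)"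
  shows "((\<lambda>s. A' (v s) i) has_real_derivative A' w i) (at s within T)"
  unfolding Adj_def lp_def cd_def
  by (intro DERIV_cmult DERIV_cdivide DERIV_diff DERIV_add assms)

lemma A_cont: "(\<And>i. continuous_on T (\<lambda>s. v s i)) \<Longrightarrow> continuous_on T (\<lambda>s. A (v s) i)"
  unfolding Aop_def lp_def cd_def using h_pos by (intro continuous_intros) auto

lemma A'_cont: "(\<And>i. continuous_on T (\<lambda>s. v s i)) \<Longrightarrow> continuous_on T (\<lambda>s. A' (v s) i)"
  unfolding Adj_def lp_def cd_def using h_pos by (intro continuous_intros) auto

lemma X_cont: "(\<And>i. continuous_on T (\<lambda>s. v s i)) \<Longrightarrow> continuous_on T (\<lambda>s. X (v s))"
  unfolding Xn_def using a_nz by (intro continuous_intros) auto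

lemma Y_cont: "(\<And>i. continuous_on T (\<lambda>s. v s i)) \<Longrightarrow> continuous_on T (\<lambda>s. Y (v s))"
  unfolding Yn_def fd_def using h_pos by (intro continuous_intros) auto

text \<open>The one-dimensional Sobolev inequality: Cauchy-Schwarz applied to the mean and to the
  total variation in \<open>per_sup_bound\<close>.\<close>

lemma sup_le:
  assumes f: "per N f"
  shows "(f i)\<^sup>2 \<le> (2 * a1 / len + 2 * len) * (X f + Y f)"
proof -
  let ?P = "(\<Sum>j\<in>{0..<N}. \<bar>f j\<bar>) / of_int N" and ?Q = "\<Sum>l\<in>{0..<N}. \<bar>f (l + 1) - f l\<bar>"
  have N: "real_of_int N > 0" using N_pos by simp
  have "\<bar>f i\<bar> \<le> ?P + ?Q" by (rule per_sup_bound[OF N_pos f])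
  then have "(f i)\<^sup>2 \<le> (?P + ?Q)\<^sup>2" by (metis abs_ge_zero power2_abs power_mono)
  also have "\<dots> \<le> 2 * ?P\<^sup>2 + 2 * ?Q\<^sup>2" using sum_squares_bound[of ?P ?Q] by (simp add: power2_sum)
  also have "?P\<^sup>2 \<le> a1 * X f / len"
  proof -
    have "?P\<^sup>2 \<le> (of_int N * (\<Sum>i\<in>{0..<N}. (f i)\<^sup>2)) / (of_int N)\<^sup>2"
      unfolding power_divide using psum_abs_sq_le[OF N_pos, of f] by (intro divide_right_mono) auto
    also have "\<dots> = h * (\<Sum>i\<in>{0..<N}. (f i)\<^sup>2) / len"
      using N h_pos unfolding len[symmetric] by (simp add: power2_eq_square)
    also have "\<dots> \<le> a1 * X f / len" using len_pos by (intro divide_right_mono h_psum_sq_le) auto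
    finally show ?thesis .
  qed
  also have "?Q\<^sup>2 \<le> len * Y f"
  proof -
    have "?Q\<^sup>2 \<le> of_int N * (\<Sum>l\<in>{0..<N}. (f (l + 1) - f l)\<^sup>2)" by (rule psum_abs_sq_le[OF N_pos])
    also have "(\<Sum>l\<in>{0..<N}. (f (l + 1) - f l)\<^sup>2) = h\<^sup>2 * (\<Sum>l\<in>{0..<N}. (fd h f l)\<^sup>2)"
      unfolding sum_distrib_left fd_def using h_pos by (intro sum.cong) (auto simp: power_divide)
    also have "of_int N * \<dots> = len * Y f" unfolding Yn_def len[symmetric] by (simp add: power2_eq_square)
    finally show ?thesis .
  qed
  finally have "(f i)\<^sup>2 \<le> 2 * (a1 * X f / len) + 2 * (len * Y f)" by simp
  also have "\<dots> \<le> (2 * a1 / len + 2 * len) * (X f + Y f)"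
    using X_nonneg[of f] Y_nonneg[of f] a1_pos len_pos by (simp add: algebra_simps)
  finally show ?thesis .
qed

section \<open>Smoothing for solutions of the backward equation\<close>

definition bsol :: "(real \<Rightarrow> int \<Rightarrow> real) \<Rightarrow> bool" where
  "bsol v \<longleftrightarrow> (\<forall>s. per N (v s)) \<and> (\<forall>i. continuous_on {0..} (\<lambda>s. v s i)) \<and>
     (\<forall>s>0. \<forall>i. ((\<lambda>s. v s i) has_real_derivative A (v s) i) (at s))"

text \<open>The coefficients do not depend on time, so the time derivative of a solution is again a
  solution, and every energy bound can be iterated.\<close>

lemma bsol_A: "bsol v \<Longrightarrow> bsol (\<lambda>s. A (v s))"
  unfolding bsol_def by (auto intro: per_A A_cont A_deriv)

lemma bsol_Apow: "bsol v \<Longrightarrow> bsol (\<lambda>s. (A ^^ k) (v s))"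
  by (induction k) (auto dest: bsol_A)

text \<open>The chain from \<open>X v\<close> to \<open>Y v\<close> and from \<open>Y v\<close> to
  \<open>X (A v)\<close>: each quantity is the dissipation of the previous one and itself grows at
  most at rate \<kappa>, so waiting for a time gains one more member of the chain at the price of
  one division by that time.\<close>

lemma bsol_decay:
  assumes v: "bsol v" and s: "0 \<le> s0" "s0 \<le> s1"
  shows "X (v s1) + (s1 - s0) * Y (v s1) \<le> exp (\<kappa> * (s1 - s0)) * X (v s0)"
    and "Y (v s1) + (s1 - s0) * X (A (v s1)) \<le> exp (\<kappa> * (s1 - s0)) * Y (v s0)"
proof -
  have c: "continuous_on {s0..s1} (\<lambda>s. v s i)" for i
    using v s unfolding bsol_def by (auto intro: continuous_on_subset)
  have d: "((\<lambda>s. v s i) has_real_derivative A (v s) i) (at s)" if "s0 < s" for s i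
    using v s that unfolding bsol_def by auto
  have p: "per N (v s)" for s using v by (simp add: bsol_def)
  have x: "2 * h * (\<Sum>i\<in>{0..<N}. f i * A f i / a i) \<le> \<kappa> * X f - Y f" if "per N f" for f
    using energy_X[OF that, of "A f" "\<lambda>_. 0"] by simp
  have y: "2 * h * (\<Sum>i\<in>{0..<N}. fd h f i * fd h (A f) i) \<le> \<kappa> * Y f - X (A f)" if "per N f" for f
    using energy_Y[OF that per_A[OF that], of "\<lambda>_. 0"] by simp
  show "X (v s1) + (s1 - s0) * Y (v s1) \<le> exp (\<kappa> * (s1 - s0)) * X (v s0)"
  proof (rule dissipation_decay[OF s(2) X_cont[OF c] Y_cont[OF c] X_deriv[OF d] Y_deriv[OF d] x[OF p]])
    show "2 * h * (\<Sum>i\<in>{0..<N}. fd h (v s) i * fd h (A (v s)) i) \<le> \<kappa> * Y (v s)" for s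
      using y[OF p, of s] X_nonneg[of "A (v s)"] by linarith
  qed
  show "Y (v s1) + (s1 - s0) * X (A (v s1)) \<le> exp (\<kappa> * (s1 - s0)) * Y (v s0)"
  proof (rule dissipation_decay[OF s(2) Y_cont[OF c] X_cont[OF A_cont[OF c]] Y_deriv[OF d]
        X_deriv[OF A_deriv[OF d]] y[OF p]])
    show "2 * h * (\<Sum>i\<in>{0..<N}. A (v s) i * A (A (v s)) i / a i) \<le> \<kappa> * X (A (v s))" for s
      using x[OF per_A[OF p], of s] Y_nonneg[of "A (v s)"] by linarith
  qed
qed

lemma bsol_X_mono: "bsol v \<Longrightarrow> 0 \<le> s0 \<Longrightarrow> s0 \<le> s1 \<Longrightarrow> X (v s1) \<le> exp (\<kappa> * (s1 - s0)) * X (v s0)"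
  using bsol_decay(1)[of v s0 s1] Y_nonneg[of "v s1"] mult_nonneg_nonneg[of "s1 - s0" "Y (v s1)"]
  by linarith

lemma bsol_step_Y:
  assumes "bsol v" "0 \<le> s0" "0 < \<tau>"
  shows "Y (v (s0 + \<tau>)) \<le> exp (\<kappa> * \<tau>) / \<tau> * X (v s0)"
  using bsol_decay(1)[of v s0 "s0 + \<tau>"] assms X_nonneg[of "v (s0 + \<tau>)"] by (simp add: field_simps)

lemma bsol_step_A:
  assumes "bsol v" "0 \<le> s0" "0 < \<tau>"
  shows "X (A (v (s0 + \<tau>))) \<le> exp (\<kappa> * \<tau>) / \<tau> * Y (v s0)"
  using bsol_decay(2)[of v s0 "s0 + \<tau>"] assms Y_nonneg[of "v (s0 + \<tau>)"] by (simp add: field_simps)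

text \<open>A power of \<open>A\<close> takes two steps of length \<tau>, from \<open>X\<close> to
  \<open>Y\<close> and from \<open>Y\<close> to \<open>X\<close> after \<open>A\<close>; hence
  \<open>2 k\<close> steps for \<open>k\<close> powers.\<close>

lemma bsol_pow_X:
  assumes v: "bsol v" and s: "0 \<le> s0" and \<tau>: "0 < \<tau>"
  shows "X ((A ^^ k) (v (s0 + 2 * real k * \<tau>))) \<le> (exp (\<kappa> * \<tau>) / \<tau>) ^ (2 * k) * X (v s0)"
proof (induction k)
  case 0
  then show ?case by simp
next
  case (Suc k)
  let ?v = "\<lambda>s. (A ^^ k) (v s)" and ?e = "exp (\<kappa> * \<tau>) / \<tau>" and ?s = "s0 + 2 * real k * \<tau>"
  have b: "bsol ?v" by (rule bsol_Apow[OF v])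
  have s': "0 \<le> ?s" using s \<tau> by simp
  have e: "0 \<le> ?e" using \<tau> by simp
  have "X (A (?v (?s + \<tau> + \<tau>))) \<le> ?e * Y (?v (?s + \<tau>))" using bsol_step_A[OF b _ \<tau>, of "?s + \<tau>"] s' \<tau> by simp
  also have "\<dots> \<le> ?e * (?e * X (?v ?s))" by (intro mult_left_mono bsol_step_Y[OF b s' \<tau>] e)
  also have "\<dots> \<le> ?e * (?e * (?e ^ (2 * k) * X (v s0)))" by (intro mult_left_mono Suc.IH e)
  finally show ?case by (simp add: algebra_simps)
qed

lemma bsol_pow_Y:
  assumes v: "bsol v" and s: "0 \<le> s0" and \<tau>: "0 < \<tau>"
  shows "Y ((A ^^ k) (v (s0 + (2 * real k + 1) * \<tau>))) \<le> (exp (\<kappa> * \<tau>) / \<tau>) ^ (2 * k + 1) * X (v s0)"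
proof -
  let ?v = "\<lambda>s. (A ^^ k) (v s)" and ?e = "exp (\<kappa> * \<tau>) / \<tau>" and ?s = "s0 + 2 * real k * \<tau>"
  have "Y (?v (?s + \<tau>)) \<le> ?e * X (?v ?s)"
    using bsol_step_Y[OF bsol_Apow[OF v], of ?s \<tau> k] s \<tau> by simp
  also have "\<dots> \<le> ?e * (?e ^ (2 * k) * X (v s0))"
    using \<tau> by (intro mult_left_mono bsol_pow_X[OF v s \<tau>]) auto
  finally show ?thesis by (simp add: algebra_simps)
qed

text \<open>Young's inequality with the Sobolev constant as parameter, tuned so that exactly half of
  the energy appears. The other half remains available when a point source is absorbed.\<close>

lemma point_value_le:
  assumes f: "per N f"
  shows "2 * \<bar>f j\<bar> / a j \<le> (X f + Y f) / 2 + 2 * (2 * a1 / len + 2 * len) / a0\<^sup>2"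
proof -
  let ?c = "2 * a1 / len + 2 * len"
  have c: "?c > 0" using a1_pos len_pos by (simp add: add_pos_pos)
  have "2 * \<bar>f j\<bar> / a j \<le> 2 * \<bar>f j\<bar> / a0"
    using a0_pos a_ge by (intro divide_left_mono) (auto simp: a_pos)
  also have "\<dots> \<le> (f j)\<^sup>2 / (2 * ?c) + 2 * ?c / a0\<^sup>2"
  proof -
    have sq: "(y - 2 * c / a0)\<^sup>2 / (2 * c) = y\<^sup>2 / (2 * c) + 2 * c / a0\<^sup>2 - 2 * y / a0"
      if "0 < c" for c y
      using that a0_pos unfolding power2_diff by (simp add: field_simps power2_eq_square)
    have "0 \<le> (\<bar>f j\<bar> - 2 * ?c / a0)\<^sup>2 / (2 * ?c)" using c by simp
    also have "\<dots> = (f j)\<^sup>2 / (2 * ?c) + 2 * ?c / a0\<^sup>2 - 2 * \<bar>f j\<bar> / a0"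
      unfolding sq[OF c] by simp
    finally show ?thesis by simp
  qed
  also have "(f j)\<^sup>2 / (2 * ?c) \<le> (X f + Y f) / 2"
  proof -
    have "(f j)\<^sup>2 / (2 * ?c) \<le> ?c * (X f + Y f) / (2 * ?c)"
      using c by (intro divide_right_mono sup_le[OF f]) simp
    also have "\<dots> = (X f + Y f) / 2" using c by (metis less_irrefl mult.commute mult_divide_mult_cancel_left)
    finally show ?thesis .
  qed
  finally show ?thesis by simp
qed

definition unit_const :: real where "unit_const = 2 * (2 * a1 / len + 2 * len) / a0\<^sup>2"

lemma unit_const_pos: "0 < unit_const"
  unfolding unit_const_def using a0_pos a1_pos len_pos by (intro divide_pos_pos mult_pos_pos add_pos_pos) auto

text \<open>The integral \<open>U\<close> starts at zero and solves the equation with a constant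
  delta source, which enters the energy identities only through point values at \<open>j\<close>.
  This yields bounded energy of \<open>U\<close> and, from the dissipation \<open>X (v s)\<close>,
  the bound of order \<open>1 / s\<close> on the squared norm of the kernel itself, without
  reference to the initial norm, which blows up with the mesh.\<close>

lemma integrated_unit_solution:
  assumes v: "bsol v" and v0: "v 0 = unit_at N h j"
  defines "U \<equiv> \<lambda>s i. integral {0..s} (\<lambda>r. v r i)"
  shows "per N (U s)"
    and "continuous_on {0..T} (\<lambda>s. U s i)"
    and "0 < s \<Longrightarrow> ((\<lambda>s. U s i) has_real_derivative v s i) (at s)"
    and "U 0 i = 0"
    and "0 \<le> s \<Longrightarrow> v s i = A (U s) i + unit_at N h j i"
    and "0 \<le> s \<Longrightarrow> X (U s) + Y (U s) \<le> 4 * unit_const * exp ((2 * \<kappa> + 1) * s)"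
    and "0 \<le> s \<Longrightarrow> s * X (v s) \<le> 2 * unit_const * exp ((2 * \<kappa> + 1) * s)"
proof -
  have pv: "per N (v s)" for s using v by (simp add: bsol_def)
  have cv: "continuous_on {0..T} (\<lambda>s. v s i)" for T i
    using v unfolding bsol_def by (auto intro: continuous_on_subset)
  have dv: "((\<lambda>s. v s i) has_real_derivative A (v s) i) (at s)" if "0 < s" for s i
    using v that unfolding bsol_def by auto
  show pU: "per N (U s)" for s using pv unfolding U_def per_def by simp
  have dU': "((\<lambda>s. U s i) has_real_derivative v s i) (at s within {0..T})" if "s \<in> {0..T}" for s i T
    unfolding U_def by (rule integral_has_real_derivative[OF cv that])
  show cU: "continuous_on {0..T} (\<lambda>s. U s i)" for T i
    by (rule DERIV_continuous_on[OF dU'])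
  show dU: "((\<lambda>s. U s i) has_real_derivative v s i) (at s)" if "0 < s" for s i
  proof -
    have "at s within {0..s + 1} = at s" using that by (intro at_within_interior) auto
    then show ?thesis using dU'[of s "s + 1" i] that by simp
  qed
  show U0: "U 0 i = 0" for i by (simp add: U_def)
  have A0: "A (U 0) i = 0" for i by (simp add: Aop_def lp_def cd_def U0)
  show w: "v s i = A (U s) i + unit_at N h j i" if "0 \<le> s" for s i
  proof (cases "s = 0")
    case True
    then show ?thesis by (simp add: A0 v0)
  next
    case False
    \<comment> \<open>Both terms have the time derivative \<open>A v\<close>, so their difference
      keeps its initial value, the delta function.\<close>
    have "v s i - A (U s) i = v 0 i - A (U 0) i"
    proof (rule DERIV_isconst2[of 0 s "\<lambda>s. v s i - A (U s) i" s])
      show "continuous_on {0..s} (\<lambda>s. v s i - A (U s) i)"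
        by (intro continuous_on_diff cv A_cont cU)
      show "((\<lambda>s. v s i - A (U s) i) has_real_derivative 0) (at x)" if "0 < x" for x
      proof -
        have "((\<lambda>s. A (U s) i) has_real_derivative A (v x) i) (at x)" by (rule A_deriv) (rule dU[OF that])
        from DERIV_diff[OF dv[OF that, of i] this] show ?thesis by simp
      qed
    qed (use False that in auto)
    then show ?thesis by (simp add: A0 v0)
  qed
  have src: "2 * h * (\<Sum>i\<in>{0..<N}. f i * unit_at N h j i / a i) = 2 * f j / a j" if "per N f" for f
    using psum_unit_at[OF N_pos per_comp2[OF that per_a], of h j "\<lambda>x y. x / y"] h_pos by (simp add: mult_ac)
  \<comment> \<open>Since \<open>X + Y\<close> is at most twice \<Phi>, the rate \<kappa> doubles;
    the additional 1 pays for the point value of \<open>U\<close> in the first energy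
    inequality.\<close>
  let ?c = "2 * \<kappa> + 1"
  have \<kappa>: "0 \<le> \<kappa>" using a1_pos by simp
  \<comment> \<open>The second energy inequality produces the point value
    \<open>2 v s j / a j\<close>, which the energies of \<open>U\<close> do not control. It is the
    time derivative of \<open>2 U s j / a j\<close>, so subtracting that term removes it; the added
    constant keeps \<Phi> above half the energy.\<close>
  define \<Phi> where "\<Phi> s = X (U s) + Y (U s) - 2 * U s j / a j + 2 * unit_const" for s
  have lb: "(X (U s) + Y (U s)) / 2 + unit_const \<le> \<Phi> s" for s
  proof -
    have "2 * U s j / a j \<le> 2 * \<bar>U s j\<bar> / a j" using a_pos[of j] by (intro divide_right_mono) auto
    moreover have "z / 2 + k \<le> z - p + 2 * k" if "p \<le> q" "q \<le> z / 2 + k" for p q z k :: real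
      using that by linarith
    ultimately show ?thesis using point_value_le[OF pU, of s j, folded unit_const_def] unfolding \<Phi>_def by blast
  qed
  have main: "\<Phi> s + s * X (v s) \<le> exp (?c * s) * \<Phi> 0" if s0: "0 \<le> s" for s
  proof -
    have "\<Phi> s + (s - 0) * X (v s) \<le> exp (?c * (s - 0)) * \<Phi> 0"
    proof (rule dissipation_decay[OF s0])
      show "continuous_on {0..s} \<Phi>" unfolding \<Phi>_def
        using a_nz by (intro continuous_intros X_cont Y_cont cU) auto
      show "continuous_on {0..s} (\<lambda>s. X (v s))" by (intro X_cont cv)
      fix r assume r: "0 < r" "r < s"
      let ?w = "v r"
      show "(\<Phi> has_real_derivative (2 * h * (\<Sum>i\<in>{0..<N}. U r i * ?w i / a i)
          + 2 * h * (\<Sum>i\<in>{0..<N}. fd h (U r) i * fd h ?w i) - 2 * ?w j / a j + 0)) (at r)"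
        unfolding \<Phi>_def using r(1)
        by (intro DERIV_add DERIV_diff DERIV_const X_deriv Y_deriv DERIV_cdivide DERIV_cmult dU)
      show "((\<lambda>s. X (v s)) has_real_derivative 2 * h * (\<Sum>i\<in>{0..<N}. v r i * A (v r) i / a i)) (at r)"
        by (intro X_deriv dv r)
      have "2 * h * (\<Sum>i\<in>{0..<N}. v r i * A (v r) i / a i) \<le> \<kappa> * X (v r) - Y (v r)"
        using energy_X[of "v r" "A (v r)" "\<lambda>_. 0"] pv by simp
      also have "\<dots> \<le> ?c * X (v r)"
        using X_nonneg[of "v r"] Y_nonneg[of "v r"] mult_nonneg_nonneg[OF \<kappa>, of "X (v r)"]
        by (simp add: algebra_simps)
      finally show "2 * h * (\<Sum>i\<in>{0..<N}. v r i * A (v r) i / a i) \<le> ?c * X (v r)" .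
      have w': "v r i = A (U r) i + unit_at N h j i" for i using w r by simp
      have 1: "2 * h * (\<Sum>i\<in>{0..<N}. U r i * ?w i / a i) \<le> \<kappa> * X (U r) - Y (U r) + 2 * U r j / a j"
        using energy_X[OF pU w'] src[of "U r"] pU by simp
      have 2: "2 * h * (\<Sum>i\<in>{0..<N}. fd h (U r) i * fd h ?w i) \<le> \<kappa> * Y (U r) - X ?w + 2 * ?w j / a j"
        using energy_Y[OF pU pv w'] src[of "v r"] pv by simp
      have 3: "2 * U r j / a j \<le> (X (U r) + Y (U r)) / 2 + unit_const"
      proof -
        have "2 * U r j / a j \<le> 2 * \<bar>U r j\<bar> / a j" using a_pos[of j] by (intro divide_right_mono) auto
        then show ?thesis using point_value_le[OF pU, of r j, folded unit_const_def] by linarith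
      qed
      have "z \<le> 2 * f" if "z / 2 + k \<le> f" "0 < k" for z f k :: real using that by linarith
      then have 5: "X (U r) + Y (U r) \<le> 2 * \<Phi> r" using lb[of r] unit_const_pos by blast
      then have 4: "\<kappa> * (X (U r) + Y (U r)) \<le> \<kappa> * (2 * \<Phi> r)" by (intro mult_left_mono \<kappa>)
      have "?c * \<Phi> r = \<kappa> * (2 * \<Phi> r) + \<Phi> r" by (simp add: algebra_simps)
      moreover have "\<kappa> * (X (U r) + Y (U r)) = \<kappa> * X (U r) + \<kappa> * Y (U r)" by (rule distrib_left)
      ultimately
      show "2 * h * (\<Sum>i\<in>{0..<N}. U r i * ?w i / a i)
          + 2 * h * (\<Sum>i\<in>{0..<N}. fd h (U r) i * fd h ?w i) - 2 * ?w j / a j + 0 \<le> ?c * \<Phi> r - X (v r)"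
        using 1 2 3 4 lb[of r] Y_nonneg[of "U r"] by linarith
    qed
    then show ?thesis by simp
  qed
  have \<Phi>0: "\<Phi> 0 = 2 * unit_const" by (simp add: \<Phi>_def U0 Xn_def Yn_def fd_def)
  show "X (U s) + Y (U s) \<le> 4 * unit_const * exp (?c * s)" if "0 \<le> s" for s
  proof -
    have "z \<le> 4 * k * e" if "f + x \<le> e * (2 * k)" "z / 2 + k \<le> f" "0 < k" "0 \<le> x" for z f k e x :: real
      using that by (simp add: mult.assoc mult.commute[of e])
    then show ?thesis
      using main[OF that] lb[of s] unit_const_pos mult_nonneg_nonneg[OF that X_nonneg[of "v s"]]
      unfolding \<Phi>0 by blast
  qed
  show "s * X (v s) \<le> 2 * unit_const * exp (?c * s)" if "0 \<le> s" for s
  proof -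
    have "x \<le> 2 * k * e" if "f + x \<le> e * (2 * k)" "z / 2 + k \<le> f" "0 < k" "0 \<le> z" for z f k e x :: real
      using that by (simp add: mult.assoc mult.commute[of e])
    moreover have "0 \<le> X (U s) + Y (U s)" by (intro add_nonneg_nonneg X_nonneg Y_nonneg)
    ultimately show ?thesis
      using main[OF that] lb[of s] unit_const_pos unfolding \<Phi>0 by blast
  qed
qed

end

section \<open>Transition kernels on one grid\<close>

lemma Aop_linear_form:
  obtains c1 c2 c3 where "\<And>f. Aop h a b f i = c1 * f (i + 1) + c2 * f (i - 1) + c3 * f i"
proof
  show "Aop h a b f i = (a i / h\<^sup>2 + a i * b i / (2 * h)) * f (i + 1)
      + (a i / h\<^sup>2 - a i * b i / (2 * h)) * f (i - 1) + (- 2 * a i / h\<^sup>2) * f i" for f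
    unfolding Aop_def lp_def cd_def by (simp add: algebra_simps add_divide_distrib diff_divide_distrib)
qed

lemma Adj_linear_form:
  obtains d1 d2 d3 where "\<And>f. Adj h a b f j = d1 * f (j + 1) + d2 * f (j - 1) + d3 * f j"
proof
  show "Adj h a b f j = (a (j + 1) / h\<^sup>2 - a (j + 1) * b (j + 1) / (2 * h)) * f (j + 1)
      + (a (j - 1) / h\<^sup>2 + a (j - 1) * b (j - 1) / (2 * h)) * f (j - 1) + (- 2 * a j / h\<^sup>2) * f j" for f
    unfolding Adj_def lp_def cd_def by (simp add: algebra_simps add_divide_distrib diff_divide_distrib)
qed

text \<open>The operators act on different variables; as three-point stencils they commute by
  rearranging a finite sum.\<close>

lemma Aop_Adj_commute:
  "Aop h a b (\<lambda>z. Adj h a b (F z) j) i = Adj h a b (\<lambda>y. Aop h a b (\<lambda>z. F z y) i) j"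
proof -
  obtain c1 c2 c3 where 1: "\<And>f. Aop h a b f i = c1 * f (i + 1) + c2 * f (i - 1) + c3 * f i"
    by (rule Aop_linear_form[of h a b i]) blast
  obtain d1 d2 d3 where 2: "\<And>f. Adj h a b f j = d1 * f (j + 1) + d2 * f (j - 1) + d3 * f j"
    by (rule Adj_linear_form[of h a b j]) blast
  show ?thesis unfolding 1 2 by (simp add: algebra_simps)
qed

context scheme
begin

lemma h_psum_abs_le: "h * (\<Sum>i\<in>{0..<N}. \<bar>f i\<bar>) \<le> sqrt (len * (h * (\<Sum>i\<in>{0..<N}. (f i)\<^sup>2)))"
proof (rule real_le_rsqrt)
  have "(h * (\<Sum>i\<in>{0..<N}. \<bar>f i\<bar>))\<^sup>2 \<le> h\<^sup>2 * (of_int N * (\<Sum>i\<in>{0..<N}. (f i)\<^sup>2))"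
    unfolding power_mult_distrib by (intro mult_left_mono psum_abs_sq_le[OF N_pos]) auto
  also have "\<dots> = len * (h * (\<Sum>i\<in>{0..<N}. (f i)\<^sup>2))"
    unfolding len[symmetric] by (simp add: power2_eq_square)
  finally show "(h * (\<Sum>i\<in>{0..<N}. \<bar>f i\<bar>))\<^sup>2 \<le> len * (h * (\<Sum>i\<in>{0..<N}. (f i)\<^sup>2))" .
qed

text \<open>The slopes sum to zero over a period, hence are bounded by their total variation, which
  is the weighted sum of the second differences.\<close>

lemma fd_sup_le:
  assumes f: "per N f"
  shows "\<bar>fd h f i\<bar> \<le> h * (\<Sum>i\<in>{0..<N}. \<bar>lp h f i\<bar>)"
proof -
  have "(\<Sum>i\<in>{0..<N}. f (i + 1)) = (\<Sum>i\<in>{0..<N}. f i)" by (rule psum_shift[OF N_pos f])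
  then have z: "(\<Sum>i\<in>{0..<N}. fd h f i) = 0"
    unfolding fd_def sum_divide_distrib[symmetric] by (simp add: sum_subtractf)
  have e: "fd h f (l + 1) - fd h f l = h * lp h f (l + 1)" for l
    using h_pos by (simp add: fd_def lp_def power2_eq_square field_simps)
  have "\<bar>fd h f i\<bar> \<le> (\<Sum>l\<in>{0..<N}. \<bar>fd h f (l + 1) - fd h f l\<bar>)"
    by (rule per_mean_zero_bound[OF N_pos per_fd[OF f] z])
  also have "\<dots> = h * (\<Sum>l\<in>{0..<N}. \<bar>lp h f (l + 1)\<bar>)"
    unfolding e using h_pos by (simp add: abs_mult sum_distrib_left)
  also have "(\<Sum>l\<in>{0..<N}. \<bar>lp h f (l + 1)\<bar>) = (\<Sum>l\<in>{0..<N}. \<bar>lp h f l\<bar>)"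
    by (rule psum_shift[OF N_pos per_comp1[OF per_lp[OF f]], of abs])
  finally show ?thesis .
qed

text \<open>The equation is solved for \<open>lp h f\<close>. The source enters only through its
  summed absolute value, so a delta source costs no more than 1, uniformly in the mesh.\<close>

lemma lp_l1_le:
  assumes f: "per N f" and w: "\<And>i. w i = A f i + S i"
  shows "h * (\<Sum>i\<in>{0..<N}. \<bar>lp h f i\<bar>) \<le> (sqrt (len * (a1 * X w)) + h * (\<Sum>i\<in>{0..<N}. \<bar>S i\<bar>)) / a0
    + B * sqrt (len * Y f)"
proof -
  have le: "\<bar>lp h f i\<bar> \<le> (\<bar>w i\<bar> + \<bar>S i\<bar>) / a0 + B * \<bar>cd h f i\<bar>" for i
  proof -
    have "lp h f i = (w i - S i) / a i - b i * cd h f i"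
      using a_nz[of i] by (simp add: w Aop_def field_simps)
    then have "\<bar>lp h f i\<bar> \<le> \<bar>(w i - S i) / a i\<bar> + \<bar>b i * cd h f i\<bar>" by linarith
    also have "\<bar>(w i - S i) / a i\<bar> \<le> (\<bar>w i\<bar> + \<bar>S i\<bar>) / a0"
      unfolding abs_divide using a_pos[of i] a0_pos a_ge[of i] by (intro frac_le) auto
    also have "\<bar>b i * cd h f i\<bar> \<le> B * \<bar>cd h f i\<bar>"
      unfolding abs_mult using b_le by (intro mult_right_mono) auto
    finally show ?thesis by simp
  qed
  have "h * (\<Sum>i\<in>{0..<N}. \<bar>lp h f i\<bar>) \<le> h * (\<Sum>i\<in>{0..<N}. (\<bar>w i\<bar> + \<bar>S i\<bar>) / a0 + B * \<bar>cd h f i\<bar>)"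
    using h_pos le by (intro mult_left_mono sum_mono) auto
  also have "\<dots> = (h * (\<Sum>i\<in>{0..<N}. \<bar>w i\<bar>) + h * (\<Sum>i\<in>{0..<N}. \<bar>S i\<bar>)) / a0
      + B * (h * (\<Sum>i\<in>{0..<N}. \<bar>cd h f i\<bar>))"
    by (simp add: sum.distrib sum_divide_distrib[symmetric] sum_distrib_left[symmetric] algebra_simps add_divide_distrib)
  also have "\<dots> \<le> (sqrt (len * (a1 * X w)) + h * (\<Sum>i\<in>{0..<N}. \<bar>S i\<bar>)) / a0 + B * sqrt (len * Y f)"
  proof (intro add_mono divide_right_mono mult_left_mono order_refl)
    show "h * (\<Sum>i\<in>{0..<N}. \<bar>w i\<bar>) \<le> sqrt (len * (a1 * X w))"
      using len_pos by (intro order_trans[OF h_psum_abs_le] real_sqrt_le_mono mult_left_mono h_psum_sq_le) auto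
    have "h * (\<Sum>i\<in>{0..<N}. (cd h f i)\<^sup>2) \<le> Y f"
      unfolding Yn_def using h_pos by (intro mult_left_mono psum_cd_le_fd[OF N_pos f]) auto
    then show "h * (\<Sum>i\<in>{0..<N}. \<bar>cd h f i\<bar>) \<le> sqrt (len * Y f)"
      using len_pos by (intro order_trans[OF h_psum_abs_le] real_sqrt_le_mono mult_left_mono) auto
  qed (use a0_pos B_nonneg h_pos in auto)
  finally show ?thesis .
qed

lemma h_psum_abs_unit_at: "h * (\<Sum>i\<in>{0..<N}. \<bar>unit_at N h j i\<bar>) = 1"
proof -
  have "\<bar>unit_at N h j i\<bar> = unit_at N h j i * 1" for i using h_pos by (simp add: unit_at_def)
  then have "(\<Sum>i\<in>{0..<N}. \<bar>unit_at N h j i\<bar>) = (\<Sum>i\<in>{0..<N}. unit_at N h j i * 1)" by simp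
  also have "\<dots> = 1 / h" using psum_unit_at[OF N_pos per_const[of N 1], of h j] .
  finally show ?thesis using h_pos by simp
qed

lemma cd_le_fd_sup:
  assumes "\<And>i. \<bar>fd h f i\<bar> \<le> M"
  shows "\<bar>cd h f i\<bar> \<le> M"
proof -
  have "cd h f i = (fd h f i + fd h f (i - 1)) / 2"
    by (simp add: cd_def fd_def add_divide_distrib[symmetric])
  then have "cd h f i = fd h f i / 2 + fd h f (i - 1) / 2" by (simp add: add_divide_distrib)
  then show ?thesis using assms[of i] assms[of "i - 1"] by linarith
qed

text \<open>The flux \<open>fd P - avg (b P)\<close> of \<open>P = a \<phi>\<close> has bounded variation and bounded mean.\<close>

lemma forward_Lipschitz:
  assumes f: "per N \<phi>" and M: "\<And>i. \<bar>\<phi> i\<bar> \<le> M" and M': "\<And>i. \<bar>A' \<phi> i\<bar> \<le> M"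
  shows "\<bar>fd h (\<lambda>i. a i * \<phi> i) i\<bar> \<le> (2 * B * a1 + len) * M"
proof -
  define P where "P = (\<lambda>i. a i * \<phi> i)"
  have M0: "0 \<le> M" using M[of 0] by linarith
  have pP: "per N P" unfolding P_def by (rule per_mult[OF per_a f])
  have bP: "\<bar>b i * P i\<bar> \<le> B * a1 * M" for i
    unfolding P_def abs_mult mult.assoc using b_le[of i] a_le[of i] a_pos[of i] M[of i] B_nonneg a1_pos M0
    by (intro mult_mono) auto
  have pbP: "per N (\<lambda>i. b i * P i)" by (rule per_mult[OF per_b pP])
  define J where "J i = fd h P i - (b (i + 1) * P (i + 1) + b i * P i) / 2" for i
  have pJ: "per N J"
    using perD[OF per_fd[OF pP], of h] perD[OF pbP] perD[OF per_shift[OF pbP, of 1]]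
    unfolding per_def J_def by (simp add: algebra_simps)
  have dJ: "J (i + 1) - J i = h * A' \<phi> (i + 1)" for i
  proof -
    have e: "(\<lambda>i. a i * b i * \<phi> i) = (\<lambda>i. b i * P i)" by (simp add: P_def mult_ac)
    show ?thesis unfolding Adj_def e P_def[symmetric] J_def fd_def lp_def cd_def
      using h_pos by (simp add: power2_eq_square field_simps)
  qed
  define c where "c = (\<Sum>i\<in>{0..<N}. J i) / of_int N"
  have N: "real_of_int N > 0" using N_pos by simp
  have "\<bar>J i - c\<bar> \<le> (\<Sum>l\<in>{0..<N}. \<bar>(J (l + 1) - c) - (J l - c)\<bar>)"
  proof (rule per_mean_zero_bound[OF N_pos])
    show "per N (\<lambda>i. J i - c)" by (rule per_comp1[OF pJ])
    show "(\<Sum>i\<in>{0..<N}. J i - c) = 0" using N unfolding c_def by (simp add: sum_subtractf)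
  qed
  also have "\<dots> = (\<Sum>l\<in>{0..<N}. h * \<bar>A' \<phi> (l + 1)\<bar>)" using h_pos by (simp add: dJ abs_mult)
  also have "\<dots> \<le> (\<Sum>l\<in>{0..<N}. h * M)" using h_pos M' by (intro sum_mono mult_left_mono) auto
  also have "\<dots> = len * M" using N unfolding len[symmetric] by simp
  finally have 1: "\<bar>J i - c\<bar> \<le> len * M" .
  \<comment> \<open>The difference quotients in \<open>J\<close> sum to zero, so the mean of the
    flux is minus the mean of \<open>b P\<close>.\<close>
  have 2: "\<bar>c\<bar> \<le> B * a1 * M"
  proof -
    have "(\<Sum>i\<in>{0..<N}. P (i + 1)) = (\<Sum>i\<in>{0..<N}. P i)" by (rule psum_shift[OF N_pos pP])
    then have z: "(\<Sum>i\<in>{0..<N}. fd h P i) = 0"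
      unfolding fd_def sum_divide_distrib[symmetric] by (simp add: sum_subtractf)
    have "(\<Sum>i\<in>{0..<N}. J i) = - (\<Sum>i\<in>{0..<N}. b i * P i)"
      using psum_shift[OF N_pos pbP, of 1] z
      unfolding J_def sum_subtractf by (simp add: sum.distrib sum_divide_distrib[symmetric])
    then have "\<bar>\<Sum>i\<in>{0..<N}. J i\<bar> \<le> (\<Sum>i\<in>{0..<N}. \<bar>b i * P i\<bar>)" by (simp add: sum_abs)
    also have "\<dots> \<le> (\<Sum>i\<in>{0..<N}. B * a1 * M)" by (rule sum_mono[OF bP])
    also have "\<dots> = B * a1 * M * of_int N" using N by simp
    finally show ?thesis unfolding c_def abs_divide using N by (simp add: field_simps)
  qed
  have 3: "fd h P i = J i + (b (i + 1) * P (i + 1) / 2 + b i * P i / 2)"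
    by (simp add: J_def add_divide_distrib)
  have "\<bar>fd h P i\<bar> \<le> len * M + B * a1 * M + B * a1 * M"
    using 1 2 bP[of i] bP[of "i + 1"] unfolding 3 by linarith
  then show ?thesis unfolding P_def by (simp add: algebra_simps)
qed

text \<open>Multiplying by \<open>a\<close> makes the forward equation accessible to the backward
  energy: for \<open>f = a w\<close>, adjointness turns the derivative of \<open>X f\<close> into
  the same quadratic form as for the backward equation.\<close>

lemma forward_unique:
  assumes per: "\<And>s. per N (w s)" and cont: "\<And>i. continuous_on {0..} (\<lambda>s. w s i)"
    and deriv: "\<And>s i. 0 < s \<Longrightarrow> ((\<lambda>s. w s i) has_real_derivative A' (w s) i) (at s)"
    and w0: "\<And>i. w 0 i = 0" and s: "0 \<le> s"
  shows "w s i = 0"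
proof -
  define f where "f s i = a i * w s i" for s i
  have pf: "per N (f s)" for s unfolding f_def by (rule per_mult[OF per_a per])
  have cf: "continuous_on {0..s} (\<lambda>s. f s i)" for i
    unfolding f_def by (intro continuous_intros continuous_on_subset[OF cont]) auto
  have df: "((\<lambda>s. f s i) has_real_derivative a i * A' (w s) i) (at s)" if "0 < s" for s i
    unfolding f_def by (intro DERIV_cmult deriv that)
  have le: "2 * h * (\<Sum>i\<in>{0..<N}. f s i * (a i * A' (w s) i) / a i) \<le> \<kappa> * X (f s)" for s
  proof -
    have "(\<Sum>i\<in>{0..<N}. f s i * (a i * A' (w s) i) / a i) = (\<Sum>i\<in>{0..<N}. A' (w s) i * f s i)"
      using a_nz by (simp add: mult_ac)
    also have "\<dots> = (\<Sum>i\<in>{0..<N}. w s i * A (f s) i)" by (rule adjoint[OF per pf, symmetric])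
    also have "\<dots> = (\<Sum>i\<in>{0..<N}. f s i * A (f s) i / a i)" using a_nz by (simp add: f_def)
    finally show ?thesis
      using energy_X[of "f s" "A (f s)" "\<lambda>_. 0"] pf[of s] Y_nonneg[of "f s"] by simp
  qed
  have "X (f s) + (s - 0) * 0 \<le> exp (\<kappa> * (s - 0)) * X (f 0)"
    by (rule dissipation_decay[OF s X_cont[OF cf] continuous_on_const X_deriv[OF df]])
      (use le in auto)
  then have "X (f s) \<le> 0" by (simp add: f_def w0 Xn_def)
  then have "(\<Sum>i\<in>{0..<N}. (f s i)\<^sup>2 / a i) \<le> 0" using h_pos unfolding Xn_def by (simp add: mult_le_0_iff)
  moreover have nn: "0 \<le> (f s i)\<^sup>2 / a i" for i using a_pos[of i] by simp
  ultimately have "(\<Sum>i\<in>{0..<N}. (f s i)\<^sup>2 / a i) = 0" using sum_nonneg[of "{0..<N}"] by (meson antisym nn)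
  then have "(f s (i mod N))\<^sup>2 / a (i mod N) = 0"
    using N_pos by (subst (asm) sum_nonneg_eq_0_iff) (auto simp: nn)
  then have "w s (i mod N) = 0" using a_nz by (simp add: f_def)
  then show ?thesis using per_mod[OF per] by simp
qed

end

text \<open>The forward equation in the second index is the only equation assumed; the backward
  equation in the first index, on which the energy method rests, is derived from it.\<close>

locale transition_kernel = scheme +
  fixes p :: "int \<Rightarrow> int \<Rightarrow> real \<Rightarrow> real"
  assumes p_per1: "per N (\<lambda>i. p i j s)" and p_per2: "per N (\<lambda>j. p i j s)"
    and p_cont: "continuous_on {0..} (p i j)"
    and p_0: "p i j 0 = unit_at N h j i"
    and p_fwd: "0 < s \<Longrightarrow> (p i j has_real_derivative A' (\<lambda>z. p i z s) j) (at s)"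
begin

text \<open>The difference of the two sides, as a function of \<open>j\<close>, solves the forward
  equation because the operators commute. It vanishes at time zero by adjointness tested on two
  delta functions, so uniqueness makes it vanish always.\<close>

lemma backward_eq_forward:
  assumes s: "0 \<le> s"
  shows "A (\<lambda>z. p z j s) i = A' (\<lambda>y. p i y s) j"
proof -
  define w where "w s j = A (\<lambda>z. p z j s) i - A' (\<lambda>y. p i y s) j" for s j
  have "w s j = 0"
  proof (rule forward_unique[OF _ _ _ _ s])
    show "per N (w s)" for s
    proof -
      have "per N (\<lambda>j. A (\<lambda>z. p z j s) i)" using p_per2 unfolding per_def Aop_def lp_def cd_def by simp
      then show ?thesis using per_A'[OF p_per2, of i s] unfolding w_def per_def by simp
    qed
    show "continuous_on {0..} (\<lambda>s. w s j)" for j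
      unfolding w_def by (intro continuous_on_diff A_cont A'_cont p_cont)
    show "((\<lambda>s. w s j) has_real_derivative A' (w s) j) (at s)" if "0 < s" for s j
    proof -
      have d: "((\<lambda>s. p i j s) has_real_derivative A' (\<lambda>z. p i z s) j) (at s)" for i j
        using p_fwd[OF that] .
      have "((\<lambda>s. w s j) has_real_derivative
          A (\<lambda>z. A' (\<lambda>y. p z y s) j) i - A' (\<lambda>y. A' (\<lambda>z. p i z s) y) j) (at s)"
        unfolding w_def by (intro DERIV_diff A_deriv A'_deriv d)
      also have "A (\<lambda>z. A' (\<lambda>y. p z y s) j) i - A' (\<lambda>y. A' (\<lambda>z. p i z s) y) j = A' (w s) j"
        unfolding Aop_Adj_commute w_def
        unfolding Adj_def lp_def cd_def by (simp add: algebra_simps add_divide_distrib diff_divide_distrib)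
      finally show ?thesis .
    qed
    show "w 0 j = 0" for j
    proof -
      have "(\<Sum>z\<in>{0..<N}. unit_at N h i z * A (unit_at N h j) z) = (\<Sum>z\<in>{0..<N}. A' (unit_at N h i) z * unit_at N h j z)"
        by (rule adjoint[OF per_unit_at per_unit_at])
      also have "\<dots> = (\<Sum>z\<in>{0..<N}. unit_at N h j z * A' (unit_at N h i) z)" by (simp add: mult.commute)
      finally have "A (unit_at N h j) i = A' (unit_at N h i) j"
        using h_pos unfolding psum_unit_at[OF N_pos per_A[OF per_unit_at]] psum_unit_at[OF N_pos per_A'[OF per_unit_at]]
        by simp
      moreover have "(\<lambda>y. p i y 0) = unit_at N h i" by (rule ext) (simp add: p_0 unit_at_sym)
      moreover have "(\<lambda>z. p z j 0) = unit_at N h j" by (rule ext) (simp add: p_0)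
      ultimately show ?thesis by (simp add: w_def)
    qed
  qed
  then show ?thesis by (simp add: w_def)
qed

lemma column_bsol: "bsol (\<lambda>s i. p i j s)"
  unfolding bsol_def
proof (intro conjI allI impI)
  show "per N (\<lambda>i. p i j s)" for s by (rule p_per1)
  show "continuous_on {0..} (\<lambda>s. p i j s)" for i by (rule p_cont)
  show "((\<lambda>s. p i j s) has_real_derivative A (\<lambda>i. p i j s) i) (at s)" if "0 < s" for s i
    using p_fwd[OF that] that by (simp add: backward_eq_forward)
qed

text \<open>At positive times this is the \<open>k\<close>-th time derivative of the kernel. Powers
  of \<open>A\<close> also give it a meaning at time zero.\<close>

definition pk :: "nat \<Rightarrow> int \<Rightarrow> int \<Rightarrow> real \<Rightarrow> real" where
  "pk k i j s = (A ^^ k) (\<lambda>z. p z j s) i"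

lemma pk_0: "pk 0 i j s = p i j s"
  by (simp add: pk_def)

lemma pk_Suc: "pk (Suc k) i j s = A (\<lambda>z. pk k z j s) i"
  by (simp add: pk_def)

lemma pk_bsol: "bsol (\<lambda>s i. pk k i j s)"
  using bsol_Apow[OF column_bsol, of k j] by (simp add: pk_def)

lemma pk_per1: "per N (\<lambda>i. pk k i j s)"
  using pk_bsol by (simp add: bsol_def)

lemma pk_per2: "per N (\<lambda>j. pk k i j s)"
proof -
  have "(\<lambda>z. p z (j + N) s) = (\<lambda>z. p z j s)" for j using perD[OF p_per2] by fastforce
  then show ?thesis by (simp add: per_def pk_def)
qed

lemma pk_cont: "continuous_on {0..} (\<lambda>s. pk k i j s)"
  using pk_bsol by (simp add: bsol_def)

lemma pk_deriv: "0 < s \<Longrightarrow> ((\<lambda>s. pk k i j s) has_real_derivative pk (Suc k) i j s) (at s)"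
  using pk_bsol[of k j] by (simp add: bsol_def pk_Suc)

lemma pk_forward: "0 \<le> s \<Longrightarrow> A' (\<lambda>y. pk k i y s) j = pk (Suc k) i j s"
proof (induction k arbitrary: i j)
  case 0
  then show ?case by (simp add: pk_0 pk_Suc backward_eq_forward)
next
  case (Suc k)
  then show ?case unfolding pk_Suc[of "Suc k"] by (simp add: pk_Suc[of k] Aop_Adj_commute[symmetric])
qed

text \<open>Duality: the backward evolution of the data \<open>p x z \<tau>\<close>, evaluated at
  \<open>x\<close> after time \<tau>, equals the squared norm \<open>F\<close> of these data.
  Smoothing and the Sobolev inequality bound the square of that value by a multiple of
  \<open>F\<close>, so \<open>F\<close> squared is at most a constant times
  \<open>F\<close>.\<close>

lemma forward_L2_le:
  assumes \<tau>: "0 < \<tau>"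
  shows "h * (\<Sum>z\<in>{0..<N}. (p x z \<tau>)\<^sup>2) \<le> (2 * a1 / len + 2 * len) * (exp (\<kappa> * \<tau>) * (1 + 1 / \<tau>)) / a0"
proof -
  let ?f = "\<lambda>z. p x z \<tau>"
  define F where "F = h * (\<Sum>z\<in>{0..<N}. (?f z)\<^sup>2)"
  define v where "v s i = h * (\<Sum>z\<in>{0..<N}. p i z s * ?f z)" for s i
  have F0: "0 \<le> F" unfolding F_def using h_pos by (intro mult_nonneg_nonneg sum_nonneg) auto
  have A_sum: "A (v s) i = h * (\<Sum>z\<in>{0..<N}. A (\<lambda>i. p i z s) i * ?f z)" for s i
  proof -
    obtain c1 c2 c3 where c: "\<And>f. A f i = c1 * f (i + 1) + c2 * f (i - 1) + c3 * f i"
      by (rule Aop_linear_form[of h a b i]) blast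
    show ?thesis unfolding c v_def by (simp add: sum_distrib_left sum.distrib algebra_simps)
  qed
  have v: "bsol v"
    unfolding bsol_def
  proof (intro conjI allI impI)
    show "per N (v s)" for s unfolding v_def per_def using perD[OF p_per1] by simp
    show "continuous_on {0..} (\<lambda>s. v s i)" for i unfolding v_def by (intro continuous_intros p_cont)
    show "((\<lambda>s. v s i) has_real_derivative A (v s) i) (at s)" if "0 < s" for s i
    proof -
      have "((\<lambda>s. p i z s) has_real_derivative A (\<lambda>i. p i z s) i) (at s)" for z
        using column_bsol[of z] that by (simp add: bsol_def)
      then show ?thesis unfolding A_sum unfolding v_def by (intro DERIV_cmult DERIV_sum DERIV_cmult_right)
    qed
  qed
  have v0: "v 0 = ?f"
  proof
    fix i
    have "v 0 i = h * (\<Sum>z\<in>{0..<N}. unit_at N h i z * ?f z)"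
      by (simp add: v_def p_0 unit_at_sym)
    then show "v 0 i = ?f i" using psum_unit_at[OF N_pos p_per2, of h i x \<tau>] h_pos by simp
  qed
  have vx: "v \<tau> x = F" by (simp add: v_def F_def power2_eq_square)
  have c: "0 \<le> 2 * a1 / len + 2 * len" using a1_pos len_pos by simp
  have "X (v \<tau>) + Y (v \<tau>) \<le> exp (\<kappa> * \<tau>) * X ?f + exp (\<kappa> * \<tau>) / \<tau> * X ?f"
    using bsol_X_mono[OF v, of 0 \<tau>] bsol_step_Y[OF v, of 0 \<tau>] \<tau> by (simp add: v0)
  also have "\<dots> = exp (\<kappa> * \<tau>) * (1 + 1 / \<tau>) * X ?f" by (simp add: algebra_simps)
  also have "\<dots> \<le> exp (\<kappa> * \<tau>) * (1 + 1 / \<tau>) * (F / a0)"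
    unfolding F_def using \<tau> by (intro mult_left_mono X_le_psum) auto
  finally have "F\<^sup>2 \<le> (2 * a1 / len + 2 * len) * (exp (\<kappa> * \<tau>) * (1 + 1 / \<tau>) * (F / a0))"
    using sup_le[of "v \<tau>" x] v c unfolding vx bsol_def by (meson mult_left_mono order_trans)
  also have "\<dots> = ((2 * a1 / len + 2 * len) * (exp (\<kappa> * \<tau>) * (1 + 1 / \<tau>)) / a0) * F" by simp
  finally have "F * F \<le> ((2 * a1 / len + 2 * len) * (exp (\<kappa> * \<tau>) * (1 + 1 / \<tau>)) / a0) * F"
    by (simp only: power2_eq_square)
  moreover have "0 \<le> (2 * a1 / len + 2 * len) * (exp (\<kappa> * \<tau>) * (1 + 1 / \<tau>)) / a0"
    using c \<tau> a0_pos by simp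
  moreover have "x \<le> y" if "x * x \<le> y * x" "0 \<le> y" "0 \<le> x" for x y :: real
    using that by (cases "x = 0") (auto simp: mult_le_cancel_right)
  ultimately show ?thesis using F0 unfolding F_def[symmetric] by blast
qed

text \<open>The step \<tau> makes \<open>2 k + 1\<close> steps last exactly \<open>t0 / 2\<close>.
  The evolution can thus be started at a time not before \<open>t0 / 2\<close>, where the integrated
  solution bounds the energy by a multiple of \<open>1 / t0\<close>.\<close>

lemma pk_X_le:
  fixes k :: nat and t0 T s :: real
  defines "\<tau> \<equiv> t0 / (2 * (2 * real k + 1))"
  assumes t: "0 < t0" "t0 \<le> s" "s \<le> T"
  shows "X (\<lambda>i. pk k i j s) \<le> (exp (\<kappa> * \<tau>) / \<tau>) ^ (2 * k) * (4 * unit_const * exp ((2 * \<kappa> + 1) * T) / t0)" (is ?x)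
    and "Y (\<lambda>i. pk k i j s) \<le> (exp (\<kappa> * \<tau>) / \<tau>) ^ (2 * k + 1) * (4 * unit_const * exp ((2 * \<kappa> + 1) * T) / t0)" (is ?y)
proof -
  have v0: "(\<lambda>i. p i j 0) = unit_at N h j" by (rule ext) (rule p_0)
  have X: "X (\<lambda>i. p i j r) \<le> 4 * unit_const * exp ((2 * \<kappa> + 1) * T) / t0" if r: "t0 / 2 \<le> r" "r \<le> T" for r
  proof -
    have r0: "0 < r" using r t by simp
    have "t0 / 2 * X (\<lambda>i. p i j r) \<le> r * X (\<lambda>i. p i j r)" using r X_nonneg by (intro mult_right_mono) auto
    also have "\<dots> \<le> 2 * unit_const * exp ((2 * \<kappa> + 1) * r)"
      using integrated_unit_solution(7)[OF column_bsol v0, of r] r0 by simp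
    also have "\<dots> \<le> 2 * unit_const * exp ((2 * \<kappa> + 1) * T)"
      using r unit_const_pos a1_pos by (auto intro!: mult_left_mono)
    finally show ?thesis using t by (simp add: field_simps)
  qed
  have \<tau>: "0 < \<tau>" using t unfolding \<tau>_def by simp
  have e: "0 \<le> exp (\<kappa> * \<tau>) / \<tau>" using \<tau> by simp
  have k1: "(2 * real k + 1) * \<tau> = t0 / 2" unfolding \<tau>_def by (simp add: field_simps)
  then have k0: "2 * real k * \<tau> \<le> t0 / 2" using \<tau> by (simp add: algebra_simps)
  have "0 \<le> 2 * real k * \<tau>" using \<tau> by simp
  note k = k0 k1 this
  show ?x
  proof -
    have "X ((A ^^ k) (\<lambda>i. p i j (s - 2 * real k * \<tau> + 2 * real k * \<tau>)))
        \<le> (exp (\<kappa> * \<tau>) / \<tau>) ^ (2 * k) * X (\<lambda>i. p i j (s - 2 * real k * \<tau>))"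
      using t k by (intro bsol_pow_X[OF column_bsol _ \<tau>]) linarith
    also have "\<dots> \<le> (exp (\<kappa> * \<tau>) / \<tau>) ^ (2 * k) * (4 * unit_const * exp ((2 * \<kappa> + 1) * T) / t0)"
      using t k by (intro mult_left_mono X zero_le_power e) linarith+
    finally show ?thesis by (simp add: pk_def)
  qed
  show ?y
  proof -
    have "Y ((A ^^ k) (\<lambda>i. p i j (s - (2 * real k + 1) * \<tau> + (2 * real k + 1) * \<tau>)))
        \<le> (exp (\<kappa> * \<tau>) / \<tau>) ^ (2 * k + 1) * X (\<lambda>i. p i j (s - (2 * real k + 1) * \<tau>))"
      using t k by (intro bsol_pow_Y[OF column_bsol _ \<tau>]) linarith
    also have "\<dots> \<le> (exp (\<kappa> * \<tau>) / \<tau>) ^ (2 * k + 1) * (4 * unit_const * exp ((2 * \<kappa> + 1) * T) / t0)"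
      using t k by (intro mult_left_mono X zero_le_power e) linarith+
    finally show ?thesis by (simp add: pk_def)
  qed
qed

end

section \<open>Hat averages and grid refinement\<close>

definition sdiff2 :: "(int \<Rightarrow> real) \<Rightarrow> int \<Rightarrow> int \<Rightarrow> real" where
  "sdiff2 f n k = f (n + k) + f (n - k) - 2 * f n"

text \<open>The average of \<open>f\<close> against the hat function of half-width \<open>q\<close> centred at \<open>n\<close>; since the
  weights sum to 1, it can be expressed by symmetric second differences.\<close>

definition hat :: "nat \<Rightarrow> (int \<Rightarrow> real) \<Rightarrow> int \<Rightarrow> real" where
  "hat q f n = f n + (\<Sum>k\<in>{1..<q}. (real q - real k) * sdiff2 f n (int k)) / (real q)\<^sup>2"

lemma sum_weights: "(\<Sum>k\<in>{1..<q}. real q - real k) = real q * (real q - 1) / 2"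
proof (cases "q = 0")
  case False
  then have "(\<Sum>k\<in>{1..<q}. real k) = real q * (real q - 1) / 2"
  proof (induction q)
    case (Suc q)
    then show ?case by (cases "q = 0") (auto simp: field_simps)
  qed simp
  then show ?thesis using False by (simp add: sum_subtractf of_nat_diff field_simps)
qed simp

lemma sum_idx: "1 \<le> q \<Longrightarrow> (\<Sum>k\<in>{1..<q}. real k) = real q * (real q - 1) / 2"
  using sum_weights[of q] by (simp add: sum_subtractf of_nat_diff field_simps)

lemma hat_add: "hat q (\<lambda>i. f i + g i) n = hat q f n + hat q g n"
  unfolding hat_def sdiff2_def
  by (simp add: algebra_simps sum.distrib[symmetric] add_divide_distrib[symmetric])

text \<open>The off-centre weights sum to less than one half. The alternative
  \<open>q \<le> 1\<close> is needed because the sum is then empty and nothing forces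
  \<open>e\<close> to be nonnegative.\<close>

lemma hat_weight_sum_le:
  assumes "\<And>k. k \<in> {1..<q} \<Longrightarrow> \<bar>x k\<bar> \<le> e"
  shows "\<bar>(\<Sum>k\<in>{1..<q}. (real q - real k) * x k) / (real q)\<^sup>2\<bar> \<le> e \<or> q \<le> 1"
proof (cases "q \<le> 1")
  case False
  then have q: "1 < real q" by simp
  have e: "0 \<le> e" using assms[of 1] False by auto
  have "\<bar>\<Sum>k\<in>{1..<q}. (real q - real k) * x k\<bar> \<le> (\<Sum>k\<in>{1..<q}. (real q - real k) * e)"
    using assms by (intro order_trans[OF sum_abs sum_mono]) (auto simp: abs_mult intro!: mult_left_mono)
  also have "\<dots> = real q * (real q - 1) / 2 * e" unfolding sum_distrib_right[symmetric] sum_weights ..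
  also have "\<dots> \<le> (real q)\<^sup>2 * e" using e q by (intro mult_right_mono) (auto simp: power2_eq_square field_simps)
  finally show ?thesis using q by (simp add: abs_divide field_simps)
qed simp

lemma hat_weight_le:
  assumes "0 \<le> e" "\<And>k. k \<in> {1..<q} \<Longrightarrow> \<bar>x k\<bar> \<le> e"
  shows "\<bar>(\<Sum>k\<in>{1..<q}. (real q - real k) * x k) / (real q)\<^sup>2\<bar> \<le> e"
  using hat_weight_sum_le[of q x e] assms by (cases "q \<le> 1") auto

lemma hat_sub_le:
  assumes "0 \<le> e" "\<And>k. k \<in> {1..<q} \<Longrightarrow> \<bar>sdiff2 f n (int k)\<bar> \<le> e"
  shows "\<bar>hat q f n - f n\<bar> \<le> e"
  using hat_weight_le[of e q "\<lambda>k. sdiff2 f n (int k)"] assms by (simp add: hat_def)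

text \<open>Triangular weights invert the second difference: raising \<open>q\<close> by one raises
  every weight by one, and the sum of second differences added in this way telescopes.\<close>

lemma weighted_second_diff:
  fixes e :: "nat \<Rightarrow> real"
  assumes "e 0 = 0"
  shows "real q * e 1 + (\<Sum>k\<in>{1..<q}. (real q - real k) * (e (k + 1) + e (k - 1) - 2 * e k)) = e q"
proof (induction q)
  case 0
  then show ?case using assms by simp
next
  case (Suc q)
  let ?t = "\<lambda>k. e (k + 1) + e (k - 1) - 2 * e k"
  have tel: "(\<Sum>k\<in>{1..<Suc q}. ?t k) = e (q + 1) - e q - e 1" for q
    by (induction q) (auto simp: assms)
  have "(\<Sum>k\<in>{1..<Suc q}. (real (Suc q) - real k) * ?t k)
      = (\<Sum>k\<in>{1..<Suc q}. (real q - real k) * ?t k) + (\<Sum>k\<in>{1..<Suc q}. ?t k)"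
    unfolding sum.distrib[symmetric] by (rule sum.cong) (auto simp: algebra_simps)
  also have "(\<Sum>k\<in>{1..<Suc q}. (real q - real k) * ?t k) = (\<Sum>k\<in>{1..<q}. (real q - real k) * ?t k)"
    by (cases q) auto
  finally show ?case using Suc tel[of q] by (simp add: algebra_simps)
qed

lemma weighted_central_diff:
  fixes o' :: "nat \<Rightarrow> real"
  assumes "o' 0 = 0"
  shows "real q * o' 1 + (\<Sum>k\<in>{1..<q}. (real q - real k) * (o' (k + 1) - o' (k - 1)))
    = 2 * (\<Sum>k\<in>{1..<q}. o' k) + o' q"
proof (induction q)
  case 0
  then show ?case using assms by simp
next
  case (Suc q)
  let ?t = "\<lambda>k. o' (k + 1) - o' (k - 1)"
  have tel: "(\<Sum>k\<in>{1..<Suc q}. ?t k) = o' (q + 1) + o' q - o' 1" for q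
    by (induction q) (auto simp: assms)
  have "(\<Sum>k\<in>{1..<Suc q}. (real (Suc q) - real k) * ?t k)
      = (\<Sum>k\<in>{1..<Suc q}. (real q - real k) * ?t k) + (\<Sum>k\<in>{1..<Suc q}. ?t k)"
    unfolding sum.distrib[symmetric] by (rule sum.cong) (auto simp: algebra_simps)
  also have "(\<Sum>k\<in>{1..<Suc q}. (real q - real k) * ?t k) = (\<Sum>k\<in>{1..<q}. (real q - real k) * ?t k)"
    by (cases q) auto
  moreover have "(\<Sum>k\<in>{1..<Suc q}. o' k) = (\<Sum>k\<in>{1..<q}. o' k) + o' q"
    using assms by (cases q) auto
  ultimately show ?case using Suc tel[of q] by (simp add: algebra_simps)
qed

text \<open>The familiar form with weights decreasing linearly from the centre. The definition by
  second differences is kept for error bounds, this form for exact identities.\<close>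

lemma hat_eq_weighted:
  assumes "1 \<le> q"
  shows "(real q)\<^sup>2 * hat q f n = real q * f n
    + (\<Sum>k\<in>{1..<q}. (real q - real k) * (f (n + int k) + f (n - int k)))"
proof -
  have "(\<Sum>k\<in>{1..<q}. (real q - real k) * sdiff2 f n (int k))
      = (\<Sum>k\<in>{1..<q}. (real q - real k) * (f (n + int k) + f (n - int k)))
        - 2 * f n * (\<Sum>k\<in>{1..<q}. real q - real k)"
    unfolding sum_distrib_left sum_subtractf[symmetric]
    by (rule sum.cong) (auto simp: sdiff2_def algebra_simps)
  moreover have "(real q)\<^sup>2 * hat q f n = (real q)\<^sup>2 * f n + (\<Sum>k\<in>{1..<q}. (real q - real k) * sdiff2 f n (int k))"
    using assms by (simp add: hat_def distrib_left)
  moreover have "x * x * y + (w - 2 * y * (x * (x - 1) / 2)) = x * y + w" for x y w :: real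
    by (simp add: field_simps)
  ultimately show ?thesis unfolding sum_weights power2_eq_square by simp
qed

lemma hat_scale: "hat q (\<lambda>i. f i * c) n = hat q f n * c"
proof -
  have "sdiff2 (\<lambda>i. f i * c) n k = sdiff2 f n k * c" for k by (simp add: sdiff2_def algebra_simps)
  then show ?thesis
    by (simp add: hat_def distrib_right sum_distrib_right mult.assoc)
qed

text \<open>Hat averages are chosen because they turn fine second differences into coarse ones exactly,
  whatever the regularity of \<open>f\<close>.\<close>

lemma hat_second_diff:
  assumes "1 \<le> q"
  shows "(real q)\<^sup>2 * hat q (\<lambda>n. f (n + 1) + f (n - 1) - 2 * f n) n = f (n + int q) + f (n - int q) - 2 * f n"
proof -
  let ?e = "\<lambda>k::nat. f (n + int k) + f (n - int k) - 2 * f n"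
  have "real q * ?e 1 + (\<Sum>k\<in>{1..<q}. (real q - real k) * (?e (k + 1) + ?e (k - 1) - 2 * ?e k)) = ?e q"
    by (rule weighted_second_diff) simp
  moreover have "(\<Sum>k\<in>{1..<q}. (real q - real k) * (?e (k + 1) + ?e (k - 1) - 2 * ?e k))
     = (\<Sum>k\<in>{1..<q}. (real q - real k) * ((f (n + int k + 1) + f (n + int k - 1) - 2 * f (n + int k))
       + (f (n - int k + 1) + f (n - int k - 1) - 2 * f (n - int k))))"
    by (rule sum.cong) (auto simp: of_nat_diff algebra_simps)
  ultimately show ?thesis unfolding hat_eq_weighted[OF assms] by simp
qed

lemma lp_restrict:
  assumes q: "1 \<le> q" and h': "0 < h'" and h: "h = real q * h'"
  shows "lp h (\<lambda>i. f (int q * i)) i = hat q (lp h' f) (int q * i)"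
proof -
  have e: "lp h' f = (\<lambda>n. (f (n + 1) + f (n - 1) - 2 * f n) * (1 / h'\<^sup>2))" by (rule ext) (simp add: lp_def)
  have "hat q (lp h' f) n = hat q (\<lambda>n. f (n + 1) + f (n - 1) - 2 * f n) n * (1 / h'\<^sup>2)" for n
    unfolding e by (rule hat_scale)
  moreover have "hat q (\<lambda>n. f (n + 1) + f (n - 1) - 2 * f n) n = (f (n + int q) + f (n - int q) - 2 * f n) / (real q)\<^sup>2" for n
    using hat_second_diff[OF q, of f n] q by (simp add: field_simps)
  ultimately show ?thesis
    unfolding lp_def h by (simp add: algebra_simps power_mult_distrib)
qed

text \<open>The mean over the coarse cell from \<open>n\<close> to \<open>n + q\<close> by the fine
  trapezoidal rule, minus the mean of the two end values.\<close>

definition trap_err :: "nat \<Rightarrow> (int \<Rightarrow> real) \<Rightarrow> int \<Rightarrow> real" where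
  "trap_err q f n = (f n / 2 + (\<Sum>k\<in>{1..<q}. f (n + int k)) + f (n + int q) / 2) / real q - (f n + f (n + int q)) / 2"

lemma sum_rev_idx: "(\<Sum>k\<in>{1..<q}. F (int q - int k)) = (\<Sum>k\<in>{1..<q}. F (int k))"
  by (rule sum.reindex_bij_witness[of _ "\<lambda>k. q - k" "\<lambda>k. q - k"]) (auto simp: of_nat_diff)

text \<open>The averaged central difference is a difference of the trapezoidal means of
  \<open>f\<close> over the two adjacent coarse cells, and the coarse central difference is the same
  with end values only. The error is therefore a coarse difference quotient of
  \<open>trap_err\<close>, ready for summation by parts.\<close>

lemma hat_cd:
  assumes q: "1 \<le> q" and h': "0 < h'" and h: "h = real q * h'"
  shows "hat q (cd h' f) n - (f (n + int q) - f (n - int q)) / (2 * h)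
    = (trap_err q f n - trap_err q f (n - int q)) / h"
proof -
  let ?o = "\<lambda>k::nat. f (n + int k) - f (n - int k)"
  have "real q * ?o 1 + (\<Sum>k\<in>{1..<q}. (real q - real k) * (?o (k + 1) - ?o (k - 1)))
      = 2 * (\<Sum>k\<in>{1..<q}. ?o k) + ?o q"
    by (rule weighted_central_diff) simp
  moreover have "(\<Sum>k\<in>{1..<q}. (real q - real k) * (?o (k + 1) - ?o (k - 1)))
      = 2 * h' * (\<Sum>k\<in>{1..<q}. (real q - real k) * (cd h' f (n + int k) + cd h' f (n - int k)))"
    unfolding sum_distrib_left using h'
    by (intro sum.cong refl) (auto simp: cd_def of_nat_diff field_simps)
  moreover have "?o 1 = 2 * h' * cd h' f n" using h' by (simp add: cd_def)
  ultimately have "2 * h' * ((real q)\<^sup>2 * hat q (cd h' f) n) = 2 * (\<Sum>k\<in>{1..<q}. ?o k) + ?o q"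
    unfolding hat_eq_weighted[OF q] by (simp add: algebra_simps)
  then have 1: "hat q (cd h' f) n = (2 * (\<Sum>k\<in>{1..<q}. ?o k) + ?o q) / (2 * h * real q)"
    using q h' unfolding h by (simp add: field_simps power2_eq_square)
  have "(\<Sum>k\<in>{1..<q}. f (n - int q + int k)) = (\<Sum>k\<in>{1..<q}. f (n - int k))"
    using sum_rev_idx[of "\<lambda>k. f (n - k)" q] by (simp add: algebra_simps)
  then show ?thesis unfolding 1 trap_err_def sum_subtractf using q h' unfolding h
    by (simp add: field_simps)
qed

text \<open>The sum runs over the open support of the hat. For second differences, \<open>h'\<close>
  times this bounds the variation of the slope there.\<close>

definition lsum :: "nat \<Rightarrow> (int \<Rightarrow> real) \<Rightarrow> int \<Rightarrow> real" where
  "lsum q F n = (\<Sum>l\<in>{n - int q<..<n + int q}. \<bar>F l\<bar>)"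

lemma lsum_nonneg: "0 \<le> lsum q F n"
  unfolding lsum_def by (intro sum_nonneg) auto

lemma fd_diff_le:
  assumes h: "0 < h'" and m: "n - int q \<le> m" "m < n + int q" and k: "n - int q \<le> k" "k < n + int q"
  shows "\<bar>fd h' f m - fd h' f k\<bar> \<le> h' * lsum q (lp h' f) n"
proof -
  have e: "fd h' f (l + 1) - fd h' f l = h' * lp h' f (l + 1)" for l
    using h by (simp add: fd_def lp_def power2_eq_square field_simps)
  have le: "\<bar>fd h' f m - fd h' f k\<bar> \<le> h' * lsum q (lp h' f) n" if "n - int q \<le> k" "k \<le> m" "m < n + int q" for k m
  proof -
    have "\<bar>fd h' f m - fd h' f k\<bar> \<le> (\<Sum>l\<in>{k..<m}. \<bar>fd h' f (l + 1) - fd h' f l\<bar>)"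
      by (rule telescope_abs_le[OF that(2)])
    also have "\<dots> = h' * (\<Sum>l\<in>{k..<m}. \<bar>lp h' f (l + 1)\<bar>)"
      unfolding e using h by (simp add: abs_mult sum_distrib_left)
    also have "(\<Sum>l\<in>{k..<m}. \<bar>lp h' f (l + 1)\<bar>) = (\<Sum>l\<in>{k<..m}. \<bar>lp h' f l\<bar>)"
      by (rule sum.reindex_bij_witness[of _ "\<lambda>l. l - 1" "\<lambda>l. l + 1"]) auto
    also have "\<dots> \<le> lsum q (lp h' f) n" unfolding lsum_def using that by (intro sum_mono2) auto
    finally show ?thesis using h by simp
  qed
  show ?thesis using le[of k m] le[of m k] m k by (cases "k \<le> m") (auto simp: abs_minus_commute)
qed

lemma cd_fd: "cd h f i = fd h f i / 2 + fd h f (i - 1) / 2"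
  by (simp add: cd_def fd_def add_divide_distrib[symmetric])

lemma cd_diff_le:
  assumes h: "0 < h'" and m: "n - int q < m" "m < n + int q" and k: "n - int q < k" "k < n + int q"
  shows "\<bar>cd h' f m - cd h' f k\<bar> \<le> h' * lsum q (lp h' f) n"
  using fd_diff_le[OF h, of n q m k f] fd_diff_le[OF h, of n q "m - 1" "k - 1" f] m k
  unfolding cd_fd by linarith

lemma h_fd: "0 < h \<Longrightarrow> h * fd h f i = f (i + 1) - f i"
  by (simp add: fd_def)

lemma sum_fd:
  assumes "0 < h'"
  shows "f (n + int k) - f n = h' * (\<Sum>j<k. fd h' f (n + int j))"
proof (induction k)
  case (Suc k)
  have "f (n + int (Suc k)) - f n = (f (n + int k) - f n) + h' * fd h' f (n + int k)"
    unfolding h_fd[OF assms] by (simp add: algebra_simps)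
  then show ?case using Suc by (simp add: algebra_simps)
qed simp

lemma diff_le_fd:
  assumes "0 < h'" "\<And>i. \<bar>fd h' f i\<bar> \<le> \<Lambda>"
  shows "\<bar>f (n + int k) - f n\<bar> \<le> real k * h' * \<Lambda>"
proof -
  have "\<bar>\<Sum>j<k. fd h' f (n + int j)\<bar> \<le> (\<Sum>j<k. \<Lambda>)"
    by (rule order_trans[OF sum_abs sum_mono]) (rule assms)
  then have "h' * \<bar>\<Sum>j<k. fd h' f (n + int j)\<bar> \<le> h' * (\<Sum>j<k. \<Lambda>)" using assms by (intro mult_left_mono) auto
  then show ?thesis unfolding sum_fd[OF assms(1)] using assms(1) by (simp add: abs_mult mult_ac)
qed

lemma diff_le_fd':
  assumes "0 < h'" "\<And>i. \<bar>fd h' f i\<bar> \<le> \<Lambda>"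
  shows "\<bar>f (n - int k) - f n\<bar> \<le> real k * h' * \<Lambda>"
  using diff_le_fd[OF assms, of "n - int k" k] by (simp add: abs_minus_commute)

text \<open>Each step outwards adds the difference of two slopes inside the hat, bounded by the
  local variation. Only summability of the second differences is used, so a kink is allowed.\<close>

lemma sdiff2_le_lsum:
  assumes h: "0 < h'" and k: "k \<le> q"
  shows "\<bar>sdiff2 f n (int k)\<bar> \<le> real k * h' * (h' * lsum q (lp h' f) n)"
  using k
proof (induction k)
  case 0
  then show ?case by (simp add: sdiff2_def)
next
  case (Suc k)
  have "sdiff2 f n (int (Suc k)) = sdiff2 f n (int k) + h' * (fd h' f (n + int k) - fd h' f (n - int k - 1))"
    unfolding right_diff_distrib h_fd[OF h] by (simp add: sdiff2_def algebra_simps)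
  moreover have "\<bar>h' * (fd h' f (n + int k) - fd h' f (n - int k - 1))\<bar> \<le> h' * (h' * lsum q (lp h' f) n)"
    unfolding abs_mult using h Suc.prems by (intro mult_mono fd_diff_le) auto
  ultimately have "\<bar>sdiff2 f n (int (Suc k))\<bar> \<le> real k * h' * (h' * lsum q (lp h' f) n) + h' * (h' * lsum q (lp h' f) n)"
    using Suc by linarith
  then show ?case by (simp add: algebra_simps)
qed

text \<open>The trapezoidal error vanishes on affine functions, so only the deviation from the
  tangent line at \<open>n\<close> counts, and that is controlled by the variation of the
  slope.\<close>

lemma trap_err_le:
  assumes q: "1 \<le> q" and h: "0 < h'"
  shows "\<bar>trap_err q f n\<bar> \<le> 2 * (real q * h') * (h' * lsum q (lp h' f) n)"
proof -
  define \<sigma> where "\<sigma> = h' * lsum q (lp h' f) n"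
  have \<sigma>: "0 \<le> \<sigma>" unfolding \<sigma>_def using h lsum_nonneg by simp
  define r where "r k = f (n + int k) - f n - real k * h' * fd h' f n" for k
  have r: "\<bar>r k\<bar> \<le> real q * h' * \<sigma>" if "k \<le> q" for k
  proof -
    have "r k = h' * (\<Sum>j<k. fd h' f (n + int j) - fd h' f n)"
      unfolding r_def sum_fd[OF h, of f n k] by (simp add: sum_subtractf right_diff_distrib mult_ac)
    then have "\<bar>r k\<bar> = h' * \<bar>\<Sum>j<k. fd h' f (n + int j) - fd h' f n\<bar>" using h by (simp add: abs_mult)
    also have "\<dots> \<le> h' * (\<Sum>j<k. \<sigma>)"
      unfolding \<sigma>_def using h that
      by (intro mult_left_mono order_trans[OF sum_abs sum_mono] fd_diff_le) auto
    also have "\<dots> = real k * h' * \<sigma>" by simp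
    also have "\<dots> \<le> real q * h' * \<sigma>" using that h \<sigma> by (intro mult_right_mono) auto
    finally show ?thesis .
  qed
  have f: "f (n + int k) = f n + real k * h' * fd h' f n + r k" for k by (simp add: r_def)
  have q0: "0 < real q" using q by simp
  have "real q * trap_err q f n = (\<Sum>k\<in>{1..<q}. r k) + r q / 2 - real q * r q / 2"
  proof -
    have S: "(\<Sum>k\<in>{1..<q}. f (n + int k)) = (real q - 1) * f n + real q * (real q - 1) / 2 * (h' * fd h' f n)
        + (\<Sum>k\<in>{1..<q}. r k)"
      unfolding f sum.distrib mult.assoc sum_distrib_right[symmetric] sum_idx[OF q]
      using q by (simp add: of_nat_diff)
    have "real q * trap_err q f n = (f n / 2 + (\<Sum>k\<in>{1..<q}. f (n + int k)) + f (n + int q) / 2)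
        - real q * ((f n + f (n + int q)) / 2)"
      using q0 by (simp add: trap_err_def right_diff_distrib)
    then show ?thesis unfolding S f[of q] by (simp add: field_simps)
  qed
  moreover have "\<bar>\<Sum>k\<in>{1..<q}. r k\<bar> \<le> (\<Sum>k\<in>{1..<q}. real q * h' * \<sigma>)"
    using r by (intro order_trans[OF sum_abs sum_mono]) auto
  then have "\<bar>\<Sum>k\<in>{1..<q}. r k\<bar> \<le> (real q - 1) * (real q * h' * \<sigma>)" using q by (simp add: of_nat_diff)
  moreover have "\<bar>r q\<bar> \<le> real q * h' * \<sigma>" by (rule r) simp
  moreover have "\<bar>real q * r q\<bar> \<le> real q * (real q * h' * \<sigma>)" unfolding abs_mult using r[of q] by (simp add: mult_left_mono)
  ultimately have "\<bar>real q * trap_err q f n\<bar> \<le> (real q - 1) * (real q * h' * \<sigma>) + real q * h' * \<sigma> / 2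
      + real q * (real q * h' * \<sigma>) / 2" by linarith
  also have "\<dots> \<le> real q * (2 * (real q * h') * \<sigma>)"
  proof -
    have "0 \<le> real q * h' * \<sigma>" using h \<sigma> by simp
    moreover have "0 \<le> real q * (real q * h' * \<sigma>)" using h \<sigma> by simp
    ultimately show ?thesis by (simp add: algebra_simps)
  qed
  finally show ?thesis unfolding abs_mult \<sigma>_def[symmetric] using q0 by simp
qed

lemma sdiff2_mult:
  "sdiff2 (\<lambda>i. c i * f i) n k = c n * sdiff2 f n k + f n * sdiff2 c n k
    + (c (n + k) - c n) * (f (n + k) - f n) + (c (n - k) - c n) * (f (n - k) - f n)"
  by (simp add: sdiff2_def algebra_simps)

section \<open>Comparison of difference operators on two grids\<close>

lemma psum_blocks:
  assumes N: "0 < N"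
  shows "(\<Sum>i\<in>{0..<N}. \<Sum>l\<in>{int q * i..<int q * i + int q}. F l) = (\<Sum>l\<in>{0..<int q * N}. (F l :: real))"
proof -
  have "(\<Sum>i\<in>{0..<int k}. \<Sum>l\<in>{int q * i..<int q * i + int q}. F l) = (\<Sum>l\<in>{0..<int q * int k}. F l)" for k
  proof (induction k)
    case (Suc k)
    have "{0..<int (Suc k)} = insert (int k) {0..<int k}" by auto
    moreover have "{0..<int q * int (Suc k)} = {0..<int q * int k} \<union> {int q * int k..<int q * int k + int q}"
      by (auto simp: algebra_simps) (metis add_nonneg_nonneg of_nat_0_le_iff of_nat_mult order_trans)
    then have "(\<Sum>l\<in>{0..<int q * int (Suc k)}. F l)
        = (\<Sum>l\<in>{0..<int q * int k}. F l) + (\<Sum>l\<in>{int q * int k..<int q * int k + int q}. F l)"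
      by (simp only:) (rule sum.union_disjoint, auto)
    ultimately show ?case using Suc by simp
  qed simp
  from this[of "nat N"] show ?thesis using N by simp
qed

text \<open>The hat centred at \<open>i\<close> covers the cells \<open>i - 1\<close> and
  \<open>i\<close>, so each fine point is counted at most twice.\<close>

lemma psum_lsum_le:
  assumes N: "0 < N" and F: "per (int q * N) F"
  shows "(\<Sum>i\<in>{0..<N}. lsum q F (int q * i)) \<le> 2 * (\<Sum>l\<in>{0..<int q * N}. \<bar>F l\<bar>)"
proof -
  define c where "c i = (\<Sum>l\<in>{int q * i..<int q * i + int q}. \<bar>F l\<bar>)" for i
  have pc: "per N c"
    unfolding per_def
  proof
    fix i
    show "c (i + N) = c i" unfolding c_def
      by (rule sum.reindex_bij_witness[of _ "\<lambda>l. l + int q * N" "\<lambda>l. l - int q * N"])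
        (use perD[OF per_shift'[OF F, of "int q * N"]] perD[OF F] in \<open>auto simp: algebra_simps\<close>)
  qed
  have "lsum q F (int q * i) \<le> c (i - 1) + c i" for i
  proof -
    have "lsum q F (int q * i) \<le> (\<Sum>l\<in>{int q * (i - 1)..<int q * (i - 1) + int q} \<union> {int q * i..<int q * i + int q}. \<bar>F l\<bar>)"
      unfolding lsum_def by (intro sum_mono2) (auto simp: algebra_simps)
    also have "\<dots> = c (i - 1) + c i" unfolding c_def
      by (rule sum.union_disjoint) (auto simp: algebra_simps)
    finally show ?thesis .
  qed
  then have "(\<Sum>i\<in>{0..<N}. lsum q F (int q * i)) \<le> (\<Sum>i\<in>{0..<N}. c (i - 1) + c i)" by (rule sum_mono)
  also have "\<dots> = 2 * (\<Sum>i\<in>{0..<N}. c i)" using psum_shift'[OF N pc, of 1] by (simp add: sum.distrib)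
  also have "(\<Sum>i\<in>{0..<N}. c i) = (\<Sum>l\<in>{0..<int q * N}. \<bar>F l\<bar>)" unfolding c_def by (rule psum_blocks[OF N])
  finally show ?thesis .
qed

text \<open>The numbers \<open>e1\<close> and \<open>e2\<close> stand for the first and second
  difference moduli of the coefficients at distance \<open>h\<close>. Keeping them abstract
  separates the grid estimates from the exponent \<gamma>.\<close>

locale refinement =
  fixes q :: nat and N :: int and h h' len M e1 e2 :: real
  assumes q: "1 \<le> q" and N_pos: "0 < N" and h'_pos: "0 < h'" and h: "h = real q * h'"
    and len: "of_int N * h = len"
    and M: "0 \<le> M" and e1: "0 \<le> e1" and e2: "0 \<le> e2"
begin

definition osc :: "(int \<Rightarrow> real) \<Rightarrow> bool" where
  "osc c \<longleftrightarrow> per (int q * N) c \<and> (\<forall>n. \<bar>c n\<bar> \<le> M \<and>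
     (\<forall>k\<le>q. \<bar>c (n + int k) - c n\<bar> \<le> e1 \<and> \<bar>sdiff2 c n (int k)\<bar> \<le> e2))"

lemma h_pos: "0 < h"
  unfolding h using q h'_pos by simp

lemma oscD:
  assumes "osc c"
  shows "per (int q * N) c" "\<bar>c n\<bar> \<le> M" "k \<le> q \<Longrightarrow> \<bar>c (n + int k) - c n\<bar> \<le> e1"
    "k \<le> q \<Longrightarrow> \<bar>c (n - int k) - c n\<bar> \<le> e1" "k \<le> q \<Longrightarrow> \<bar>sdiff2 c n (int k)\<bar> \<le> e2"
proof -
  show "k \<le> q \<Longrightarrow> \<bar>c (n - int k) - c n\<bar> \<le> e1"
    using assms unfolding osc_def by (metis abs_minus_commute diff_add_cancel)
qed (use assms in \<open>auto simp: osc_def\<close>)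

section \<open>Hat averages of products with rough coefficients\<close>

lemma sdiff2_prod_le:
  assumes c: "osc c" and k: "k \<le> q" and f: "\<bar>f n\<bar> \<le> \<Phi>"
    and d: "\<bar>f (n + int k) - f n\<bar> \<le> d" "\<bar>f (n - int k) - f n\<bar> \<le> d"
  shows "\<bar>sdiff2 (\<lambda>i. c i * f i) n (int k) - c n * sdiff2 f n (int k)\<bar> \<le> e2 * \<Phi> + 2 * e1 * d"
proof -
  have "\<bar>f n * sdiff2 c n (int k)\<bar> \<le> \<Phi> * e2"
    unfolding abs_mult using f oscD(5)[OF c k] by (intro mult_mono) auto
  moreover have "\<bar>(c (n + int k) - c n) * (f (n + int k) - f n)\<bar> \<le> e1 * d"
    unfolding abs_mult using d oscD(3)[OF c k] e1 by (intro mult_mono) auto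
  moreover have "\<bar>(c (n - int k) - c n) * (f (n - int k) - f n)\<bar> \<le> e1 * d"
    unfolding abs_mult using d oscD(4)[OF c k] e1 by (intro mult_mono) auto
  ultimately show ?thesis unfolding sdiff2_mult by (simp add: mult.commute)
qed

text \<open>In the product rule for second differences the term with \<open>c n\<close> cancels.
  What is left is \<open>e2\<close> times the size of \<open>f\<close> and \<open>e1\<close> times
  the increments of \<open>f\<close>; a first difference of the coefficient never appears
  alone.\<close>

lemma hat_prod_sub:
  assumes c: "osc c" and f: "\<bar>f n\<bar> \<le> \<Phi>" and d0: "0 \<le> d"
    and d: "\<And>k. k \<in> {1..<q} \<Longrightarrow> \<bar>f (n + int k) - f n\<bar> \<le> d"
      "\<And>k. k \<in> {1..<q} \<Longrightarrow> \<bar>f (n - int k) - f n\<bar> \<le> d"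
  shows "\<bar>hat q (\<lambda>i. c i * f i) n - c n * hat q f n\<bar> \<le> e2 * \<Phi> + 2 * e1 * d"
proof -
  have "hat q (\<lambda>i. c i * f i) n - c n * hat q f n
    = (\<Sum>k\<in>{1..<q}. (real q - real k) * (sdiff2 (\<lambda>i. c i * f i) n (int k) - c n * sdiff2 f n (int k))) / (real q)\<^sup>2"
    unfolding hat_def right_diff_distrib sum_subtractf diff_divide_distrib
    by (simp add: distrib_left sum_distrib_left mult_ac sum_subtractf right_diff_distrib left_diff_distrib)
  also have "\<bar>\<dots>\<bar> \<le> e2 * \<Phi> + 2 * e1 * d"
    using f d d0 e1 e2 by (intro hat_weight_le sdiff2_prod_le[OF c]) auto
  finally show ?thesis .
qed

lemma fd_local:
  assumes "\<And>i. \<bar>fd h' f i\<bar> \<le> \<Lambda>" "k \<le> q"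
  shows "\<bar>f (n + int k) - f n\<bar> \<le> h * \<Lambda>" "\<bar>f (n - int k) - f n\<bar> \<le> h * \<Lambda>"
proof -
  have "0 \<le> \<Lambda>" using assms(1)[of 0] by linarith
  then have "real k * h' * \<Lambda> \<le> h * \<Lambda>" unfolding h using assms h'_pos by (intro mult_right_mono) auto
  then show "\<bar>f (n + int k) - f n\<bar> \<le> h * \<Lambda>" "\<bar>f (n - int k) - f n\<bar> \<le> h * \<Lambda>"
    using diff_le_fd[OF h'_pos assms(1), where n=n and k=k] diff_le_fd'[OF h'_pos assms(1), where n=n and k=k] by auto
qed

abbreviation \<sigma> where "\<sigma> f n \<equiv> h' * lsum q (lp h' f) n"

lemma \<sigma>_nonneg: "0 \<le> \<sigma> f n"
  using lsum_nonneg h'_pos by simp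

lemma sdiff2_le_\<sigma>: "k \<le> q \<Longrightarrow> \<bar>sdiff2 f n (int k)\<bar> \<le> h * \<sigma> f n"
proof -
  assume k: "k \<le> q"
  have "real k * h' * \<sigma> f n \<le> h * \<sigma> f n" unfolding h using k h'_pos \<sigma>_nonneg by (intro mult_right_mono) auto
  then show ?thesis using sdiff2_le_lsum[OF h'_pos k, of f n] by linarith
qed

lemma \<sigma>_le_sup:
  assumes "\<And>i. \<bar>lp h' f i\<bar> \<le> S"
  shows "\<sigma> f n \<le> 2 * h * S"
proof -
  have S: "0 \<le> S" using assms[of 0] by linarith
  have "lsum q (lp h' f) n \<le> (\<Sum>l\<in>{n - int q<..<n + int q}. S)" unfolding lsum_def by (intro sum_mono assms)
  also have "\<dots> \<le> 2 * real q * S" using S q by (auto intro!: mult_right_mono)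
  finally have "h' * lsum q (lp h' f) n \<le> h' * (2 * real q * S)" using h'_pos by simp
  then show ?thesis unfolding h by (simp add: mult_ac)
qed

lemma hat_prod_local:
  assumes c: "osc c" and f: "\<bar>f n\<bar> \<le> \<Lambda>" "\<And>i. \<bar>fd h' f i\<bar> \<le> \<Lambda>"
  shows "\<bar>hat q (\<lambda>i. c i * f i) n - c n * f n\<bar> \<le> M * (h * \<sigma> f n) + (e2 + 2 * e1 * h) * \<Lambda>"
proof -
  have \<Lambda>: "0 \<le> \<Lambda>" using f(1) by linarith
  have "\<bar>hat q (\<lambda>i. c i * f i) n - c n * hat q f n\<bar> \<le> e2 * \<Lambda> + 2 * e1 * (h * \<Lambda>)"
    using \<Lambda> h_pos fd_local[OF f(2)] by (intro hat_prod_sub c f(1)) auto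
  moreover have "\<bar>c n * (hat q f n - f n)\<bar> \<le> M * (h * \<sigma> f n)"
    unfolding abs_mult using oscD(2)[OF c] h_pos \<sigma>_nonneg M
    by (intro mult_mono hat_sub_le sdiff2_le_\<sigma>) auto
  ultimately show ?thesis by (simp add: algebra_simps)
qed

lemma hat_prod_sup:
  assumes c: "osc c" and f: "\<bar>f n\<bar> \<le> S" "\<And>i. \<bar>fd h' f i\<bar> \<le> S" "\<And>i. \<bar>lp h' f i\<bar> \<le> S"
  shows "\<bar>hat q (\<lambda>i. c i * f i) n - c n * f n\<bar> \<le> (2 * M * h\<^sup>2 + e2 + 2 * e1 * h) * S"
proof -
  have "M * (h * \<sigma> f n) \<le> M * (h * (2 * h * S))"
    using M h_pos by (intro mult_left_mono \<sigma>_le_sup f) auto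
  then show ?thesis using hat_prod_local[of c f n S, OF c f(1,2)] by (simp add: algebra_simps power2_eq_square)
qed

lemma h_psum_\<sigma>_le:
  assumes f: "per (int q * N) f" and l: "h' * (\<Sum>j\<in>{0..<int q * N}. \<bar>lp h' f j\<bar>) \<le> \<Theta>"
  shows "h * (\<Sum>i\<in>{0..<N}. \<sigma> f (int q * i)) \<le> 2 * h * \<Theta>"
proof -
  have "h' * (\<Sum>i\<in>{0..<N}. lsum q (lp h' f) (int q * i)) \<le> h' * (2 * (\<Sum>j\<in>{0..<int q * N}. \<bar>lp h' f j\<bar>))"
    using h'_pos by (intro mult_left_mono psum_lsum_le[OF N_pos per_lp[OF f]]) auto
  then have "(\<Sum>i\<in>{0..<N}. \<sigma> f (int q * i)) \<le> 2 * \<Theta>" using l by (simp add: sum_distrib_left[symmetric])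
  then show ?thesis using h_pos by simp
qed

lemma h_psum_const: "h * (\<Sum>i\<in>{0..<N}. c) = len * c"
  using N_pos unfolding len[symmetric] by simp

text \<open>The summed counterpart of \<open>hat_prod_sup\<close>, for functions whose second
  differences are only summable, such as the time integral of a kernel.\<close>

lemma hat_prod_l1:
  assumes c: "osc c" and f: "per (int q * N) f" "\<And>i. \<bar>f i\<bar> \<le> \<Theta>" "\<And>i. \<bar>fd h' f i\<bar> \<le> \<Theta>"
    and l: "h' * (\<Sum>j\<in>{0..<int q * N}. \<bar>lp h' f j\<bar>) \<le> \<Theta>"
  shows "h * (\<Sum>i\<in>{0..<N}. \<bar>hat q (\<lambda>i. c i * f i) (int q * i) - c (int q * i) * f (int q * i)\<bar>)
    \<le> (2 * M * h\<^sup>2 + len * (e2 + 2 * e1 * h)) * \<Theta>"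
proof -
  have "h * (\<Sum>i\<in>{0..<N}. \<bar>hat q (\<lambda>i. c i * f i) (int q * i) - c (int q * i) * f (int q * i)\<bar>)
    \<le> h * (\<Sum>i\<in>{0..<N}. M * (h * \<sigma> f (int q * i)) + (e2 + 2 * e1 * h) * \<Theta>)"
    using h_pos by (intro mult_left_mono sum_mono hat_prod_local[OF c] f) auto
  also have "\<dots> = M * h * (h * (\<Sum>i\<in>{0..<N}. \<sigma> f (int q * i))) + h * (\<Sum>i\<in>{0..<N}. (e2 + 2 * e1 * h) * \<Theta>)"
    unfolding sum.distrib distrib_left by (simp add: sum_distrib_left mult_ac)
  also have "\<dots> \<le> M * h * (2 * h * \<Theta>) + len * ((e2 + 2 * e1 * h) * \<Theta>)"
    unfolding h_psum_const using M h_pos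
    by (intro add_mono order_refl mult_left_mono[OF h_psum_\<sigma>_le[OF f(1) l]]) auto
  finally show ?thesis by (simp add: algebra_simps power2_eq_square)
qed

text \<open>The difference between the averaged fine gradient and the coarse gradient is a discrete
  derivative, which is moved to the test function \<open>\<psi>\<close>; at the kink of an integrated kernel
  the pointwise error would only be of order one.\<close>

lemma hat_gradient_weak:
  assumes c: "osc c" and f: "per (int q * N) f" "\<And>i. \<bar>fd h' f i\<bar> \<le> \<Theta>"
    and l: "h' * (\<Sum>j\<in>{0..<int q * N}. \<bar>lp h' f j\<bar>) \<le> \<Theta>"
    and \<psi>: "per N \<psi>" "\<And>i. \<bar>\<psi> i\<bar> \<le> K" "\<And>i. \<bar>fd h \<psi> i\<bar> \<le> K"
  shows "\<bar>h * (\<Sum>i\<in>{0..<N}. \<psi> i * (hat q (\<lambda>i. c i * cd h' f i) (int q * i)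
      - c (int q * i) * cd h (\<lambda>i. f (int q * i)) i))\<bar>
    \<le> (len * e2 + 8 * e1 * h + 4 * M * h\<^sup>2) * (K * \<Theta>)"
proof -
  have K: "0 \<le> K" using \<psi>(2)[of 0] by linarith
  have \<Theta>: "0 \<le> \<Theta>" using f(2)[of 0] by linarith
  let ?n = "\<lambda>i. int q * i"
  define E where "E i = hat q (\<lambda>i. c i * cd h' f i) (?n i) - c (?n i) * hat q (cd h' f) (?n i)" for i
  define Q where "Q i = trap_err q f (?n i)" for i
  define \<theta> where "\<theta> i = \<psi> i * c (?n i)" for i
  have pc: "per N (\<lambda>i. c (?n i))" "per N (\<lambda>i. f (?n i))"
    using perD[OF oscD(1)[OF c]] perD[OF f(1)] by (simp_all add: per_def distrib_left)
  have p\<theta>: "per N \<theta>" unfolding \<theta>_def by (rule per_mult[OF \<psi>(1) pc(1)])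
  have pQ: "per N Q"
  proof -
    have e: "f (int q * (i + N) + x) = f (int q * i + x)" for i x
      using perD[OF per_shift[OF f(1), of x], of "int q * i"] by (simp add: algebra_simps)
    show ?thesis unfolding per_def Q_def trap_err_def using e[of _ 0] by (simp add: e)
  qed
  have split: "\<psi> i * (hat q (\<lambda>i. c i * cd h' f i) (?n i) - c (?n i) * cd h (\<lambda>i. f (?n i)) i)
      = \<psi> i * E i + \<theta> i * (Q i - Q (i - 1)) / h" for i
  proof -
    have "hat q (cd h' f) (?n i) = cd h (\<lambda>i. f (?n i)) i + (Q i - Q (i - 1)) / h"
      using hat_cd[OF q h'_pos h, of f "?n i"] by (simp add: cd_def Q_def algebra_simps)
    then show ?thesis unfolding E_def \<theta>_def by (simp add: algebra_simps)
  qed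
  have 1: "\<bar>h * (\<Sum>i\<in>{0..<N}. \<psi> i * E i)\<bar> \<le> K * (len * (e2 * \<Theta>) + 2 * e1 * (2 * h * \<Theta>))"
  proof -
    \<comment> \<open>The oscillation of the gradient within one hat is its local variation, which
      need not be small at a single point but gains a factor \<open>h\<close> when summed over the
      grid.\<close>
    have E: "\<bar>E i\<bar> \<le> e2 * \<Theta> + 2 * e1 * \<sigma> f (?n i)" for i
      unfolding E_def
    proof (rule hat_prod_sub[where f = "cd h' f", OF c _ \<sigma>_nonneg])
      show "\<bar>cd h' f (?n i)\<bar> \<le> \<Theta>" using f(2)[of "?n i"] f(2)[of "?n i - 1"] unfolding cd_fd by linarith
    qed (rule cd_diff_le[OF h'_pos]; auto)+
    have "\<bar>h * (\<Sum>i\<in>{0..<N}. \<psi> i * E i)\<bar> = h * \<bar>\<Sum>i\<in>{0..<N}. \<psi> i * E i\<bar>" using h_pos by (simp add: abs_mult)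
    also have "\<dots> \<le> h * (\<Sum>i\<in>{0..<N}. K * (e2 * \<Theta> + 2 * e1 * \<sigma> f (?n i)))"
      using h_pos K E \<psi>(2) by (intro mult_left_mono order_trans[OF sum_abs sum_mono]) (auto simp: abs_mult intro!: mult_mono)
    also have "\<dots> = K * (h * (\<Sum>i\<in>{0..<N}. e2 * \<Theta>) + 2 * e1 * (h * (\<Sum>i\<in>{0..<N}. \<sigma> f (?n i))))"
      unfolding sum_distrib_left[symmetric] sum.distrib by (simp add: sum_distrib_left algebra_simps)
    also have "\<dots> \<le> K * (len * (e2 * \<Theta>) + 2 * e1 * (2 * h * \<Theta>))"
      unfolding h_psum_const using K e1 by (intro mult_left_mono add_left_mono h_psum_\<sigma>_le f l) auto
    finally show ?thesis .
  qed
  have 2: "\<bar>h * (\<Sum>i\<in>{0..<N}. \<theta> i * (Q i - Q (i - 1)) / h)\<bar> \<le> (K * e1 + K * M * h) * (4 * h * \<Theta>)"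
  proof -
    \<comment> \<open>Summation by parts in the coarse index: the increment of \<theta> over one
      cell compensates the loss of a factor \<open>h\<close> in the difference quotient.\<close>
    have "h * (\<Sum>i\<in>{0..<N}. \<theta> i * (Q i - Q (i - 1)) / h)
        = (\<Sum>i\<in>{0..<N}. \<theta> i * Q i) - (\<Sum>i\<in>{0..<N}. \<theta> i * Q (i - 1))"
      using h_pos unfolding sum_divide_distrib[symmetric] sum_subtractf[symmetric] right_diff_distrib by simp
    also have "(\<Sum>i\<in>{0..<N}. \<theta> i * Q (i - 1)) = (\<Sum>i\<in>{0..<N}. \<theta> (i + 1) * Q i)"
      using psum_shift[OF N_pos per_mult[OF p\<theta> per_shift'[OF pQ, of 1]], of 1] by simp
    finally have "h * (\<Sum>i\<in>{0..<N}. \<theta> i * (Q i - Q (i - 1)) / h) = (\<Sum>i\<in>{0..<N}. (\<theta> i - \<theta> (i + 1)) * Q i)"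
      by (simp add: sum_subtractf left_diff_distrib)
    also have "\<bar>\<dots>\<bar> \<le> (\<Sum>i\<in>{0..<N}. (K * e1 + K * M * h) * (2 * (h * \<sigma> f (?n i))))"
    proof (rule order_trans[OF sum_abs sum_mono])
      fix i
      \<comment> \<open>The increment of the coefficient costs \<open>e1\<close>, that of the
        Lipschitz test function costs \<open>h\<close>.\<close>
      have "\<theta> i - \<theta> (i + 1) = - (\<psi> i * (c (?n i + int q) - c (?n i))) - (\<psi> (i + 1) - \<psi> i) * c (?n (i + 1))"
        unfolding \<theta>_def by (simp add: algebra_simps)
      also have "\<bar>\<dots>\<bar> \<le> \<bar>\<psi> i * (c (?n i + int q) - c (?n i))\<bar> + \<bar>(\<psi> (i + 1) - \<psi> i) * c (?n (i + 1))\<bar>" by linarith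
      also have "\<bar>\<psi> i * (c (?n i + int q) - c (?n i))\<bar> \<le> K * e1"
        unfolding abs_mult using K \<psi>(2) oscD(3)[OF c] by (intro mult_mono) auto
      also have "\<bar>(\<psi> (i + 1) - \<psi> i) * c (?n (i + 1))\<bar> \<le> (h * K) * M"
      proof -
        have "\<bar>\<psi> (i + 1) - \<psi> i\<bar> = h * \<bar>fd h \<psi> i\<bar>" using h_pos by (simp add: fd_def)
        also have "\<dots> \<le> h * K" using h_pos \<psi>(3) by simp
        finally show ?thesis unfolding abs_mult using oscD(2)[OF c] K h_pos by (intro mult_mono) auto
      qed
      finally have x: "\<bar>\<theta> i - \<theta> (i + 1)\<bar> \<le> K * e1 + K * M * h" by (simp add: mult_ac)
      have "\<bar>Q i\<bar> \<le> 2 * (h * \<sigma> f (?n i))"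
        using trap_err_le[OF q h'_pos, of f "?n i"] unfolding Q_def h by (simp add: mult_ac)
      with x show "\<bar>(\<theta> i - \<theta> (i + 1)) * Q i\<bar> \<le> (K * e1 + K * M * h) * (2 * (h * \<sigma> f (?n i)))"
        unfolding abs_mult using K e1 M h_pos by (intro mult_mono) auto
    qed
    also have "\<dots> = (K * e1 + K * M * h) * (2 * (h * (\<Sum>i\<in>{0..<N}. \<sigma> f (?n i))))"
      unfolding sum_distrib_left[symmetric] by simp
    also have "\<dots> \<le> (K * e1 + K * M * h) * (2 * (2 * h * \<Theta>))"
      using K e1 M h_pos by (intro mult_left_mono h_psum_\<sigma>_le f l) auto
    finally show ?thesis by simp
  qed
  have "h * (\<Sum>i\<in>{0..<N}. \<psi> i * (hat q (\<lambda>i. c i * cd h' f i) (?n i) - c (?n i) * cd h (\<lambda>i. f (?n i)) i))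
      = h * (\<Sum>i\<in>{0..<N}. \<psi> i * E i) + h * (\<Sum>i\<in>{0..<N}. \<theta> i * (Q i - Q (i - 1)) / h)"
    unfolding split sum.distrib distrib_left ..
  then have "\<bar>h * (\<Sum>i\<in>{0..<N}. \<psi> i * (hat q (\<lambda>i. c i * cd h' f i) (?n i) - c (?n i) * cd h (\<lambda>i. f (?n i)) i))\<bar>
     \<le> K * (len * (e2 * \<Theta>) + 2 * e1 * (2 * h * \<Theta>)) + (K * e1 + K * M * h) * (4 * h * \<Theta>)"
    using 1 2 by linarith
  then show ?thesis by (simp add: algebra_simps power2_eq_square)
qed

section \<open>Truncation error of smooth solutions\<close>

lemma cd_restrict_le:
  assumes e: "\<And>k. k < q \<Longrightarrow> \<bar>sdiff2 (cd h' f) n (int k)\<bar> \<le> e" and e0: "0 \<le> e"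
  shows "\<bar>(f (n + int q) - f (n - int q)) / (2 * h) - cd h' f n\<bar> \<le> e"
proof -
  let ?V = "cd h' f"
  define r where "r k = f (n + int k) - f (n - int k) - 2 * real k * h' * ?V n" for k
  have hV: "2 * h' * ?V i = f (i + 1) - f (i - 1)" for i using h'_pos by (simp add: cd_def)
  \<comment> \<open>The recursion for \<open>r\<close> advances by two, so the induction carries two
    consecutive values.\<close>
  have "\<bar>r k\<bar> \<le> 2 * real k * h' * e \<and> \<bar>r (Suc k)\<bar> \<le> 2 * real (Suc k) * h' * e" if "k < q" for k
    using that
  proof (induction k)
    case 0
    have "r 1 = 0" using hV[of n] by (simp add: r_def)
    then show ?case using h'_pos e0 by (simp add: r_def)
  next
    case (Suc k)
    have "r (Suc (Suc k)) = r k + 2 * h' * sdiff2 ?V n (int (Suc k))"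
      unfolding sdiff2_def right_diff_distrib distrib_left hV r_def
      using hV[of n] by (simp add: algebra_simps)
    moreover have "\<bar>2 * h' * sdiff2 ?V n (int (Suc k))\<bar> \<le> 2 * h' * e"
      unfolding abs_mult using e[OF Suc.prems] h'_pos by simp
    moreover have "0 \<le> 2 * h' * e" using h'_pos e0 by simp
    moreover have "2 * real (Suc (Suc k)) * h' * e = 2 * real k * h' * e + 2 * (2 * h' * e)" by (simp add: algebra_simps)
    ultimately show ?case using Suc by linarith
  qed
  from this[of "q - 1"] have r: "\<bar>r q\<bar> \<le> 2 * h * e" using q unfolding h by simp
  have "(f (n + int q) - f (n - int q)) / (2 * h) - ?V n = r q / (2 * h)"
    using h_pos q h'_pos unfolding r_def by (simp add: field_simps) (simp add: h)
  then show ?thesis using r h_pos by (simp add: abs_divide field_simps)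
qed

text \<open>Increments of the central difference are means of neighbouring values of
  \<open>lp\<close>. In the symmetric combination the value at \<open>n\<close> cancels, so only the
  oscillation of \<open>lp\<close> remains, multiplied by \<open>h\<close>.\<close>

lemma sdiff2_cd_le:
  assumes D: "\<And>k. k < q \<Longrightarrow> \<bar>lp h' f (n + int k) - lp h' f n\<bar> \<le> d"
      "\<And>k. k < q \<Longrightarrow> \<bar>lp h' f (n - int k) - lp h' f n\<bar> \<le> d" and k: "k < q"
  shows "\<bar>sdiff2 (cd h' f) n (int k)\<bar> \<le> 2 * h * d"
proof -
  have d0: "0 \<le> d" using D(1)[of 0] q by simp
  have step: "cd h' f (i + 1) - cd h' f i = h' / 2 * lp h' f (i + 1) + h' / 2 * lp h' f i" for i
    using h'_pos by (simp add: cd_def lp_def power2_eq_square field_simps)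
  have "\<bar>sdiff2 (cd h' f) n (int k)\<bar> \<le> real k * (2 * h' * d)"
    using k
  proof (induction k)
    case 0
    then show ?case by (simp add: sdiff2_def)
  next
    case (Suc k)
    let ?L = "lp h' f"
    let ?x = "(?L (n + int (Suc k)) - ?L n) + (?L (n + int k) - ?L n)
        - (?L (n - int k) - ?L n) - (?L (n - int (Suc k)) - ?L n)"
    have "sdiff2 (cd h' f) n (int (Suc k)) = sdiff2 (cd h' f) n (int k)
      + (cd h' f (n + int k + 1) - cd h' f (n + int k))
      - (cd h' f (n - int (Suc k) + 1) - cd h' f (n - int (Suc k)))"
      by (simp add: sdiff2_def algebra_simps)
    also have "\<dots> = sdiff2 (cd h' f) n (int k) + h' / 2 * ?x"
      unfolding step by (simp add: algebra_simps)
    finally have e: "sdiff2 (cd h' f) n (int (Suc k)) = sdiff2 (cd h' f) n (int k) + h' / 2 * ?x" .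
    have "\<bar>?x\<bar> \<le> 4 * d" using D(1)[of k] D(2)[of k] D(1)[of "Suc k"] D(2)[of "Suc k"] Suc.prems by linarith
    then have "\<bar>h' / 2 * ?x\<bar> \<le> h' / 2 * (4 * d)" unfolding abs_mult using h'_pos by simp
    then show ?case unfolding e using Suc by (simp add: algebra_simps)
  qed
  also have "\<dots> \<le> real q * (2 * h' * d)" using k h'_pos d0 by (intro mult_right_mono) auto
  finally show ?thesis unfolding h by (simp add: mult_ac)
qed

lemma truncation:
  assumes g: "osc g" and b: "osc b"
    and w: "\<And>n. g n * w n = lp h' f n + b n * cd h' f n"
    and S: "\<And>n. \<bar>fd h' f n\<bar> \<le> S" "\<And>n. \<bar>lp h' f n\<bar> \<le> S" "\<And>n. \<bar>w n\<bar> \<le> S" "\<And>n. \<bar>fd h' w n\<bar> \<le> S"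
      "\<And>n. \<bar>lp h' w n\<bar> \<le> S"
    and \<epsilon>: "e2 \<le> \<epsilon>" "h * e1 \<le> \<epsilon>" "h\<^sup>2 \<le> \<epsilon>"
  shows "\<bar>lp h (\<lambda>i. f (int q * i)) i + b (int q * i) * cd h (\<lambda>i. f (int q * i)) i
      - g (int q * i) * w (int q * i)\<bar> \<le> (8 + 2 * M + 4 * M * (3 * M + 2)) * (S * \<epsilon>)"
proof -
  let ?V = "cd h' f" and ?D = "lp h' f" and ?n = "int q * i"
  have S0: "0 \<le> S" using S(1)[of 0] by linarith
  have SE: "h * e1 * S \<le> S * \<epsilon>" "h\<^sup>2 * S \<le> S * \<epsilon>" "e2 * S \<le> S * \<epsilon>" "0 \<le> S * \<epsilon>"
    using \<epsilon> S0 e2 mult_right_mono[OF \<epsilon>(1) S0] mult_right_mono[OF \<epsilon>(2) S0] mult_right_mono[OF \<epsilon>(3) S0]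
    by (auto simp: mult.commute)
  have V: "\<bar>?V n\<bar> \<le> S" for n using S(1)[of n] S(1)[of "n - 1"] unfolding cd_fd by linarith
  have dV: "\<bar>?V (n + int k) - ?V n\<bar> \<le> 2 * h * S" "\<bar>?V (n - int k) - ?V n\<bar> \<le> 2 * h * S" if "k < q" for n k
    using cd_diff_le[OF h'_pos, of n q "n + int k" n f] cd_diff_le[OF h'_pos, of n q "n - int k" n f]
      \<sigma>_le_sup[OF S(2), of n] that by auto
  \<comment> \<open>The oscillation of \<open>lp h' f\<close> at distance up to \<open>h\<close>:
    the increments of \<open>w\<close> and of the gradient contribute \<open>h * S\<close> and
    \<open>2 * h * S\<close>, each times \<open>M\<close>; those of \<open>g\<close> and
    \<open>b\<close> contribute \<open>e1 * S\<close> each.\<close>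
  define d where "d = 3 * M * (h * S) + 2 * (e1 * S)"
  have d0: "0 \<le> d" unfolding d_def using M h_pos S0 e1 by simp
  have D: "?D n = g n * w n - b n * ?V n" for n using w[of n] by simp
  have dD: "\<bar>?D m - ?D n\<bar> \<le> d"
    if k: "\<bar>g m - g n\<bar> \<le> e1" "\<bar>b m - b n\<bar> \<le> e1" "\<bar>w m - w n\<bar> \<le> h * S" "\<bar>?V m - ?V n\<bar> \<le> 2 * h * S" for m n
  proof -
    have "?D m - ?D n = g m * (w m - w n) + (g m - g n) * w n - b m * (?V m - ?V n) - (b m - b n) * ?V n"
      unfolding D by (simp add: algebra_simps)
    then have "\<bar>?D m - ?D n\<bar> \<le> \<bar>g m * (w m - w n)\<bar> + \<bar>(g m - g n) * w n\<bar> + \<bar>b m * (?V m - ?V n)\<bar> + \<bar>(b m - b n) * ?V n\<bar>"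
      by linarith
    also have "\<dots> \<le> M * (h * S) + e1 * S + M * (2 * h * S) + e1 * S"
      unfolding abs_mult using k V S(3) oscD(2)[OF g] oscD(2)[OF b] M e1 h_pos S0
      by (intro add_mono mult_mono) auto
    finally show ?thesis unfolding d_def by (simp add: algebra_simps)
  qed
  have s2V: "\<bar>sdiff2 ?V n (int k)\<bar> \<le> 2 * h * d" if "k < q" for n k
  proof (rule sdiff2_cd_le[OF _ _ that])
    fix k assume k: "k < q"
    show "\<bar>?D (n + int k) - ?D n\<bar> \<le> d"
      using k dV[OF k] fd_local(1)[OF S(4)] oscD(3)[OF g] oscD(3)[OF b] by (intro dD) auto
    show "\<bar>?D (n - int k) - ?D n\<bar> \<le> d"
      using k dV[OF k] fd_local(2)[OF S(4)] oscD(4)[OF g] oscD(4)[OF b] by (intro dD) auto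
  qed
  have hd: "2 * h * d \<le> 2 * (3 * M + 2) * (S * \<epsilon>)"
  proof -
    have "2 * h * d = 6 * M * (h\<^sup>2 * S) + 4 * (h * e1 * S)" unfolding d_def by (simp add: algebra_simps power2_eq_square)
    also have "\<dots> \<le> 6 * M * (S * \<epsilon>) + 4 * (S * \<epsilon>)" using M SE by (intro add_mono mult_left_mono) auto
    finally show ?thesis by (simp add: algebra_simps)
  qed
  have 1: "\<bar>hat q (\<lambda>i. g i * w i) ?n - g ?n * w ?n\<bar> \<le> (2 * M + 3) * (S * \<epsilon>)"
  proof -
    have "\<bar>hat q (\<lambda>i. g i * w i) ?n - g ?n * w ?n\<bar> \<le> (2 * M * h\<^sup>2 + e2 + 2 * e1 * h) * S"
      by (rule hat_prod_sup[OF g S(3-5)])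
    also have "\<dots> = 2 * M * (h\<^sup>2 * S) + e2 * S + 2 * (h * e1 * S)" by (simp add: algebra_simps)
    also have "\<dots> \<le> 2 * M * (S * \<epsilon>) + S * \<epsilon> + 2 * (S * \<epsilon>)" using M SE by (intro add_mono mult_left_mono) auto
    finally show ?thesis by (simp add: algebra_simps)
  qed
  have 2: "\<bar>hat q (\<lambda>i. b i * ?V i) ?n - b ?n * ?V ?n\<bar> \<le> 5 * (S * \<epsilon>) + M * (2 * (3 * M + 2) * (S * \<epsilon>))"
  proof -
    have "\<bar>hat q (\<lambda>i. b i * ?V i) ?n - b ?n * hat q ?V ?n\<bar> \<le> e2 * S + 2 * e1 * (2 * h * S)"
      using dV h_pos S0 by (intro hat_prod_sub b V) auto
    also have "\<dots> = e2 * S + 4 * (h * e1 * S)" by simp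
    also have "\<dots> \<le> S * \<epsilon> + 4 * (S * \<epsilon>)" using SE by (intro add_mono mult_left_mono) auto
    finally have x: "\<bar>hat q (\<lambda>i. b i * ?V i) ?n - b ?n * hat q ?V ?n\<bar> \<le> 5 * (S * \<epsilon>)" by simp
    have "\<bar>hat q ?V ?n - ?V ?n\<bar> \<le> 2 * h * d" using s2V h_pos d0 by (intro hat_sub_le) auto
    then have "\<bar>hat q ?V ?n - ?V ?n\<bar> \<le> 2 * (3 * M + 2) * (S * \<epsilon>)" using hd by linarith
    then have "\<bar>b ?n * (hat q ?V ?n - ?V ?n)\<bar> \<le> M * (2 * (3 * M + 2) * (S * \<epsilon>))"
      unfolding abs_mult using oscD(2)[OF b] M by (intro mult_mono) auto
    then show ?thesis using x by (simp add: right_diff_distrib)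
  qed
  have 3: "\<bar>b ?n * (cd h (\<lambda>i. f (int q * i)) i - ?V ?n)\<bar> \<le> M * (2 * (3 * M + 2) * (S * \<epsilon>))"
  proof -
    have "cd h (\<lambda>i. f (int q * i)) i = (f (?n + int q) - f (?n - int q)) / (2 * h)"
      by (simp add: cd_def algebra_simps)
    then have "\<bar>cd h (\<lambda>i. f (int q * i)) i - ?V ?n\<bar> \<le> 2 * h * d"
      using cd_restrict_le[OF s2V, of ?n] h_pos d0 by simp
    then have "\<bar>cd h (\<lambda>i. f (int q * i)) i - ?V ?n\<bar> \<le> 2 * (3 * M + 2) * (S * \<epsilon>)" using hd by linarith
    then show ?thesis unfolding abs_mult using oscD(2)[OF b] M by (intro mult_mono) auto
  qed
  \<comment> \<open>Averaging the fine equation is exact and turns its Laplacian into the coarse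
    one, so the coarse residual consists of the three averaging errors alone.\<close>
  have "hat q ?D ?n + hat q (\<lambda>i. b i * ?V i) ?n = hat q (\<lambda>i. g i * w i) ?n"
    unfolding hat_add[symmetric] w ..
  then have "lp h (\<lambda>i. f (int q * i)) i + b ?n * cd h (\<lambda>i. f (int q * i)) i - g ?n * w ?n
    = (hat q (\<lambda>i. g i * w i) ?n - g ?n * w ?n) - (hat q (\<lambda>i. b i * ?V i) ?n - b ?n * ?V ?n)
      + b ?n * (cd h (\<lambda>i. f (int q * i)) i - ?V ?n)"
    unfolding lp_restrict[OF q h'_pos h] by (simp add: algebra_simps)
  then have "\<bar>lp h (\<lambda>i. f (int q * i)) i + b ?n * cd h (\<lambda>i. f (int q * i)) i - g ?n * w ?n\<bar>
    \<le> (2 * M + 3) * (S * \<epsilon>) + (5 * (S * \<epsilon>) + M * (2 * (3 * M + 2) * (S * \<epsilon>))) + M * (2 * (3 * M + 2) * (S * \<epsilon>))"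
    using 1 2 3 by linarith
  also have "\<dots> = (8 + 2 * M + 4 * M * (3 * M + 2)) * (S * \<epsilon>)" by (simp add: algebra_simps)
  finally show ?thesis .
qed

end

text \<open>Strictly inside a hat only the centre can carry the mass of a fine delta placed at a
  coarse point. The central weight \<open>1 / q\<close> turns its height \<open>1 / h'\<close> into
  \<open>1 / h\<close>.\<close>

lemma hat_unit_at:
  assumes q: "1 \<le> q" and N: "2 \<le> N" and h': "0 < h'" and h: "h = real q * h'"
  shows "hat q (unit_at (int q * N) h' (int q * j)) (int q * i) = unit_at N h j i"
proof -
  let ?u = "unit_at (int q * N) h' (int q * j)" and ?n = "int q * i"
  \<comment> \<open>An offset smaller than \<open>q\<close> is a multiple of \<open>q\<close> only
    if it is zero.\<close>
  have dv: "int q * N dvd int q * i + k - int q * j \<longleftrightarrow> k = 0 \<and> N dvd i - j" if k: "\<bar>k\<bar> < int q" for k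
  proof
    assume a: "int q * N dvd int q * i + k - int q * j"
    then have "int q dvd int q * i + k - int q * j" by (rule dvd_mult_left)
    then have "int q dvd k" by (metis add_diff_eq add.commute dvd_add_times_triv_left_iff dvd_triv_left dvd_diff_commute right_diff_distrib add_diff_cancel_left' diff_add_eq dvd_add_right_iff)
    then have "k = 0" using k by (metis abs_dvd_iff dvd_imp_le_int dvd_abs_iff abs_of_nat linorder_not_less)
    then show "k = 0 \<and> N dvd i - j" using a q by (simp add: right_diff_distrib[symmetric])
  qed (use q in \<open>auto simp: right_diff_distrib[symmetric]\<close>)
  have s: "sdiff2 ?u ?n (int k) = - 2 * ?u ?n" if "k \<in> {1..<q}" for k
    using dv[of "int k"] dv[of "- int k"] that by (simp add: sdiff2_def unit_at_def)
  have "hat q ?u ?n = ?u ?n - 2 * ?u ?n * (real q * (real q - 1) / 2) / (real q)\<^sup>2"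
  proof -
    have "(\<Sum>k\<in>{1..<q}. (real q - real k) * sdiff2 ?u ?n (int k)) = (\<Sum>k\<in>{1..<q}. (real q - real k) * (- 2 * ?u ?n))"
      using s by (intro sum.cong) auto
    then show ?thesis unfolding hat_def sum_distrib_right[symmetric] sum_weights by simp
  qed
  also have "\<dots> = ?u ?n / real q" using q by (simp add: field_simps power2_eq_square)
  also have "\<dots> = unit_at N h j i" using dv[of 0] q h' unfolding h by (auto simp: unit_at_def)
  finally show ?thesis .
qed

section \<open>Bounds that are uniform in the grid level\<close>

definition npts :: "nat \<Rightarrow> int" where
  "npts m = 2 ^ (m + 1)"

definition sample :: "real \<Rightarrow> nat \<Rightarrow> (real \<Rightarrow> real) \<Rightarrow> int \<Rightarrow> real" where
  "sample L m f i = f (mesh L m * of_int i)"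

text \<open>The bounds \<open>a0\<close>, \<open>a1\<close> and \<open>B\<close> are shared by all
  levels. Uniformity in the mesh is then expressed by choosing constants before quantifying over
  \<open>m\<close>.\<close>

locale kernel_family =
  fixes L a0 a1 B :: real and a b :: "real \<Rightarrow> real"
    and p :: "nat \<Rightarrow> int \<Rightarrow> int \<Rightarrow> real \<Rightarrow> real"
  assumes L_pos: "0 < L"
    and kernels: "transition_kernel (npts m) (mesh L m) (2 * L) a0 a1 B (sample L m a) (sample L m b) (p m)"
begin

sublocale lev: transition_kernel "npts m" "mesh L m" "2 * L" a0 a1 B "sample L m a" "sample L m b" "p m" for m
  by (rule kernels)

abbreviation "cS \<equiv> 2 * a1 / (2 * L) + 2 * (2 * L)"

lemma cS_pos: "0 < cS"
  using L_pos lev.a1_pos by (intro add_pos_pos divide_pos_pos) auto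

lemma abs_le_sqrt_energy:
  assumes "per (npts m) f" "lev.X m f \<le> K" "lev.Y m f \<le> K"
  shows "\<bar>f i\<bar> \<le> sqrt (cS * (2 * K))"
proof (rule real_le_rsqrt)
  have "(f i)\<^sup>2 \<le> cS * (lev.X m f + lev.Y m f)" by (rule lev.sup_le[OF assms(1)])
  also have "\<dots> \<le> cS * (2 * K)" using assms(2,3) cS_pos by (intro mult_left_mono) auto
  finally show "\<bar>f i\<bar>\<^sup>2 \<le> cS * (2 * K)" by simp
qed

lemma pk_energy_bound:
  assumes "0 < t0"
  shows "\<exists>K\<ge>0. \<forall>m j s. t0 \<le> s \<and> s \<le> T \<longrightarrow>
    lev.X m (\<lambda>i. lev.pk m k i j s) \<le> K \<and> lev.Y m (\<lambda>i. lev.pk m k i j s) \<le> K"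
proof -
  let ?\<tau> = "t0 / (2 * (2 * real k + 1))"
  let ?R = "\<lambda>n. (exp (B\<^sup>2 * a1 * ?\<tau>) / ?\<tau>) ^ n * (4 * scheme.unit_const (2 * L) a0 a1 * exp ((2 * (B\<^sup>2 * a1) + 1) * T) / t0)"
  show ?thesis
  proof (intro exI[of _ "max 0 (max (?R (2 * k)) (?R (2 * k + 1)))"] conjI allI impI)
    fix m j s assume s: "t0 \<le> s \<and> s \<le> T"
    show "lev.X m (\<lambda>i. lev.pk m k i j s) \<le> max 0 (max (?R (2 * k)) (?R (2 * k + 1)))"
      using lev.pk_X_le(1)[OF assms, of s T m k j] s by simp
    show "lev.Y m (\<lambda>i. lev.pk m k i j s) \<le> max 0 (max (?R (2 * k)) (?R (2 * k + 1)))"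
      using lev.pk_X_le(2)[OF assms, of s T m k j] s by simp
  qed simp
qed

text \<open>Values come from the Sobolev inequality, slopes from the summed second differences, and
  second differences from the equation. Two differences in space thus cost one more time derivative,
  which is why energies of order \<open>k\<close> and \<open>Suc k\<close> are both used.\<close>

lemma pk_bounds:
  assumes t0: "0 < t0"
  shows "\<exists>K\<ge>0. \<forall>m i j s. t0 \<le> s \<and> s \<le> T \<longrightarrow> \<bar>lev.pk m k i j s\<bar> \<le> K \<and>
    \<bar>fd (mesh L m) (\<lambda>i. lev.pk m k i j s) i\<bar> \<le> K \<and> \<bar>lp (mesh L m) (\<lambda>i. lev.pk m k i j s) i\<bar> \<le> K"
proof -
  obtain K0 where K0: "0 \<le> K0" "\<And>m j s. t0 \<le> s \<Longrightarrow> s \<le> T \<Longrightarrow>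
    lev.X m (\<lambda>i. lev.pk m k i j s) \<le> K0 \<and> lev.Y m (\<lambda>i. lev.pk m k i j s) \<le> K0"
    using pk_energy_bound[OF t0, of T k] by blast
  obtain K1 where K1: "0 \<le> K1" "\<And>m j s. t0 \<le> s \<Longrightarrow> s \<le> T \<Longrightarrow>
    lev.X m (\<lambda>i. lev.pk m (Suc k) i j s) \<le> K1 \<and> lev.Y m (\<lambda>i. lev.pk m (Suc k) i j s) \<le> K1"
    using pk_energy_bound[OF t0, of T "Suc k"] by blast
  define S0 where "S0 = sqrt (cS * (2 * K0))"
  define S1 where "S1 = sqrt (cS * (2 * K1))"
  define P where "P = sqrt (2 * L * (a1 * K1)) / a0 + B * sqrt (2 * L * K0)"
  have nn: "0 \<le> S0" "0 \<le> S1" "0 \<le> P" "0 \<le> B * P" "0 \<le> S1 / a0"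
    unfolding S0_def S1_def P_def using cS_pos K0(1) K1(1) L_pos lev.a1_pos lev.a0_pos lev.B_nonneg by auto
  show ?thesis
  proof (intro exI[of _ "S0 + P + (S1 / a0 + B * P)"] conjI allI impI)
    show "0 \<le> S0 + P + (S1 / a0 + B * P)" using nn by linarith
    fix m i j s assume "t0 \<le> s \<and> s \<le> T"
    then have s: "t0 \<le> s" "s \<le> T" by auto
    let ?f = "\<lambda>i. lev.pk m k i j s" and ?w = "\<lambda>i. lev.pk m (Suc k) i j s"
    have "\<bar>?f i\<bar> \<le> S0" unfolding S0_def
      using K0(2)[OF s, of m j] abs_le_sqrt_energy[OF lev.pk_per1[of m k j s], of K0] by blast
    then show "\<bar>lev.pk m k i j s\<bar> \<le> S0 + P + (S1 / a0 + B * P)" using nn by linarith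
    have w1: "\<bar>?w i\<bar> \<le> S1" unfolding S1_def
      using K1(2)[OF s, of m j] abs_le_sqrt_energy[OF lev.pk_per1[of m "Suc k" j s], of K1] by blast
    have w: "?w i = lev.A m ?f i + 0" for i by (simp add: lev.pk_Suc)
    have fdP: "\<bar>fd (mesh L m) ?f i\<bar> \<le> P" for i
    proof -
      have "\<bar>fd (mesh L m) ?f i\<bar> \<le> (sqrt (2 * L * (a1 * lev.X m ?w)) + mesh L m * (\<Sum>i\<in>{0..<npts m}. \<bar>0\<bar>)) / a0
          + B * sqrt (2 * L * lev.Y m ?f)"
        by (rule order_trans[OF lev.fd_sup_le[OF lev.pk_per1] lev.lp_l1_le[OF lev.pk_per1 w]])
      also have "\<dots> = sqrt (2 * L * (a1 * lev.X m ?w)) / a0 + B * sqrt (2 * L * lev.Y m ?f)" by simp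
      also have "\<dots> \<le> P" unfolding P_def
        using K0(2)[OF s, of m j] K1(2)[OF s, of m j] L_pos lev.a1_pos lev.a0_pos lev.B_nonneg
        by (intro add_mono divide_right_mono mult_left_mono real_sqrt_le_mono) auto
      finally show ?thesis .
    qed
    from fdP show "\<bar>fd (mesh L m) ?f i\<bar> \<le> S0 + P + (S1 / a0 + B * P)" using nn by (meson add_increasing2 add_increasing add_nonneg_nonneg)
    have "lp (mesh L m) ?f i = ?w i / sample L m a i - sample L m b i * cd (mesh L m) ?f i"
      using lev.a_nz[of m i] unfolding w by (simp add: Aop_def)
    then have "\<bar>lp (mesh L m) ?f i\<bar> \<le> \<bar>?w i / sample L m a i\<bar> + \<bar>sample L m b i * cd (mesh L m) ?f i\<bar>" by linarith
    also have "\<bar>?w i / sample L m a i\<bar> \<le> S1 / a0"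
      unfolding abs_divide using w1 lev.a0_pos lev.a_ge[of m i] lev.a_pos[of m i] nn by (intro frac_le) auto
    also have "\<bar>sample L m b i * cd (mesh L m) ?f i\<bar> \<le> B * P"
      unfolding abs_mult using lev.b_le[of m i] lev.B_nonneg lev.cd_le_fd_sup[of m ?f P i, OF fdP] by (intro mult_mono) auto
    finally show "\<bar>lp (mesh L m) ?f i\<bar> \<le> S0 + P + (S1 / a0 + B * P)" using nn by linarith
  qed
qed

text \<open>In the second variable the smooth quantity is the product with \<open>a\<close>: the
  kernel alone need not be Lipschitz there when \<open>a\<close> is not.\<close>

lemma pk_forward_Lipschitz:
  assumes t0: "0 < t0"
  shows "\<exists>K\<ge>0. \<forall>m i j s. t0 \<le> s \<and> s \<le> T \<longrightarrow>
    \<bar>fd (mesh L m) (\<lambda>j. sample L m a j * lev.pk m k i j s) j\<bar> \<le> K"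
proof -
  obtain K0 where K0: "0 \<le> K0" "\<And>m i j s. t0 \<le> s \<Longrightarrow> s \<le> T \<Longrightarrow> \<bar>lev.pk m k i j s\<bar> \<le> K0"
    using pk_bounds[OF t0, of T k] by blast
  obtain K1 where K1: "0 \<le> K1" "\<And>m i j s. t0 \<le> s \<Longrightarrow> s \<le> T \<Longrightarrow> \<bar>lev.pk m (Suc k) i j s\<bar> \<le> K1"
    using pk_bounds[OF t0, of T "Suc k"] by blast
  show ?thesis
  proof (intro exI[of _ "(2 * B * a1 + 2 * L) * (K0 + K1)"] conjI allI impI)
    show "0 \<le> (2 * B * a1 + 2 * L) * (K0 + K1)" using K0(1) K1(1) lev.B_nonneg lev.a1_pos L_pos by simp
    fix m i j s assume "t0 \<le> s \<and> s \<le> T"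
    then have s: "t0 \<le> s" "s \<le> T" by auto
    show "\<bar>fd (mesh L m) (\<lambda>j. sample L m a j * lev.pk m k i j s) j\<bar> \<le> (2 * B * a1 + 2 * L) * (K0 + K1)"
    proof (rule lev.forward_Lipschitz[OF lev.pk_per2])
      show "\<bar>lev.pk m k i j s\<bar> \<le> K0 + K1" for j using K0(2)[OF s, of m i j] K1(1) by linarith
      show "\<bar>lev.A' m (\<lambda>j. lev.pk m k i j s) j\<bar> \<le> K0 + K1" for j
        using K1(2)[OF s, of m i j] K0(1) s t0 by (simp add: lev.pk_forward)
    qed
  qed
qed

text \<open>Cauchy-Schwarz reduces this to the squared norm, of order \<open>1 / \<tau>\<close>. The
  resulting \<open>1 / sqrt \<tau>\<close> is integrable at zero, as the Duhamel argument
  requires.\<close>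

lemma forward_l1_bound:
  assumes T: "0 < T"
  shows "\<exists>K\<ge>0. \<forall>m i \<tau>. 0 < \<tau> \<and> \<tau> \<le> T \<longrightarrow>
    mesh L m * (\<Sum>z\<in>{0..<npts m}. \<bar>p m i z \<tau>\<bar>) \<le> K / sqrt \<tau>"
proof -
  define Q where "Q = 2 * L * (cS * (exp (B\<^sup>2 * a1 * T) * (T + 1)) / a0)"
  have Q: "0 \<le> Q" unfolding Q_def using L_pos cS_pos T lev.a0_pos by (intro mult_nonneg_nonneg divide_nonneg_pos) auto
  show ?thesis
  proof (intro exI[of _ "sqrt Q"] conjI allI impI)
    show "0 \<le> sqrt Q" using Q by simp
    fix m i \<tau> assume "0 < \<tau> \<and> \<tau> \<le> T"
    then have \<tau>: "0 < \<tau>" "\<tau> \<le> T" by auto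
    have "mesh L m * (\<Sum>z\<in>{0..<npts m}. \<bar>p m i z \<tau>\<bar>)
      \<le> sqrt (2 * L * (mesh L m * (\<Sum>z\<in>{0..<npts m}. (p m i z \<tau>)\<^sup>2)))" by (rule lev.h_psum_abs_le)
    also have "\<dots> \<le> sqrt (2 * L * (cS * (exp (B\<^sup>2 * a1 * \<tau>) * (1 + 1 / \<tau>)) / a0))"
      using L_pos by (intro real_sqrt_le_mono mult_left_mono lev.forward_L2_le \<tau>) auto
    also have "\<dots> \<le> sqrt (2 * L * (cS * (exp (B\<^sup>2 * a1 * T) * ((T + 1) / \<tau>)) / a0))"
    proof -
      have "exp (B\<^sup>2 * a1 * \<tau>) \<le> exp (B\<^sup>2 * a1 * T)" using \<tau> lev.a1_pos by (simp add: mult_left_mono)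
      moreover have "1 + 1 / \<tau> \<le> (T + 1) / \<tau>" using \<tau> by (simp add: field_simps)
      moreover have "0 \<le> 1 + 1 / \<tau>" using \<tau> by simp
      ultimately show ?thesis using L_pos cS_pos lev.a0_pos
        by (intro real_sqrt_le_mono mult_left_mono divide_right_mono mult_mono) auto
    qed
    also have "2 * L * (cS * (exp (B\<^sup>2 * a1 * T) * ((T + 1) / \<tau>)) / a0) = Q / \<tau>" by (simp add: Q_def)
    also have "sqrt (Q / \<tau>) = sqrt Q / sqrt \<tau>" by (rule real_sqrt_divide)
    finally show "mesh L m * (\<Sum>z\<in>{0..<npts m}. \<bar>p m i z \<tau>\<bar>) \<le> sqrt Q / sqrt \<tau>" .
  qed
qed

definition U :: "nat \<Rightarrow> int \<Rightarrow> real \<Rightarrow> int \<Rightarrow> real" where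
  "U m j s i = integral {0..s} (\<lambda>r. p m i j r)"

lemma U_props:
  shows U_per: "per (npts m) (U m j s)"
    and U_cont: "continuous_on {0..T} (\<lambda>s. U m j s i)"
    and U_deriv: "0 < s \<Longrightarrow> ((\<lambda>s. U m j s i) has_real_derivative p m i j s) (at s)"
    and U_0: "U m j 0 i = 0"
proof -
  have v0: "(\<lambda>i. p m i j 0) = unit_at (npts m) (mesh L m) j" by (rule ext) (rule lev.p_0)
  note * = lev.integrated_unit_solution[OF lev.column_bsol[of m j] v0, folded U_def]
  show "per (npts m) (U m j s)" using *(1)[of s] unfolding U_def by simp
  show "continuous_on {0..T} (\<lambda>s. U m j s i)" by (rule *(2))
  show "0 < s \<Longrightarrow> ((\<lambda>s. U m j s i) has_real_derivative p m i j s) (at s)" by (rule *(3))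
  show "U m j 0 i = 0" by (simp add: U_def)
qed

text \<open>The energies of \<open>U\<close> stay bounded; only the summed second differences
  involve the kernel itself, whose norm is of order \<open>1 / sqrt s\<close>, besides mass 1 from
  the delta. All three bounds are given the common form \<open>K / sqrt s\<close> so that one number
  can serve in the averaging estimates.\<close>

lemma U_bounds:
  assumes T: "0 < T"
  shows "\<exists>K\<ge>0. \<forall>m j s. 0 < s \<and> s \<le> T \<longrightarrow> (\<forall>i. \<bar>U m j s i\<bar> \<le> K / sqrt s) \<and>
    (\<forall>i. \<bar>fd (mesh L m) (U m j s) i\<bar> \<le> K / sqrt s) \<and>
    mesh L m * (\<Sum>i\<in>{0..<npts m}. \<bar>lp (mesh L m) (U m j s) i\<bar>) \<le> K / sqrt s"
proof -
  let ?c = "2 * (B\<^sup>2 * a1) + 1" and ?unit_const = "scheme.unit_const (2 * L) a0 a1"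
  define E where "E = 4 * ?unit_const * exp (?c * T)"
  have E: "0 \<le> E" unfolding E_def using lev.unit_const_pos by simp
  define K where "K = sqrt (cS * (2 * E)) * sqrt T + ((sqrt (2 * L * (a1 * E)) + sqrt T) / a0 + B * sqrt (2 * L * E) * sqrt T)"
  have K2: "0 \<le> sqrt (cS * (2 * E)) * sqrt T" using E T cS_pos by simp
  have K3: "0 \<le> (sqrt (2 * L * (a1 * E)) + sqrt T) / a0 + B * sqrt (2 * L * E) * sqrt T"
    using E T lev.a0_pos lev.a1_pos lev.B_nonneg L_pos by simp
  show ?thesis
  proof (intro exI[of _ K] conjI allI impI)
    show "0 \<le> K" unfolding K_def using K2 K3 by linarith
    fix m j s assume "0 < s \<and> s \<le> T"
    then have s: "0 < s" "s \<le> T" by auto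
    then have ss: "0 < sqrt s" "sqrt s \<le> sqrt T" by auto
    have v0: "(\<lambda>i. p m i j 0) = unit_at (npts m) (mesh L m) j" by (rule ext) (rule lev.p_0)
    note iu = lev.integrated_unit_solution[OF lev.column_bsol[of m j] v0]
    have Ue: "(\<lambda>i. integral {0..s} (\<lambda>r. p m i j r)) = U m j s" by (rule ext) (simp add: U_def)
    have ex: "exp (?c * s) \<le> exp (?c * T)" using s lev.a1_pos by (simp add: mult_left_mono)
    have XY: "lev.X m (U m j s) + lev.Y m (U m j s) \<le> E"
    proof -
      have "lev.X m (U m j s) + lev.Y m (U m j s) \<le> 4 * ?unit_const * exp (?c * s)"
        using iu(6)[of s] s unfolding Ue by simp
      also have "\<dots> \<le> E" unfolding E_def using ex lev.unit_const_pos by simp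
      finally show ?thesis .
    qed
    then have X: "lev.X m (U m j s) \<le> E" and Y: "lev.Y m (U m j s) \<le> E"
      using lev.X_nonneg[of m "U m j s"] lev.Y_nonneg[of m "U m j s"] by linarith+
    have Xv: "s * lev.X m (\<lambda>i. p m i j s) \<le> E"
    proof -
      have "s * lev.X m (\<lambda>i. p m i j s) \<le> 2 * ?unit_const * exp (?c * s)" using iu(7)[of s] s by simp
      also have "\<dots> \<le> 2 * ?unit_const * exp (?c * T)" using ex lev.unit_const_pos by simp
      also have "\<dots> \<le> E" unfolding E_def using lev.unit_const_pos by simp
      finally show ?thesis .
    qed
    show "\<bar>U m j s i\<bar> \<le> K / sqrt s" for i
    proof -
      have "\<bar>U m j s i\<bar> * sqrt s \<le> sqrt (cS * (2 * E)) * sqrt T"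
        using ss by (intro mult_mono abs_le_sqrt_energy[OF U_per X Y]) (use E cS_pos in auto)
      then have "\<bar>U m j s i\<bar> * sqrt s \<le> K" unfolding K_def using K3 by linarith
      then show ?thesis using ss by (simp add: field_simps)
    qed
    have w: "p m i j s = lev.A m (U m j s) i + unit_at (npts m) (mesh L m) j i" for i
      using iu(5)[of s i] s unfolding Ue by simp
    show l1: "mesh L m * (\<Sum>i\<in>{0..<npts m}. \<bar>lp (mesh L m) (U m j s) i\<bar>) \<le> K / sqrt s"
    proof -
      have "mesh L m * (\<Sum>i\<in>{0..<npts m}. \<bar>lp (mesh L m) (U m j s) i\<bar>)
        \<le> (sqrt (2 * L * (a1 * lev.X m (\<lambda>i. p m i j s))) + 1) / a0 + B * sqrt (2 * L * lev.Y m (U m j s))"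
        using lev.lp_l1_le[OF U_per w] unfolding lev.h_psum_abs_unit_at by simp
      also have "\<dots> \<le> (sqrt (2 * L * (a1 * E)) / sqrt s + 1) / a0 + B * sqrt (2 * L * E)"
      proof (intro add_mono divide_right_mono mult_left_mono real_sqrt_le_mono order_refl Y)
        have "lev.X m (\<lambda>i. p m i j s) \<le> E / s" using Xv s by (simp add: field_simps)
        then have "2 * L * (a1 * lev.X m (\<lambda>i. p m i j s)) \<le> 2 * L * (a1 * (E / s))"
          using L_pos lev.a1_pos by (intro mult_left_mono) auto
        then have "sqrt (2 * L * (a1 * lev.X m (\<lambda>i. p m i j s))) \<le> sqrt (2 * L * (a1 * E) / s)"
          by (intro real_sqrt_le_mono) simp
        then show "sqrt (2 * L * (a1 * lev.X m (\<lambda>i. p m i j s))) \<le> sqrt (2 * L * (a1 * E)) / sqrt s"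
          by (simp only: real_sqrt_divide)
      qed (use lev.a0_pos lev.B_nonneg L_pos in auto)
      finally have "mesh L m * (\<Sum>i\<in>{0..<npts m}. \<bar>lp (mesh L m) (U m j s) i\<bar>) * sqrt s
        \<le> ((sqrt (2 * L * (a1 * E)) / sqrt s + 1) / a0 + B * sqrt (2 * L * E)) * sqrt s"
        using ss by (intro mult_right_mono) auto
      also have "\<dots> = (sqrt (2 * L * (a1 * E)) + sqrt s) / a0 + B * sqrt (2 * L * E) * sqrt s"
        using ss by (simp add: distrib_right add_divide_distrib)
      also have "\<dots> \<le> (sqrt (2 * L * (a1 * E)) + sqrt T) / a0 + B * sqrt (2 * L * E) * sqrt T"
        using ss lev.a0_pos lev.B_nonneg L_pos E
        by (intro add_mono divide_right_mono mult_left_mono order_refl) auto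
      also have "\<dots> \<le> K" unfolding K_def using K2 by linarith
      finally show ?thesis using ss by (simp add: pos_le_divide_eq)
    qed
    show "\<bar>fd (mesh L m) (U m j s) i\<bar> \<le> K / sqrt s" for i
      by (rule order_trans[OF lev.fd_sup_le[OF U_per] l1])
  qed
qed

end

section \<open>Convergence of the kernels\<close>

text \<open>Comparison with \<open>2 * K * sqrt s\<close>, whose derivative is
  \<open>K / sqrt s\<close>. Only continuity is needed at the endpoints, so no singular integral has
  to be formed.\<close>

lemma sqrt_growth:
  fixes f f' :: "real \<Rightarrow> real"
  assumes r: "0 \<le> r" and c: "continuous_on {0..r} f"
    and d: "\<And>s. 0 < s \<Longrightarrow> s < r \<Longrightarrow> (f has_real_derivative f' s) (at s)"
    and b: "\<And>s. 0 < s \<Longrightarrow> s < r \<Longrightarrow> \<bar>f' s\<bar> \<le> K / sqrt s"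
  shows "\<bar>f r - f 0\<bar> \<le> 2 * K * sqrt r"
proof -
  have *: "F r \<le> F 0 + 2 * K * sqrt r" if c: "continuous_on {0..r} F"
    and d: "\<And>s. 0 < s \<Longrightarrow> s < r \<Longrightarrow> (F has_real_derivative F' s) (at s)"
    and b: "\<And>s. 0 < s \<Longrightarrow> s < r \<Longrightarrow> F' s \<le> K / sqrt s" for F F' :: "real \<Rightarrow> real"
  proof -
    have "F r - 2 * K * sqrt r \<le> F 0 - 2 * K * sqrt 0"
    proof (rule DERIV_nonpos_imp_decreasing_open[OF r])
      show "continuous_on {0..r} (\<lambda>s. F s - 2 * K * sqrt s)" by (intro continuous_intros c)
      fix s assume s: "0 < s" "s < r"
      have "((\<lambda>s. F s - 2 * K * sqrt s) has_real_derivative F' s - 2 * K * (inverse (sqrt s) / 2)) (at s)"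
        by (rule DERIV_diff[OF d[OF s] DERIV_cmult[OF DERIV_real_sqrt[OF s(1)]]])
      moreover have "F' s - 2 * K * (inverse (sqrt s) / 2) \<le> 0"
        using b[OF s] by (simp add: field_simps)
      ultimately show "\<exists>y. ((\<lambda>s. F s - 2 * K * sqrt s) has_real_derivative y) (at s) \<and> y \<le> 0"
        by blast
    qed
    then show ?thesis by simp
  qed
  have "f r \<le> f 0 + 2 * K * sqrt r"
  proof (rule *[OF c d])
    show "f' s \<le> K / sqrt s" if "0 < s" "s < r" for s using b[OF that] by linarith
  qed
  moreover have "- f r \<le> - f 0 + 2 * K * sqrt r"
  proof (rule *[of "\<lambda>s. - f s" "\<lambda>s. - f' s"])
    show "continuous_on {0..r} (\<lambda>s. - f s)" by (intro continuous_intros c)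
    show "((\<lambda>s. - f s) has_real_derivative - f' s) (at s)" if "0 < s" "s < r" for s
      by (rule DERIV_minus[OF d[OF that]])
    show "- f' s \<le> K / sqrt s" if "0 < s" "s < r" for s using b[OF that] by linarith
  qed
  ultimately show ?thesis by linarith
qed

lemma hat_deriv:
  assumes "\<And>n. ((\<lambda>s. f s n) has_real_derivative f' n) (at s)"
  shows "((\<lambda>s. hat q (f s) n) has_real_derivative hat q f' n) (at s)"
  unfolding hat_def sdiff2_def by (intro DERIV_add DERIV_cdivide DERIV_sum DERIV_cmult DERIV_diff assms)

lemma hat_cont:
  assumes "\<And>n. continuous_on T (\<lambda>s. f s n)"
  shows "continuous_on T (\<lambda>s. hat q (f s) n)"
proof -
  have "continuous_on T (\<lambda>s. f s n + (\<Sum>k\<in>{1..<q}. (real q - real k) * sdiff2 (f s) n (int k)) * (1 / (real q)\<^sup>2))"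
    unfolding sdiff2_def by (intro continuous_intros assms)
  then show ?thesis by (simp add: hat_def)
qed

text \<open>The only consequence of the regularity of the coefficients that is used; symmetric second
  differences avoid a case distinction at \<open>\<gamma> = 1\<close>.\<close>

definition smooth_bound :: "real \<Rightarrow> real \<Rightarrow> real \<Rightarrow> (real \<Rightarrow> real) \<Rightarrow> bool" where
  "smooth_bound L \<gamma> C f \<longleftrightarrow> (\<forall>x d. 0 \<le> d \<and> d \<le> L \<longrightarrow>
     \<bar>f (x + d) - f x\<bar> \<le> C * d powr min 1 \<gamma> \<and> \<bar>f (x + d) + f (x - d) - 2 * f x\<bar> \<le> C * d powr \<gamma>)"

lemma npts_pos: "0 < npts m"
  by (simp add: npts_def)

lemma npts_ge2: "2 \<le> npts m"
proof -
  have "(1::int) \<le> 2 ^ m" by (rule one_le_power) simp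
  then show ?thesis by (simp add: npts_def)
qed

lemma npts_refine: "m \<le> m' \<Longrightarrow> int (2 ^ (m' - m)) * npts m = npts m'"
  unfolding npts_def of_nat_power of_nat_numeral by (subst power_add[symmetric]) simp

lemma mesh_refine: "m \<le> m' \<Longrightarrow> mesh L m = real (2 ^ (m' - m)) * mesh L m'"
  unfolding mesh_def of_nat_power of_nat_numeral by (subst power_diff) auto

lemma mesh_pos: "0 < L \<Longrightarrow> 0 < mesh L m"
  by (simp add: mesh_def)

lemma mesh_le: "0 < L \<Longrightarrow> mesh L m \<le> L"
proof -
  assume "0 < L"
  moreover have "(1::real) \<le> 2 ^ m" by (rule one_le_power) simp
  ultimately show ?thesis unfolding mesh_def by (simp add: field_simps)
qed

lemma npts_mesh: "of_int (npts m) * mesh L m = 2 * L"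
  by (simp add: npts_def mesh_def)

lemma sample_refine: "m \<le> m' \<Longrightarrow> sample L m' f (int (2 ^ (m' - m)) * i) = sample L m f i"
  unfolding sample_def mesh_refine[of m m' L] by (simp add: mult_ac)

locale smooth_kernel_family = kernel_family +
  fixes \<gamma> C :: real
  assumes \<gamma>: "0 < \<gamma>" "\<gamma> \<le> 2" and C: "0 \<le> C"
    and smooth_g: "smooth_bound L \<gamma> C (\<lambda>x. 1 / a x)" and smooth_b: "smooth_bound L \<gamma> C b"
begin

abbreviation "hm \<equiv> mesh L"
abbreviation "\<epsilon> m \<equiv> mesh L m powr \<gamma>"
text \<open>One sup bound for both coefficients of the divided equation, \<open>1 / a\<close> and
  \<open>b\<close>.\<close>

abbreviation "M \<equiv> B + 1 / a0"
definition "e1 m = C * mesh L m powr min 1 \<gamma>"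
definition "e2 m = C * mesh L m powr \<gamma>"
text \<open>The three summands serve in turn to bound \<open>e2\<close>, \<open>h * e1\<close> and
  \<open>h\<^sup>2\<close>, the only error sizes that occur, by a multiple of
  \<open>h\<^sup>\<gamma>\<close>.\<close>

definition "Ke = C + C * (L + L powr (2 - \<gamma>)) + L powr (2 - \<gamma>)"

abbreviation "gg m \<equiv> sample L m (\<lambda>x. 1 / a x)"
abbreviation "bb m \<equiv> sample L m b"
abbreviation "aa m \<equiv> sample L m a"

lemma hm_pos: "0 < hm m"
  using L_pos by (rule mesh_pos)

lemma Ke_nonneg: "0 \<le> Ke"
  unfolding Ke_def using C L_pos by simp

lemma M_nonneg: "0 \<le> M"
  using lev.B_nonneg lev.a0_pos by simp

lemma e1_nonneg: "0 \<le> e1 m" and e2_nonneg: "0 \<le> e2 m"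
  unfolding e1_def e2_def using C by auto

lemma h_sq_le: "(hm m)\<^sup>2 \<le> L powr (2 - \<gamma>) * \<epsilon> m"
proof -
  have "(hm m)\<^sup>2 = hm m powr (2 - \<gamma>) * \<epsilon> m"
    using hm_pos[of m] unfolding powr_add[symmetric] by simp
  also have "\<dots> \<le> L powr (2 - \<gamma>) * \<epsilon> m"
    using \<gamma> hm_pos[of m] mesh_le[OF L_pos, of m] by (intro mult_right_mono powr_mono2) auto
  finally show ?thesis .
qed

lemma e2_le: "e2 m \<le> Ke * \<epsilon> m"
  unfolding e2_def Ke_def using C L_pos by (intro mult_right_mono) auto

lemma h2_le: "(hm m)\<^sup>2 \<le> Ke * \<epsilon> m"
proof -
  have "L powr (2 - \<gamma>) * \<epsilon> m \<le> Ke * \<epsilon> m" unfolding Ke_def using C L_pos by (intro mult_right_mono) auto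
  then show ?thesis using h_sq_le[of m] by linarith
qed

text \<open>For \<gamma> \<le> 1 the extra factor \<open>h\<close> is simply bounded by
  \<open>L\<close>; for \<gamma> > 1 the product is \<open>h\<^sup>2\<close>.\<close>

lemma e1_le: "hm m * e1 m \<le> Ke * \<epsilon> m"
proof -
  have "hm m * hm m powr min 1 \<gamma> \<le> (L + L powr (2 - \<gamma>)) * \<epsilon> m"
  proof (cases "\<gamma> \<le> 1")
    case True
    then have "hm m * hm m powr min 1 \<gamma> \<le> L * \<epsilon> m"
      using mesh_le[OF L_pos, of m] by (simp add: min_def mult_right_mono)
    also have "\<dots> \<le> (L + L powr (2 - \<gamma>)) * \<epsilon> m" by (intro mult_right_mono) auto
    finally show ?thesis .
  next
    case False
    then have "hm m * hm m powr min 1 \<gamma> = (hm m)\<^sup>2" using hm_pos[of m] by (simp add: min_def power2_eq_square)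
    also have "\<dots> \<le> L powr (2 - \<gamma>) * \<epsilon> m" by (rule h_sq_le)
    also have "\<dots> \<le> (L + L powr (2 - \<gamma>)) * \<epsilon> m" using L_pos by (intro mult_right_mono) auto
    finally show ?thesis .
  qed
  then have "C * (hm m * hm m powr min 1 \<gamma>) \<le> C * ((L + L powr (2 - \<gamma>)) * \<epsilon> m)" using C by (rule mult_left_mono)
  also have "\<dots> = C * (L + L powr (2 - \<gamma>)) * \<epsilon> m" by simp
  also have "\<dots> \<le> Ke * \<epsilon> m" unfolding Ke_def using C by (intro mult_right_mono) auto
  finally show ?thesis unfolding e1_def by (simp add: mult_ac)
qed

lemma refinement_levels:
  "m \<le> m' \<Longrightarrow> refinement (2 ^ (m' - m)) (npts m) (hm m) (hm m') (2 * L) M (e1 m) (e2 m)"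
proof (unfold_locales, goal_cases)
  case 1
  show "(1::nat) \<le> 2 ^ (m' - m)" by simp
next
  case 4
  then show ?case by (rule mesh_refine)
qed (rule npts_pos hm_pos npts_mesh M_nonneg e1_nonneg e2_nonneg)+

lemma osc_sample:
  assumes m: "m \<le> m'" and f: "smooth_bound L \<gamma> C f" and p: "per (npts m') (sample L m' f)"
    and le: "\<And>x. \<bar>sample L m' f x\<bar> \<le> M"
  shows "refinement.osc (2 ^ (m' - m)) (npts m) M (e1 m) (e2 m) (sample L m' f)"
proof -
  interpret R: refinement "2 ^ (m' - m)" "npts m" "hm m" "hm m'" "2 * L" M "e1 m" "e2 m"
    by (rule refinement_levels[OF m])
  show ?thesis unfolding R.osc_def
  proof (intro conjI allI impI le)
    show "per (int (2 ^ (m' - m)) * npts m) (sample L m' f)" using p npts_refine[OF m] by simp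
    fix n and k :: nat assume k: "k \<le> 2 ^ (m' - m)"
    let ?d = "hm m' * real k" and ?x = "hm m' * of_int n"
    have "real k \<le> real (2 ^ (m' - m))" using k by (simp only: of_nat_le_iff)
    then have "?d \<le> hm m' * real (2 ^ (m' - m))" using hm_pos[of m'] by (intro mult_left_mono) auto
    then have dh: "?d \<le> hm m" unfolding mesh_refine[OF m] by (simp add: mult.commute)
    have d: "0 \<le> ?d" "?d \<le> L" using hm_pos[of m'] dh mesh_le[OF L_pos, of m] by auto
    have 1: "\<bar>f (?x + ?d) - f ?x\<bar> \<le> C * ?d powr min 1 \<gamma>" "\<bar>f (?x + ?d) + f (?x - ?d) - 2 * f ?x\<bar> \<le> C * ?d powr \<gamma>"
      using f d unfolding smooth_bound_def by blast+
    have 2: "C * ?d powr min 1 \<gamma> \<le> e1 m" "C * ?d powr \<gamma> \<le> e2 m"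
      unfolding e1_def e2_def using C dh d \<gamma> by (auto intro!: mult_left_mono powr_mono2)
    have 3: "sample L m' f (n + int k) = f (?x + ?d)" "sample L m' f (n - int k) = f (?x - ?d)"
      "sample L m' f n = f ?x" by (simp_all add: sample_def algebra_simps)
    show "\<bar>sample L m' f (n + int k) - sample L m' f n\<bar> \<le> e1 m"
      using 1 2 unfolding 3 by linarith
    show "\<bar>sdiff2 (sample L m' f) n (int k)\<bar> \<le> e2 m"
      using 1 2 unfolding sdiff2_def 3 by linarith
  qed
qed

lemma gg_eq: "gg m i = 1 / aa m i"
  by (simp add: sample_def)

lemma osc_g: "m \<le> m' \<Longrightarrow> refinement.osc (2 ^ (m' - m)) (npts m) M (e1 m) (e2 m) (gg m')"
proof (rule osc_sample[OF _ smooth_g])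
  show "per (npts m') (gg m')" using lev.per_a[of m'] by (simp add: per_def gg_eq)
  fix i
  have "1 / aa m' i \<le> 1 / a0" using lev.a0_pos lev.a_ge[of m' i] by (intro divide_left_mono) (auto simp: lev.a_pos)
  then show "\<bar>gg m' i\<bar> \<le> M" unfolding gg_eq using lev.a_pos[of m' i] lev.B_nonneg by simp
qed auto

lemma osc_b: "m \<le> m' \<Longrightarrow> refinement.osc (2 ^ (m' - m)) (npts m) M (e1 m) (e2 m) (bb m')"
proof (rule osc_sample[OF _ smooth_b])
  show "per (npts m') (bb m')" by (rule lev.per_b)
  show "\<bar>bb m' i\<bar> \<le> M" for i using lev.b_le[of m' i] lev.a0_pos by (simp add: add_increasing2)
qed auto

section \<open>Consistency at positive times and the two halves of the time interval\<close>

lemma A_refine: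
  "lev.A m f i = aa m i * (lp (hm m) f i + bb m i * cd (hm m) f i)"
  by (simp add: Aop_def)

lemma g_pk_Suc: "gg m n * lev.pk m (Suc k) n j s
    = lp (hm m) (\<lambda>n. lev.pk m k n j s) n + bb m n * cd (hm m) (\<lambda>n. lev.pk m k n j s) n"
  using lev.a_nz[of m n] unfolding gg_eq lev.pk_Suc A_refine by simp

text \<open>The restriction of the fine kernel nearly solves the coarse backward equation. In the
  equation divided by \<open>a\<close>, the role of \<open>w\<close> is played by the next time
  derivative, which is as smooth as the kernel away from time zero.\<close>

lemma truncation_bound:
  assumes t0: "0 < t0"
  shows "\<exists>K\<ge>0. \<forall>m m' j s i. m \<le> m' \<and> t0 \<le> s \<and> s \<le> T \<longrightarrow>
    \<bar>lev.A m (\<lambda>i. lev.pk m' k (int (2 ^ (m' - m)) * i) j s) i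
       - lev.pk m' (Suc k) (int (2 ^ (m' - m)) * i) j s\<bar> \<le> K * \<epsilon> m"
proof -
  obtain K0 where K0: "0 \<le> K0" "\<And>m i j s. t0 \<le> s \<Longrightarrow> s \<le> T \<Longrightarrow> \<bar>lev.pk m k i j s\<bar> \<le> K0 \<and>
    \<bar>fd (mesh L m) (\<lambda>i. lev.pk m k i j s) i\<bar> \<le> K0 \<and> \<bar>lp (mesh L m) (\<lambda>i. lev.pk m k i j s) i\<bar> \<le> K0"
    using pk_bounds[OF t0, of T k] by blast
  obtain K1 where K1: "0 \<le> K1" "\<And>m i j s. t0 \<le> s \<Longrightarrow> s \<le> T \<Longrightarrow> \<bar>lev.pk m (Suc k) i j s\<bar> \<le> K1 \<and>
    \<bar>fd (mesh L m) (\<lambda>i. lev.pk m (Suc k) i j s) i\<bar> \<le> K1 \<and> \<bar>lp (mesh L m) (\<lambda>i. lev.pk m (Suc k) i j s) i\<bar> \<le> K1"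
    using pk_bounds[OF t0, of T "Suc k"] by blast
  let ?S = "K0 + K1" and ?c = "8 + 2 * M + 4 * M * (3 * M + 2)"
  show ?thesis
  proof (intro exI[of _ "a1 * (?c * (?S * Ke))"] conjI allI impI)
    have c: "0 \<le> ?c" using M_nonneg by simp
    show "0 \<le> a1 * (?c * (?S * Ke))" using lev.a1_pos c K0 K1 Ke_nonneg by simp
    fix m m' :: nat and j s i assume "m \<le> m' \<and> t0 \<le> s \<and> s \<le> T"
    then have m: "m \<le> m'" and s: "t0 \<le> s" "s \<le> T" by auto
    let ?q = "2 ^ (m' - m) :: nat"
    interpret R: refinement "?q" "npts m" "hm m" "hm m'" "2 * L" M "e1 m" "e2 m"
      by (rule refinement_levels[OF m])
    let ?f = "\<lambda>n. lev.pk m' k n j s" and ?w = "\<lambda>n. lev.pk m' (Suc k) n j s"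
    let ?E = "lp (hm m) (\<lambda>i. ?f (int ?q * i)) i + bb m' (int ?q * i) * cd (hm m) (\<lambda>i. ?f (int ?q * i)) i
       - gg m' (int ?q * i) * ?w (int ?q * i)"
    have "\<bar>?E\<bar> \<le> ?c * (?S * (Ke * \<epsilon> m))"
    proof (rule R.truncation[OF osc_g[OF m] osc_b[OF m] g_pk_Suc])
      show "\<bar>fd (hm m') ?f n\<bar> \<le> ?S" "\<bar>lp (hm m') ?f n\<bar> \<le> ?S" "\<bar>?w n\<bar> \<le> ?S"
        "\<bar>fd (hm m') ?w n\<bar> \<le> ?S" "\<bar>lp (hm m') ?w n\<bar> \<le> ?S" for n
        using K0(2)[OF s, where m=m' and i=n and j=j] K1(2)[OF s, where m=m' and i=n and j=j] K0(1) K1(1) by linarith+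
    qed (rule e2_le e1_le h2_le)+
    moreover have "lev.A m (\<lambda>i. ?f (int ?q * i)) i - ?w (int ?q * i) = aa m i * ?E"
      using lev.a_nz[of m i] unfolding A_refine sample_refine[OF m] gg_eq by (simp add: sample_refine[OF m] right_diff_distrib)
    ultimately have "\<bar>lev.A m (\<lambda>i. ?f (int ?q * i)) i - ?w (int ?q * i)\<bar> \<le> a1 * (?c * (?S * (Ke * \<epsilon> m)))"
      using lev.a_pos[of m i] lev.a_le[of m i] lev.a1_pos by (auto simp: abs_mult intro!: mult_mono)
    then show "\<bar>lev.A m (\<lambda>i. ?f (int ?q * i)) i - ?w (int ?q * i)\<bar> \<le> a1 * (?c * (?S * Ke)) * \<epsilon> m"
      by (simp add: mult_ac)
  qed
qed

text \<open>The sum of the coarse kernel at time \<tau> against the fine one at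
  \<open>t - \<tau>\<close> equals the fine kernel at \<tau> = 0. Its \<tau>-derivative tests the
  truncation error of the fine kernel, whose age is at least \<open>t / 2\<close>, with the coarse
  kernel, whose summed size is \<open>1 / sqrt \<tau>\<close>.\<close>

lemma second_half:
  assumes t: "0 < t"
  shows "\<exists>K\<ge>0. \<forall>m m' i j. m \<le> m' \<longrightarrow>
    \<bar>hm m * (\<Sum>z\<in>{0..<npts m}. p m i z (t / 2) * lev.pk m' k (int (2 ^ (m' - m)) * z) j (t / 2))
       - lev.pk m' k (int (2 ^ (m' - m)) * i) j t\<bar> \<le> K * \<epsilon> m"
proof -
  obtain Kt where Kt: "0 \<le> Kt" "\<And>m m' j s i. m \<le> m' \<Longrightarrow> t / 2 \<le> s \<Longrightarrow> s \<le> t \<Longrightarrow>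
    \<bar>lev.A m (\<lambda>i. lev.pk m' k (int (2 ^ (m' - m)) * i) j s) i
       - lev.pk m' (Suc k) (int (2 ^ (m' - m)) * i) j s\<bar> \<le> Kt * \<epsilon> m"
    using truncation_bound[of "t / 2" t k] t by auto
  obtain Kl where Kl: "0 \<le> Kl" "\<And>m i \<tau>. 0 < \<tau> \<Longrightarrow> \<tau> \<le> t \<Longrightarrow>
      mesh L m * (\<Sum>z\<in>{0..<npts m}. \<bar>p m i z \<tau>\<bar>) \<le> Kl / sqrt \<tau>"
    using forward_l1_bound[OF t] by blast
  show ?thesis
  proof (intro exI[of _ "2 * (Kl * Kt) * sqrt (t / 2)"] conjI allI impI)
    show "0 \<le> 2 * (Kl * Kt) * sqrt (t / 2)" using Kl(1) Kt(1) t by simp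
    fix m m' :: nat and i j assume m: "m \<le> m'"
    let ?n = "\<lambda>z. int (2 ^ (m' - m)) * z"
    let ?f = "\<lambda>\<tau>. hm m * (\<Sum>z\<in>{0..<npts m}. p m i z \<tau> * lev.pk m' k (?n z) j (t - \<tau>))"
    let ?f' = "\<lambda>\<tau>. hm m * (\<Sum>z\<in>{0..<npts m}. p m i z \<tau> *
      (lev.A m (\<lambda>z. lev.pk m' k (?n z) j (t - \<tau>)) z - lev.pk m' (Suc k) (?n z) j (t - \<tau>)))"
    have "\<bar>?f (t / 2) - ?f 0\<bar> \<le> 2 * (Kl * Kt * \<epsilon> m) * sqrt (t / 2)"
    proof (rule sqrt_growth)
      show "0 \<le> t / 2" using t by simp
      show "continuous_on {0..t / 2} ?f"
      proof (intro continuous_intros)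
        show "continuous_on {0..t / 2} (p m i z)" for z
          by (rule continuous_on_subset[OF lev.p_cont]) auto
        show "continuous_on {0..t / 2} (\<lambda>\<tau>. lev.pk m' k (?n z) j (t - \<tau>))" for z
          by (rule continuous_on_compose2[OF lev.pk_cont[of m' k "?n z" j]]) (auto intro!: continuous_intros)
      qed
      fix \<tau> assume \<tau>: "0 < \<tau>" "\<tau> < t / 2"
      have per: "per (npts m) (\<lambda>z. lev.pk m' k (?n z) j s)" for s
        using perD[OF lev.pk_per1[of m' k j s]] by (simp add: per_def distrib_left npts_refine[OF m] del: of_nat_power)
      have d: "((\<lambda>\<tau>. lev.pk m' k (?n z) j (t - \<tau>)) has_real_derivative - lev.pk m' (Suc k) (?n z) j (t - \<tau>)) (at \<tau>)" for z
      proof -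
        have "((\<lambda>s. lev.pk m' k (?n z) j s) has_real_derivative lev.pk m' (Suc k) (?n z) j (t - \<tau>)) (at (t - \<tau>))"
          using \<tau> by (intro lev.pk_deriv) auto
        moreover have "((\<lambda>\<tau>. t - \<tau>) has_real_derivative - 1) (at \<tau>)" by (auto intro!: derivative_eq_intros)
        ultimately show ?thesis using DERIV_chain2[of "\<lambda>s. lev.pk m' k (?n z) j s"] by fastforce
      qed
      have "(?f has_real_derivative hm m * (\<Sum>z\<in>{0..<npts m}.
          lev.A' m (\<lambda>y. p m i y \<tau>) z * lev.pk m' k (?n z) j (t - \<tau>)
          + - lev.pk m' (Suc k) (?n z) j (t - \<tau>) * p m i z \<tau>)) (at \<tau>)"
        by (intro DERIV_cmult DERIV_sum DERIV_mult lev.p_fwd \<tau> d)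
      \<comment> \<open>Adjointness moves the operator from the coarse kernel to the restricted fine
        one, where only its failure to be a coarse solution survives.\<close>
      also have "(\<Sum>z\<in>{0..<npts m}. lev.A' m (\<lambda>y. p m i y \<tau>) z * lev.pk m' k (?n z) j (t - \<tau>)
          + - lev.pk m' (Suc k) (?n z) j (t - \<tau>) * p m i z \<tau>)
        = (\<Sum>z\<in>{0..<npts m}. p m i z \<tau> *
      (lev.A m (\<lambda>z. lev.pk m' k (?n z) j (t - \<tau>)) z - lev.pk m' (Suc k) (?n z) j (t - \<tau>)))"
        unfolding sum.distrib lev.adjoint[OF lev.p_per2 per, symmetric]
        by (simp add: sum.distrib[symmetric] algebra_simps)
      finally show "(?f has_real_derivative ?f' \<tau>) (at \<tau>)" .
      have "\<bar>?f' \<tau>\<bar> \<le> hm m * (\<Sum>z\<in>{0..<npts m}. \<bar>p m i z \<tau>\<bar> * (Kt * \<epsilon> m))"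
      proof -
        have tr: "\<bar>lev.A m (\<lambda>z. lev.pk m' k (?n z) j (t - \<tau>)) z - lev.pk m' (Suc k) (?n z) j (t - \<tau>)\<bar> \<le> Kt * \<epsilon> m" for z
          using \<tau> by (intro Kt(2)[OF m]) auto
        show ?thesis unfolding abs_mult abs_of_pos[OF hm_pos]
          using hm_pos[of m] by (intro mult_left_mono order_trans[OF sum_abs sum_mono])
            (simp_all only: abs_mult mult_left_mono tr abs_ge_zero less_imp_le)
      qed
      also have "\<dots> = hm m * (\<Sum>z\<in>{0..<npts m}. \<bar>p m i z \<tau>\<bar>) * (Kt * \<epsilon> m)" by (simp only: sum_distrib_right[symmetric] mult.assoc)
      also have "\<dots> \<le> Kl / sqrt \<tau> * (Kt * \<epsilon> m)"
        using \<tau> Kt(1) by (intro mult_right_mono Kl(2)) auto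
      finally show "\<bar>?f' \<tau>\<bar> \<le> Kl * Kt * \<epsilon> m / sqrt \<tau>" by simp
    qed
    moreover have "?f 0 = lev.pk m' k (?n i) j t"
    proof -
      have per: "per (npts m) (\<lambda>z. lev.pk m' k (?n z) j t)"
        using perD[OF lev.pk_per1[of m' k j t]] by (simp add: per_def distrib_left npts_refine[OF m] del: of_nat_power)
      have "p m i z 0 = unit_at (npts m) (hm m) i z" for z by (simp add: lev.p_0 unit_at_sym)
      then show ?thesis using psum_unit_at[OF npts_pos per, of "hm m" i] hm_pos[of m] by simp
    qed
    ultimately show "\<bar>hm m * (\<Sum>z\<in>{0..<npts m}. p m i z (t / 2) * lev.pk m' k (?n z) j (t / 2))
       - lev.pk m' k (?n i) j t\<bar> \<le> 2 * (Kl * Kt) * sqrt (t / 2) * \<epsilon> m"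
      by (simp add: mult_ac)
  qed
qed


text \<open>The error of averaging in the time-derivative term of the divided equation; it is small
  in sum, so boundedness of the test function suffices.\<close>

lemma weak_error_F:
  assumes m: "m \<le> m'" and f: "per (npts m') f" "\<And>i. \<bar>f i\<bar> \<le> \<Theta>" "\<And>i. \<bar>fd (hm m') f i\<bar> \<le> \<Theta>"
    and l: "hm m' * (\<Sum>j\<in>{0..<npts m'}. \<bar>lp (hm m') f j\<bar>) \<le> \<Theta>"
    and \<psi>: "\<And>i. \<bar>\<psi> i\<bar> \<le> K"
  defines "F \<equiv> \<lambda>z. hat (2 ^ (m' - m)) (\<lambda>n. gg m' n * f n) (int (2 ^ (m' - m)) * z)
      - gg m' (int (2 ^ (m' - m)) * z) * f (int (2 ^ (m' - m)) * z)"
  shows "\<bar>hm m * (\<Sum>z\<in>{0..<npts m}. \<psi> z * F z)\<bar> \<le> (2 * M + 6 * L) * Ke * (K * \<Theta>) * \<epsilon> m"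
proof -
  interpret R: refinement "2 ^ (m' - m)" "npts m" "hm m" "hm m'" "2 * L" M "e1 m" "e2 m"
    by (rule refinement_levels[OF m])
  have K: "0 \<le> K" using \<psi>[of 0] by linarith
  have \<Theta>: "0 \<le> \<Theta>" using f(2)[of 0] by linarith
  have "\<bar>hm m * (\<Sum>z\<in>{0..<npts m}. \<psi> z * F z)\<bar> \<le> hm m * (\<Sum>z\<in>{0..<npts m}. K * \<bar>F z\<bar>)"
    unfolding abs_mult abs_of_pos[OF hm_pos]
  proof (intro mult_left_mono order_trans[OF sum_abs sum_mono])
    show "\<bar>\<psi> z * F z\<bar> \<le> K * \<bar>F z\<bar>" for z unfolding abs_mult by (intro mult_right_mono \<psi>) simp
  qed (simp add: less_imp_le[OF hm_pos])
  also have "\<dots> = K * (hm m * (\<Sum>z\<in>{0..<npts m}. \<bar>F z\<bar>))" by (simp add: sum_distrib_left mult_ac)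
  also have "\<dots> \<le> K * ((2 * M * (hm m)\<^sup>2 + 2 * L * (e2 m + 2 * e1 m * hm m)) * \<Theta>)"
    unfolding F_def using f l npts_refine[OF m]
    by (intro mult_left_mono K R.hat_prod_l1[OF osc_g[OF m]]) auto
  also have "\<dots> = K * \<Theta> * (2 * M * (hm m)\<^sup>2 + 2 * L * e2 m + 4 * L * (hm m * e1 m))" by (simp add: algebra_simps)
  also have "\<dots> \<le> K * \<Theta> * (2 * M * (Ke * \<epsilon> m) + 2 * L * (Ke * \<epsilon> m) + 4 * L * (Ke * \<epsilon> m))"
    using K \<Theta> M_nonneg L_pos by (intro mult_left_mono add_mono h2_le e2_le e1_le) auto
  also have "\<dots> = (2 * M + 6 * L) * Ke * (K * \<Theta>) * \<epsilon> m" by (simp add: algebra_simps)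
  finally show ?thesis .
qed

text \<open>The error of averaging in the drift term; here the test function must also be Lipschitz,
  because a discrete derivative is moved onto it.\<close>

lemma weak_error_H:
  assumes m: "m \<le> m'" and f: "per (npts m') f" "\<And>i. \<bar>fd (hm m') f i\<bar> \<le> \<Theta>"
    and l: "hm m' * (\<Sum>j\<in>{0..<npts m'}. \<bar>lp (hm m') f j\<bar>) \<le> \<Theta>"
    and \<psi>: "per (npts m) \<psi>" "\<And>i. \<bar>\<psi> i\<bar> \<le> K" "\<And>i. \<bar>fd (hm m) \<psi> i\<bar> \<le> K"
  defines "H \<equiv> \<lambda>z. hat (2 ^ (m' - m)) (\<lambda>n. bb m' n * cd (hm m') f n) (int (2 ^ (m' - m)) * z)
      - bb m' (int (2 ^ (m' - m)) * z) * cd (hm m) (\<lambda>z. f (int (2 ^ (m' - m)) * z)) z"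
  shows "\<bar>hm m * (\<Sum>z\<in>{0..<npts m}. \<psi> z * H z)\<bar> \<le> (2 * L + 8 + 4 * M) * Ke * (K * \<Theta>) * \<epsilon> m"
proof -
  interpret R: refinement "2 ^ (m' - m)" "npts m" "hm m" "hm m'" "2 * L" M "e1 m" "e2 m"
    by (rule refinement_levels[OF m])
  have K: "0 \<le> K" using \<psi>(2)[of 0] by linarith
  have \<Theta>: "0 \<le> \<Theta>" using f(2)[of 0] by linarith
  have "\<bar>hm m * (\<Sum>z\<in>{0..<npts m}. \<psi> z * H z)\<bar> \<le> (2 * L * e2 m + 8 * e1 m * hm m + 4 * M * (hm m)\<^sup>2) * (K * \<Theta>)"
    unfolding H_def using f l npts_refine[OF m] by (intro R.hat_gradient_weak[OF osc_b[OF m]] \<psi>) auto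
  also have "\<dots> = (K * \<Theta>) * (2 * L * e2 m + 8 * (hm m * e1 m) + 4 * M * (hm m)\<^sup>2)" by (simp add: algebra_simps)
  also have "\<dots> \<le> (K * \<Theta>) * (2 * L * (Ke * \<epsilon> m) + 8 * (Ke * \<epsilon> m) + 4 * M * (Ke * \<epsilon> m))"
    using K \<Theta> M_nonneg L_pos by (intro mult_left_mono add_mono h2_le e2_le e1_le) auto
  also have "\<dots> = (2 * L + 8 + 4 * M) * Ke * (K * \<Theta>) * \<epsilon> m" by (simp add: algebra_simps)
  finally show ?thesis .
qed

text \<open>The source terms are singular for small times, so they are written as time derivatives of
  the same expressions in the integrated kernel \<open>U\<close>, and the derivative is moved to the smooth
  coarse kernel.\<close>

lemma first_half:
  assumes t: "0 < t"
  shows "\<exists>K\<ge>0. \<forall>m m' i j. m \<le> m' \<longrightarrow>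
    \<bar>hm m * (\<Sum>z\<in>{0..<npts m}. lev.pk m k i z (t / 2) * p m' (int (2 ^ (m' - m)) * z) (int (2 ^ (m' - m)) * j) (t / 2))
       - lev.pk m k i j t\<bar> \<le> K * \<epsilon> m"
proof -
  define r where "r = t / 2"
  have r: "0 < r" "r < t" "t - r = r" "r \<le> t" using t unfolding r_def by auto
  obtain K0 where K0: "0 \<le> K0" "\<And>m i j s. r \<le> s \<Longrightarrow> s \<le> t \<Longrightarrow> \<bar>lev.pk m k i j s\<bar> \<le> K0"
    using pk_bounds[OF r(1), of t k] by blast
  obtain K1 where K1: "0 \<le> K1" "\<And>m i j s. r \<le> s \<Longrightarrow> s \<le> t \<Longrightarrow> \<bar>lev.pk m (Suc k) i j s\<bar> \<le> K1"
    using pk_bounds[OF r(1), of t "Suc k"] by blast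
  obtain K2 where K2: "0 \<le> K2" "\<And>m i j s. r \<le> s \<Longrightarrow> s \<le> t \<Longrightarrow> \<bar>lev.pk m (Suc (Suc k)) i j s\<bar> \<le> K2"
    using pk_bounds[OF r(1), of t "Suc (Suc k)"] by blast
  obtain K3 where K3: "0 \<le> K3" "\<And>m i j s. r \<le> s \<Longrightarrow> s \<le> t \<Longrightarrow>
      \<bar>fd (hm m) (\<lambda>j. aa m j * lev.pk m k i j s) j\<bar> \<le> K3"
    using pk_forward_Lipschitz[OF r(1), of t k] by blast
  obtain K4 where K4: "0 \<le> K4" "\<And>m i j s. r \<le> s \<Longrightarrow> s \<le> t \<Longrightarrow>
      \<bar>fd (hm m) (\<lambda>j. aa m j * lev.pk m (Suc k) i j s) j\<bar> \<le> K4"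
    using pk_forward_Lipschitz[OF r(1), of t "Suc k"] by blast
  obtain K5 where K5: "0 \<le> K5" "\<And>m i j. \<bar>p m i j r\<bar> \<le> K5 \<and>
    \<bar>fd (hm m) (\<lambda>i. p m i j r) i\<bar> \<le> K5 \<and> \<bar>lp (hm m) (\<lambda>i. p m i j r) i\<bar> \<le> K5"
    using pk_bounds[OF r(1), of r 0] by (auto simp: lev.pk_0)
  obtain KU where KU: "0 \<le> KU" "\<And>m j s i. 0 < s \<Longrightarrow> s \<le> r \<Longrightarrow> \<bar>U m j s i\<bar> \<le> KU / sqrt s"
     "\<And>m j s i. 0 < s \<Longrightarrow> s \<le> r \<Longrightarrow> \<bar>fd (hm m) (U m j s) i\<bar> \<le> KU / sqrt s"
     "\<And>m j s. 0 < s \<Longrightarrow> s \<le> r \<Longrightarrow> hm m * (\<Sum>i\<in>{0..<npts m}. \<bar>lp (hm m) (U m j s) i\<bar>) \<le> KU / sqrt s"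
    using U_bounds[OF r(1)] by blast
  \<comment> \<open>A common bound for all test functions: \<open>a\<close> times the coarse kernel
    after up to two further time derivatives, and the slopes needed for the drift error.\<close>
  define Kp where "Kp = a1 * (K0 + K1 + K2) + K3 + K4"
  define Cw where "Cw = (2 * L + 8 + 4 * M) * Ke"
  define Cf where "Cf = (2 * M + 6 * L) * Ke"
  define Cs where "Cs = a1 * K0 * (2 * L) * ((2 * M + 3) * K5 * Ke)"
  define KD where "KD = (Cw + Cf) * (Kp * KU)"
  have C0: "0 \<le> Cw" "0 \<le> Cf" "0 \<le> Kp" "0 \<le> Cs" "0 \<le> KD"
    unfolding Cw_def Cf_def Kp_def Cs_def KD_def
    using L_pos M_nonneg Ke_nonneg K0(1) K1(1) K2(1) K3(1) K4(1) K5(1) KU(1) lev.a1_pos by auto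
  have \<phi>: "\<bar>aa m z * lev.pk m k i z s\<bar> \<le> Kp" "\<bar>aa m z * lev.pk m (Suc k) i z s\<bar> \<le> Kp"
    "\<bar>aa m z * lev.pk m (Suc (Suc k)) i z s\<bar> \<le> Kp"
    "\<bar>fd (hm m) (\<lambda>z. aa m z * lev.pk m k i z s) z\<bar> \<le> Kp" "\<bar>fd (hm m) (\<lambda>z. aa m z * lev.pk m (Suc k) i z s) z\<bar> \<le> Kp"
    if s: "r \<le> s" "s \<le> t" for m i z s
  proof -
    have *: "\<bar>aa m z * x\<bar> \<le> Kp" if "\<bar>x\<bar> \<le> K0 + K1 + K2" for x
    proof -
      have "\<bar>aa m z * x\<bar> \<le> a1 * (K0 + K1 + K2)"
        unfolding abs_mult using that lev.a_le[of m z] lev.a_pos[of m z] lev.a1_pos by (intro mult_mono) auto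
      then show ?thesis unfolding Kp_def using K3(1) K4(1) by linarith
    qed
    have a: "0 \<le> a1 * (K0 + K1 + K2)" using lev.a1_pos K0(1) K1(1) K2(1) by simp
    show "\<bar>aa m z * lev.pk m k i z s\<bar> \<le> Kp" "\<bar>aa m z * lev.pk m (Suc k) i z s\<bar> \<le> Kp"
      "\<bar>aa m z * lev.pk m (Suc (Suc k)) i z s\<bar> \<le> Kp"
      using K0(2)[OF s, of m i z] K1(2)[OF s, of m i z] K2(2)[OF s, of m i z] K0(1) K1(1) K2(1)
      by (intro *; linarith)+
    show "\<bar>fd (hm m) (\<lambda>z. aa m z * lev.pk m k i z s) z\<bar> \<le> Kp" "\<bar>fd (hm m) (\<lambda>z. aa m z * lev.pk m (Suc k) i z s) z\<bar> \<le> Kp"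
      using K3(2)[OF s, of m i z] K4(2)[OF s, of m i z] K3(1) K4(1) a unfolding Kp_def by linarith+
  qed
  show ?thesis
  proof (intro exI[of _ "2 * KD * sqrt r + Cs + KD / sqrt r"] conjI allI impI)
    show "0 \<le> 2 * KD * sqrt r + Cs + KD / sqrt r" using C0 r by simp
    fix m m' :: nat and i j assume m: "m \<le> m'"
    let ?q = "2 ^ (m' - m) :: nat"
    interpret R: refinement ?q "npts m" "hm m" "hm m'" "2 * L" M "e1 m" "e2 m"
      by (rule refinement_levels[OF m])
    let ?n = "\<lambda>z. int ?q * z"
    define v where "v s n = p m' n (?n j) s" for s n
    define u where "u s = U m' (?n j) s" for s
    define F where "F f z = hat ?q (\<lambda>n. gg m' n * f n) (?n z) - gg m' (?n z) * f (?n z)" for f z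
    define H where "H f z = hat ?q (\<lambda>n. bb m' n * cd (hm m') f n) (?n z)
      - bb m' (?n z) * cd (hm m) (\<lambda>z. f (?n z)) z" for f z
    let ?\<phi> = "\<lambda>k z s. lev.pk m k i z (t - s)"
    \<comment> \<open>The pairing of the coarse kernel with the averaged fine one, plus two
      corrections built from \<open>u\<close>. Upon differentiation the corrections cancel
      \<open>H (v s)\<close> and \<open>F (v s)\<close>, the errors that are too singular, and leave
      errors in \<open>u\<close> tested with further time derivatives of the coarse kernel.\<close>
    define D where "D s = hm m * (\<Sum>z\<in>{0..<npts m}. ?\<phi> k z s * (aa m z * (hat ?q (\<lambda>n. gg m' n * v s n) (?n z) - H (u s) z))
      + ?\<phi> (Suc k) z s * (aa m z * F (u s) z))" for s
    define D' where "D' s = hm m * (\<Sum>z\<in>{0..<npts m}. (aa m z * ?\<phi> (Suc k) z s) * H (u s) z)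
      - hm m * (\<Sum>z\<in>{0..<npts m}. (aa m z * ?\<phi> (Suc (Suc k)) z s) * F (u s) z)" for s
    have pv: "per (npts m) (\<lambda>z. v s (?n z))" for s
      using perD[OF lev.p_per1[of m' "?n j" s]] by (simp add: per_def v_def distrib_left npts_refine[OF m] del: of_nat_power)
    have bq: "bb m' (?n z) = bb m z" "gg m' (?n z) = 1 / aa m z" for z
      by (simp_all only: sample_refine[OF m] gg_eq)
    have cv: "continuous_on {0..r} (\<lambda>s. v s n)" for n
      unfolding v_def by (rule continuous_on_subset[OF lev.p_cont]) auto
    have cu: "continuous_on {0..r} (\<lambda>s. u s n)" for n
      unfolding u_def by (rule U_cont)
    have dv: "((\<lambda>s. v s n) has_real_derivative lev.A m' (v s) n) (at s)" if "0 < s" for s n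
      using lev.column_bsol[of m' "?n j"] that unfolding lev.bsol_def v_def by simp
    have du: "((\<lambda>s. u s n) has_real_derivative v s n) (at s)" if "0 < s" for s n
      unfolding u_def v_def by (rule U_deriv[OF that])
    have c\<phi>: "continuous_on {0..r} (\<lambda>s. ?\<phi> k z s)" for k z
      by (rule continuous_on_compose2[OF lev.pk_cont[of m k i z]]) (use r in \<open>auto intro!: continuous_intros\<close>)
    have d\<phi>: "((\<lambda>s. ?\<phi> k z s) has_real_derivative - ?\<phi> (Suc k) z s) (at s)" if "s < r" for k z s
    proof -
      have "((\<lambda>s. lev.pk m k i z s) has_real_derivative lev.pk m (Suc k) i z (t - s)) (at (t - s))"
        using that r by (intro lev.pk_deriv) auto
      moreover have "((\<lambda>s. t - s) has_real_derivative - 1) (at s)" by (auto intro!: derivative_eq_intros)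
      ultimately show ?thesis using DERIV_chain2[of "\<lambda>s. lev.pk m k i z s"] by fastforce
    qed
    have cd_cont: "continuous_on T (\<lambda>s. cd h' (f s) n)" if "\<And>n. continuous_on T (\<lambda>s. f s n)" "0 < h'"
      for T :: "real set" and f :: "real \<Rightarrow> int \<Rightarrow> real" and h' n
      unfolding cd_def using that by (intro continuous_intros) auto
    have cd_deriv: "((\<lambda>s. cd h' (f s) n) has_real_derivative cd h' f' n) (at s)"
      if "\<And>n. ((\<lambda>s. f s n) has_real_derivative f' n) (at s)" for f f' s h' n
      unfolding cd_def by (intro DERIV_cdivide DERIV_diff that)
    have cF: "continuous_on {0..r} (\<lambda>s. F (u s) z)" for z
      unfolding F_def by (intro continuous_on_diff continuous_on_mult continuous_on_const hat_cont cu)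
    have cH: "continuous_on {0..r} (\<lambda>s. H (u s) z)" for z
      unfolding H_def
      by (intro continuous_on_diff continuous_on_mult continuous_on_const hat_cont cd_cont cu hm_pos)
    have dF: "((\<lambda>s. F (u s) z) has_real_derivative F (v s) z) (at s)" if "0 < s" for z s
      unfolding F_def by (intro DERIV_diff DERIV_cmult hat_deriv du that)
    have dH: "((\<lambda>s. H (u s) z) has_real_derivative H (v s) z) (at s)" if "0 < s" for z s
      unfolding H_def by (intro DERIV_diff DERIV_cmult hat_deriv cd_deriv du that)
    have pu: "per (npts m') (u s)" for s unfolding u_def by (rule U_per)
    have errF: "\<bar>hm m * (\<Sum>z\<in>{0..<npts m}. \<psi> z * F (u s) z)\<bar> \<le> Cf * (Kp * KU) * \<epsilon> m / sqrt s"
      if s: "0 < s" "s \<le> r" and \<psi>: "\<And>z. \<bar>\<psi> z\<bar> \<le> Kp" for s \<psi>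
      using weak_error_F[OF m pu KU(2)[OF s, of m' "?n j", folded u_def] KU(3)[OF s, of m' "?n j", folded u_def]
          KU(4)[OF s, of m' "?n j", folded u_def] \<psi>]
      unfolding F_def Cf_def by (simp add: mult.assoc)
    have errH: "\<bar>hm m * (\<Sum>z\<in>{0..<npts m}. \<psi> z * H (u s) z)\<bar> \<le> Cw * (Kp * KU) * \<epsilon> m / sqrt s"
      if s: "0 < s" "s \<le> r" and \<psi>: "per (npts m) \<psi>" "\<And>z. \<bar>\<psi> z\<bar> \<le> Kp" "\<And>z. \<bar>fd (hm m) \<psi> z\<bar> \<le> Kp" for s \<psi>
      using weak_error_H[OF m pu KU(3)[OF s, of m' "?n j", folded u_def]
          KU(4)[OF s, of m' "?n j", folded u_def] \<psi>]
      unfolding H_def Cw_def by (simp add: mult.assoc)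
    have p\<phi>: "per (npts m) (\<lambda>z. aa m z * ?\<phi> k z s)" for k s by (rule per_mult[OF lev.per_a lev.pk_per2])
    have dD: "(D has_real_derivative D' s) (at s)" if s: "0 < s" "s < r" for s
    proof -
      \<comment> \<open>The divided fine equation is averaged; dividing by \<open>a\<close> is what
        leaves a bare Laplacian that the hat converts exactly.\<close>
      have gA: "hat ?q (\<lambda>n. gg m' n * lev.A m' (v s) n) (?n z)
          = lp (hm m) (\<lambda>z. v s (?n z)) z + hat ?q (\<lambda>n. bb m' n * cd (hm m') (v s) n) (?n z)" for z
      proof -
        have "gg m' n * lev.A m' (v s) n = lp (hm m') (v s) n + bb m' n * cd (hm m') (v s) n" for n
          using lev.a_nz[of m' n] by (simp add: gg_eq A_refine)
        then show ?thesis by (simp only: hat_add lp_restrict[OF R.q R.h'_pos R.h])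
      qed
      let ?R = "\<lambda>z. v s (?n z)"
      have "(D has_real_derivative hm m * (\<Sum>z\<in>{0..<npts m}.
          (- ?\<phi> (Suc k) z s * (aa m z * (hat ?q (\<lambda>n. gg m' n * v s n) (?n z) - H (u s) z))
           + (aa m z * (hat ?q (\<lambda>n. gg m' n * lev.A m' (v s) n) (?n z) - H (v s) z)) * ?\<phi> k z s)
          + (- ?\<phi> (Suc (Suc k)) z s * (aa m z * F (u s) z) + (aa m z * F (v s) z) * ?\<phi> (Suc k) z s))) (at s)"
        unfolding D_def
        by (intro DERIV_cmult DERIV_sum DERIV_add DERIV_mult DERIV_diff hat_deriv dv du dF dH d\<phi> s)
      also have "(\<Sum>z\<in>{0..<npts m}.
          (- ?\<phi> (Suc k) z s * (aa m z * (hat ?q (\<lambda>n. gg m' n * v s n) (?n z) - H (u s) z))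
           + (aa m z * (hat ?q (\<lambda>n. gg m' n * lev.A m' (v s) n) (?n z) - H (v s) z)) * ?\<phi> k z s)
          + (- ?\<phi> (Suc (Suc k)) z s * (aa m z * F (u s) z) + (aa m z * F (v s) z) * ?\<phi> (Suc k) z s))
        = (\<Sum>z\<in>{0..<npts m}. ((aa m z * ?\<phi> (Suc k) z s) * H (u s) z - (aa m z * ?\<phi> (Suc (Suc k)) z s) * F (u s) z)
            + (?\<phi> k z s * lev.A m ?R z - ?\<phi> (Suc k) z s * ?R z))"
      proof (rule sum.cong[OF refl])
        fix z
        have hF: "hat ?q (\<lambda>n. gg m' n * v s n) (?n z) = F (v s) z + ?R z / aa m z"
          unfolding F_def bq by simp
        have hH: "hat ?q (\<lambda>n. bb m' n * cd (hm m') (v s) n) (?n z) = H (v s) z + bb m z * cd (hm m) ?R z"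
          unfolding H_def bq by simp
        show "(- ?\<phi> (Suc k) z s * (aa m z * (hat ?q (\<lambda>n. gg m' n * v s n) (?n z) - H (u s) z))
           + (aa m z * (hat ?q (\<lambda>n. gg m' n * lev.A m' (v s) n) (?n z) - H (v s) z)) * ?\<phi> k z s)
          + (- ?\<phi> (Suc (Suc k)) z s * (aa m z * F (u s) z) + (aa m z * F (v s) z) * ?\<phi> (Suc k) z s)
          = ((aa m z * ?\<phi> (Suc k) z s) * H (u s) z - (aa m z * ?\<phi> (Suc (Suc k)) z s) * F (u s) z)
            + (?\<phi> k z s * lev.A m ?R z - ?\<phi> (Suc k) z s * ?R z)"
          unfolding gA hF hH unfolding A_refine using lev.a_nz[of m z] by (simp add: algebra_simps)
      qed
      also have "hm m * \<dots> = D' s"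
      proof -
        \<comment> \<open>The leading terms cancel: the coarse kernel solves the forward equation in
          the variable that is summed.\<close>
        have "(\<Sum>z\<in>{0..<npts m}. ?\<phi> k z s * lev.A m ?R z) = (\<Sum>z\<in>{0..<npts m}. lev.A' m (\<lambda>z. ?\<phi> k z s) z * ?R z)"
          by (rule lev.adjoint[OF lev.pk_per2 pv])
        also have "\<dots> = (\<Sum>z\<in>{0..<npts m}. ?\<phi> (Suc k) z s * ?R z)"
          using s r by (simp add: lev.pk_forward)
        finally show ?thesis unfolding D'_def sum.distrib sum_subtractf by (simp add: right_diff_distrib)
      qed
      finally show ?thesis .
    qed
    have bD: "\<bar>D' s\<bar> \<le> KD * \<epsilon> m / sqrt s" if s: "0 < s" "s < r" for s
    proof -
      have ts: "r \<le> t - s" "t - s \<le> t" and s': "s \<le> r" using s r by auto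
      have "\<bar>D' s\<bar> \<le> Cw * (Kp * KU) * \<epsilon> m / sqrt s + Cf * (Kp * KU) * \<epsilon> m / sqrt s"
        unfolding D'_def
        by (intro order_trans[OF abs_triangle_ineq4] add_mono errH errF s s' p\<phi> \<phi> ts)
      also have "\<dots> = KD * \<epsilon> m / sqrt s" unfolding KD_def by (simp only: distrib_right add_divide_distrib add.assoc)
      finally show ?thesis .
    qed
    have cD: "continuous_on {0..r} D"
      unfolding D_def
      by (intro continuous_on_mult continuous_on_add continuous_on_sum continuous_on_const
          continuous_on_diff hat_cont cv cu cF cH c\<phi>)
    have main: "\<bar>D r - D 0\<bar> \<le> 2 * (KD * \<epsilon> m) * sqrt r"
      using r by (intro sqrt_growth[OF _ cD dD bD]) auto
    \<comment> \<open>At time zero the corrections vanish with \<open>u\<close>, and the averaged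
      fine delta is the coarse delta, so the pairing evaluates the coarse kernel at \<open>j\<close>
      without error.\<close>
    have D0: "D 0 = lev.pk m k i j t"
    proof -
      have u0: "u 0 = (\<lambda>n. 0)" unfolding u_def by (rule ext) (rule U_0)
      have FH: "F (u 0) z = 0" "H (u 0) z = 0" for z
        unfolding F_def H_def u0 by (simp_all add: hat_def sdiff2_def cd_def)
      \<comment> \<open>The delta only sees points congruent to its centre, where periodicity gives
        the coefficient the same value; it can then be pulled out of the average.\<close>
      have vg: "gg m' n * v 0 n = unit_at (int ?q * npts m) (hm m') (?n j) n * gg m' (?n j)" for n
      proof -
        have v0: "v 0 n = unit_at (npts m') (hm m') (?n j) n" unfolding v_def by (rule lev.p_0)
        show ?thesis
        proof (cases "npts m' dvd n - ?n j")
          case True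
          then obtain l where l: "n - ?n j = npts m' * l" by (auto elim: dvdE)
          have "per (npts m') (gg m')" using lev.per_a[of m'] by (simp add: per_def gg_eq)
          then have "gg m' (?n j + npts m' * l) = gg m' (?n j)" by (rule per_mult_int)
          moreover have "?n j + npts m' * l = n" using l by simp
          ultimately show ?thesis unfolding v0 npts_refine[OF m] by simp
        qed (simp add: v0 npts_refine[OF m] unit_at_def del: of_nat_power)
      qed
      have "hat ?q (\<lambda>n. gg m' n * v 0 n) (?n z) = unit_at (npts m) (hm m) j z / aa m j" for z
        unfolding vg hat_scale hat_unit_at[OF R.q npts_ge2 R.h'_pos R.h] bq by simp
      then have "D 0 = hm m * (\<Sum>z\<in>{0..<npts m}. unit_at (npts m) (hm m) j z * (aa m z * ?\<phi> k z 0 / aa m j))"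
        unfolding D_def FH by (simp add: mult_ac)
      also have "\<dots> = hm m * (aa m j * ?\<phi> k j 0 / aa m j / hm m)"
        by (subst psum_unit_at[OF npts_pos per_comp1[OF p\<phi>]]) simp
      also have "\<dots> = lev.pk m k i j t" using hm_pos[of m] lev.a_nz[of m j] by simp
      finally show ?thesis .
    qed
    \<comment> \<open>At time \<open>r\<close> the fine kernel has bounded second differences, so
      its average can be replaced by its values (cost \<open>Cs\<close>), and the corrections are
      bounded as before.\<close>
    have Dr: "\<bar>D r - hm m * (\<Sum>z\<in>{0..<npts m}. lev.pk m k i z r * v r (?n z))\<bar> \<le> Cs * \<epsilon> m + KD * \<epsilon> m / sqrt r"
    proof -
      let ?\<rho> = "\<lambda>z. hat ?q (\<lambda>n. gg m' n * v r n) (?n z) - gg m' (?n z) * v r (?n z)"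
      have \<rho>: "\<bar>?\<rho> z\<bar> \<le> (2 * M + 3) * K5 * Ke * \<epsilon> m" for z
      proof -
        have "\<bar>?\<rho> z\<bar> \<le> (2 * M * (hm m)\<^sup>2 + e2 m + 2 * e1 m * hm m) * K5"
          using K5(2)[of m' _ "?n j"] unfolding v_def by (intro R.hat_prod_sup[OF osc_g[OF m]]) auto
        also have "\<dots> = K5 * (2 * M * (hm m)\<^sup>2 + e2 m + 2 * (hm m * e1 m))" by (simp add: algebra_simps)
        also have "\<dots> \<le> K5 * (2 * M * (Ke * \<epsilon> m) + Ke * \<epsilon> m + 2 * (Ke * \<epsilon> m))"
          using K5(1) M_nonneg by (intro mult_left_mono add_mono h2_le e2_le e1_le) auto
        also have "\<dots> = (2 * M + 3) * K5 * Ke * \<epsilon> m" by (simp add: algebra_simps)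
        finally show ?thesis .
      qed
      have rr: "r \<le> t - r" "t - r \<le> t" using r by auto
      have eqD: "D r - hm m * (\<Sum>z\<in>{0..<npts m}. lev.pk m k i z r * v r (?n z))
        = hm m * (\<Sum>z\<in>{0..<npts m}. (aa m z * ?\<phi> k z r) * ?\<rho> z)
          - hm m * (\<Sum>z\<in>{0..<npts m}. (aa m z * ?\<phi> k z r) * H (u r) z)
          + hm m * (\<Sum>z\<in>{0..<npts m}. (aa m z * ?\<phi> (Suc k) z r) * F (u r) z)"
      proof -
        let ?l = "\<lambda>z. ?\<phi> k z r * (aa m z * (hat ?q (\<lambda>n. gg m' n * v r n) (?n z) - H (u r) z))
            + ?\<phi> (Suc k) z r * (aa m z * F (u r) z)"
        have eq: "?l z - lev.pk m k i z r * v r (?n z)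
          = (aa m z * ?\<phi> k z r) * ?\<rho> z - (aa m z * ?\<phi> k z r) * H (u r) z + (aa m z * ?\<phi> (Suc k) z r) * F (u r) z" for z
          unfolding bq r(3) using lev.a_nz[of m z] by (simp add: algebra_simps)
        have "D r - hm m * (\<Sum>z\<in>{0..<npts m}. lev.pk m k i z r * v r (?n z))
          = hm m * (\<Sum>z\<in>{0..<npts m}. ?l z - lev.pk m k i z r * v r (?n z))"
          by (simp only: D_def sum_subtractf right_diff_distrib)
        also have "\<dots> = hm m * (\<Sum>z\<in>{0..<npts m}. (aa m z * ?\<phi> k z r) * ?\<rho> z
            - (aa m z * ?\<phi> k z r) * H (u r) z + (aa m z * ?\<phi> (Suc k) z r) * F (u r) z)"
          by (simp only: eq)
        also have "\<dots> = hm m * (\<Sum>z\<in>{0..<npts m}. (aa m z * ?\<phi> k z r) * ?\<rho> z)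
          - hm m * (\<Sum>z\<in>{0..<npts m}. (aa m z * ?\<phi> k z r) * H (u r) z)
          + hm m * (\<Sum>z\<in>{0..<npts m}. (aa m z * ?\<phi> (Suc k) z r) * F (u r) z)"
          unfolding sum.distrib sum_subtractf distrib_left right_diff_distrib[of "hm m"] ..
        finally show ?thesis .
      qed
      have "\<bar>D r - hm m * (\<Sum>z\<in>{0..<npts m}. lev.pk m k i z r * v r (?n z))\<bar>
          \<le> Cs * \<epsilon> m + Cw * (Kp * KU) * \<epsilon> m / sqrt r + Cf * (Kp * KU) * \<epsilon> m / sqrt r"
      proof -
        have "\<bar>hm m * (\<Sum>z\<in>{0..<npts m}. (aa m z * ?\<phi> k z r) * ?\<rho> z)\<bar>
          \<le> hm m * (\<Sum>z\<in>{0..<npts m}. a1 * K0 * ((2 * M + 3) * K5 * Ke * \<epsilon> m))"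
          unfolding abs_mult[of "hm m"] abs_of_pos[OF hm_pos]
        proof (intro mult_left_mono order_trans[OF sum_abs sum_mono])
          fix z
          have "\<bar>?\<phi> k z r\<bar> \<le> K0" using K0(2)[OF rr] .
          then show "\<bar>(aa m z * ?\<phi> k z r) * ?\<rho> z\<bar> \<le> a1 * K0 * ((2 * M + 3) * K5 * Ke * \<epsilon> m)"
            unfolding abs_mult[of "aa m z * ?\<phi> k z r"] abs_mult[of "aa m z"]
            using \<rho>[of z] lev.a_le[of m z] lev.a_pos[of m z] lev.a1_pos K0(1) by (intro mult_mono) auto
        qed (simp add: less_imp_le[OF hm_pos])
        also have "\<dots> = Cs * \<epsilon> m" unfolding R.h_psum_const Cs_def by simp
        finally have 1: "\<bar>hm m * (\<Sum>z\<in>{0..<npts m}. (aa m z * ?\<phi> k z r) * ?\<rho> z)\<bar> \<le> Cs * \<epsilon> m" .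
        have 2: "\<bar>hm m * (\<Sum>z\<in>{0..<npts m}. (aa m z * ?\<phi> k z r) * H (u r) z)\<bar> \<le> Cw * (Kp * KU) * \<epsilon> m / sqrt r"
          by (intro errH r p\<phi> \<phi> rr order_refl)
        have 3: "\<bar>hm m * (\<Sum>z\<in>{0..<npts m}. (aa m z * ?\<phi> (Suc k) z r) * F (u r) z)\<bar> \<le> Cf * (Kp * KU) * \<epsilon> m / sqrt r"
          by (intro errF r \<phi> rr order_refl)
        have lin: "\<bar>x - y + z\<bar> \<le> a + b + c" if "\<bar>x\<bar> \<le> a" "\<bar>y\<bar> \<le> b" "\<bar>z\<bar> \<le> c" for x y z a b c :: real
          using that by linarith
        show ?thesis unfolding eqD by (rule lin[OF 1 2 3])
      qed
      also have "\<dots> = Cs * \<epsilon> m + KD * \<epsilon> m / sqrt r"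
        unfolding KD_def by (simp only: distrib_right add_divide_distrib add.assoc)
      finally show ?thesis .
    qed
    have "\<bar>hm m * (\<Sum>z\<in>{0..<npts m}. lev.pk m k i z r * v r (?n z)) - lev.pk m k i j t\<bar>
      \<le> 2 * (KD * \<epsilon> m) * sqrt r + (Cs * \<epsilon> m + KD * \<epsilon> m / sqrt r)"
      using main Dr unfolding D0 by linarith
    also have "\<dots> = (2 * KD * sqrt r + Cs + KD / sqrt r) * \<epsilon> m" by (simp add: algebra_simps)
    finally show "\<bar>hm m * (\<Sum>z\<in>{0..<npts m}. lev.pk m k i z (t / 2) * p m' (?n z) (?n j) (t / 2))
       - lev.pk m k i j t\<bar> \<le> (2 * KD * sqrt r + Cs + KD / sqrt r) * \<epsilon> m"
      unfolding v_def r_def .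
  qed
qed

text \<open>Both kernels are compared with the composition of the coarse kernel up to
  \<open>t / 2\<close> with the fine kernel afterwards. For the time derivative, one comparison
  differentiates the coarse factor and the other the fine factor; the two compositions differ by a
  truncation error.\<close>

lemma kernel_convergence:
  assumes t: "0 < t"
  shows "\<exists>K\<ge>0. \<forall>m m' i j. m \<le> m' \<longrightarrow>
    \<bar>p m i j t - p m' (int (2 ^ (m' - m)) * i) (int (2 ^ (m' - m)) * j) t\<bar> \<le> K * \<epsilon> m \<and>
    \<bar>lev.pk m 1 i j t - lev.pk m' 1 (int (2 ^ (m' - m)) * i) (int (2 ^ (m' - m)) * j) t\<bar> \<le> K * \<epsilon> m"
proof -
  define r where "r = t / 2"
  have r: "0 < r" "r \<le> t" using t unfolding r_def by auto
  let ?q = "\<lambda>m m'. int (2 ^ (m' - m))"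
  obtain F0 where F0: "0 \<le> F0" "\<And>m m' i j. m \<le> m' \<Longrightarrow>
    \<bar>hm m * (\<Sum>z\<in>{0..<npts m}. p m i z r * p m' (?q m m' * z) (?q m m' * j) r) - p m i j t\<bar> \<le> F0 * \<epsilon> m"
    using first_half[OF t, of 0] unfolding lev.pk_0 r_def by blast
  obtain F1 where F1: "0 \<le> F1" "\<And>m m' i j. m \<le> m' \<Longrightarrow>
    \<bar>hm m * (\<Sum>z\<in>{0..<npts m}. lev.pk m 1 i z r * p m' (?q m m' * z) (?q m m' * j) r) - lev.pk m 1 i j t\<bar> \<le> F1 * \<epsilon> m"
    using first_half[OF t, of 1] unfolding r_def by blast
  obtain S0 where S0: "0 \<le> S0" "\<And>m m' i j. m \<le> m' \<Longrightarrow>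
    \<bar>hm m * (\<Sum>z\<in>{0..<npts m}. p m i z r * p m' (?q m m' * z) j r) - p m' (?q m m' * i) j t\<bar> \<le> S0 * \<epsilon> m"
    using second_half[OF t, of 0] unfolding lev.pk_0 r_def by blast
  obtain S1 where S1: "0 \<le> S1" "\<And>m m' i j. m \<le> m' \<Longrightarrow>
    \<bar>hm m * (\<Sum>z\<in>{0..<npts m}. p m i z r * lev.pk m' 1 (?q m m' * z) j r) - lev.pk m' 1 (?q m m' * i) j t\<bar> \<le> S1 * \<epsilon> m"
    using second_half[OF t, of 1] unfolding r_def by blast
  obtain Kt where Kt: "0 \<le> Kt" "\<And>m m' j i. m \<le> m' \<Longrightarrow>
    \<bar>lev.A m (\<lambda>i. p m' (?q m m' * i) j r) i - lev.pk m' 1 (?q m m' * i) j r\<bar> \<le> Kt * \<epsilon> m"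
    using truncation_bound[OF r(1), of r 0] unfolding lev.pk_0 by (auto simp del: of_nat_power)
  obtain Kl where Kl: "0 \<le> Kl" "\<And>m i. mesh L m * (\<Sum>z\<in>{0..<npts m}. \<bar>p m i z r\<bar>) \<le> Kl / sqrt r"
    using forward_l1_bound[OF r(1)] r(1) by blast
  have nn: "0 \<le> Kl / sqrt r * Kt" using Kl(1) Kt(1) r by simp
  show ?thesis
  proof (intro exI[of _ "F0 + S0 + (F1 + S1 + Kl / sqrt r * Kt)"] conjI allI impI)
    show "0 \<le> F0 + S0 + (F1 + S1 + Kl / sqrt r * Kt)" using F0(1) F1(1) S0(1) S1(1) nn by linarith
    fix m m' :: nat and i j assume m: "m \<le> m'"
    let ?n = "\<lambda>z. ?q m m' * z"
    have "\<bar>p m i j t - p m' (?n i) (?n j) t\<bar> \<le> F0 * \<epsilon> m + S0 * \<epsilon> m"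
      using F0(2)[OF m, of i j] S0(2)[OF m, of i "?n j"] by linarith
    also have "\<dots> \<le> (F0 + S0 + (F1 + S1 + Kl / sqrt r * Kt)) * \<epsilon> m"
      unfolding distrib_right[symmetric] using F1(1) S1(1) nn by (intro mult_right_mono) auto
    finally show "\<bar>p m i j t - p m' (?n i) (?n j) t\<bar> \<le> (F0 + S0 + (F1 + S1 + Kl / sqrt r * Kt)) * \<epsilon> m" .
    let ?R = "\<lambda>z. p m' (?n z) (?n j) r"
    have pR: "per (npts m) ?R"
      using perD[OF lev.p_per1[of m' "?n j" r]] by (simp add: per_def distrib_left npts_refine[OF m] del: of_nat_power)
    \<comment> \<open>The time derivative of the coarse factor is a forward operator, which
      adjointness passes to the fine factor.\<close>
    have "(\<Sum>z\<in>{0..<npts m}. lev.pk m 1 i z r * ?R z) = (\<Sum>z\<in>{0..<npts m}. lev.A' m (\<lambda>z. p m i z r) z * ?R z)"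
      using lev.pk_forward[of r m 0 i] r by (simp add: lev.pk_0)
    also have "\<dots> = (\<Sum>z\<in>{0..<npts m}. p m i z r * lev.A m ?R z)"
      by (rule lev.adjoint[OF lev.p_per2 pR, symmetric])
    finally have eq: "hm m * (\<Sum>z\<in>{0..<npts m}. lev.pk m 1 i z r * ?R z)
        - hm m * (\<Sum>z\<in>{0..<npts m}. p m i z r * lev.pk m' 1 (?n z) (?n j) r)
      = hm m * (\<Sum>z\<in>{0..<npts m}. p m i z r * (lev.A m ?R z - lev.pk m' 1 (?n z) (?n j) r))"
      by (simp add: right_diff_distrib sum_subtractf)
    have "hm m * (\<Sum>z\<in>{0..<npts m}. \<bar>p m i z r\<bar> * (Kt * \<epsilon> m)) \<le> Kl / sqrt r * (Kt * \<epsilon> m)"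
      unfolding sum_distrib_right[symmetric] mult.assoc[symmetric]
      using Kt(1) by (intro mult_right_mono Kl(2)) auto
    moreover have "\<bar>hm m * (\<Sum>z\<in>{0..<npts m}. p m i z r * (lev.A m ?R z - lev.pk m' 1 (?n z) (?n j) r))\<bar>
        \<le> hm m * (\<Sum>z\<in>{0..<npts m}. \<bar>p m i z r\<bar> * (Kt * \<epsilon> m))"
      unfolding abs_mult[of "hm m"] abs_of_pos[OF hm_pos]
    proof (intro mult_left_mono order_trans[OF sum_abs sum_mono])
      show "\<bar>p m i z r * (lev.A m ?R z - lev.pk m' 1 (?n z) (?n j) r)\<bar> \<le> \<bar>p m i z r\<bar> * (Kt * \<epsilon> m)" for z
        unfolding abs_mult by (intro mult_left_mono Kt(2)[OF m]) simp
    qed (simp add: less_imp_le[OF hm_pos])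
    ultimately have link: "\<bar>hm m * (\<Sum>z\<in>{0..<npts m}. lev.pk m 1 i z r * ?R z)
        - hm m * (\<Sum>z\<in>{0..<npts m}. p m i z r * lev.pk m' 1 (?n z) (?n j) r)\<bar> \<le> Kl / sqrt r * Kt * \<epsilon> m"
      unfolding eq by simp
    have "\<bar>lev.pk m 1 i j t - lev.pk m' 1 (?n i) (?n j) t\<bar> \<le> F1 * \<epsilon> m + S1 * \<epsilon> m + Kl / sqrt r * Kt * \<epsilon> m"
      using F1(2)[OF m, of i j] S1(2)[OF m, of i "?n j"] link by linarith
    also have "\<dots> \<le> (F0 + S0 + (F1 + S1 + Kl / sqrt r * Kt)) * \<epsilon> m"
      unfolding distrib_right[symmetric] using F0(1) S0(1) by (intro mult_right_mono) auto
    finally show "\<bar>lev.pk m 1 i j t - lev.pk m' 1 (?n i) (?n j) t\<bar> \<le> (F0 + S0 + (F1 + S1 + Kl / sqrt r * Kt)) * \<epsilon> m" .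
  qed
qed

end

section \<open>Regularity of the coefficients and translation to the circle\<close>

lemma powr_le_scale:
  assumes "0 \<le> d" "d \<le> L" "\<beta> \<le> \<alpha>"
  shows "(d::real) powr \<alpha> \<le> L powr (\<alpha> - \<beta>) * d powr \<beta>"
proof (cases "d = 0")
  case False
  have "d powr \<alpha> = d powr (\<alpha> - \<beta>) * d powr \<beta>" by (simp flip: powr_add)
  also have "\<dots> \<le> L powr (\<alpha> - \<beta>) * d powr \<beta>" using assms by (intro mult_right_mono powr_mono2) auto
  finally show ?thesis .
qed simp

lemma smooth_boundI:
  assumes 1: "\<And>x d. 0 \<le> d \<Longrightarrow> d \<le> L \<Longrightarrow> \<bar>f (x + d) - f x\<bar> \<le> C1 * d powr min 1 \<gamma>"
    and 2: "\<And>x d. 0 \<le> d \<Longrightarrow> d \<le> L \<Longrightarrow> \<bar>f (x + d) + f (x - d) - 2 * f x\<bar> \<le> C2 * d powr \<gamma>"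
  shows "\<exists>C\<ge>0. smooth_bound L \<gamma> C f"
proof -
  have "smooth_bound L \<gamma> (max 0 (max C1 C2)) f"
    unfolding smooth_bound_def
  proof (intro allI impI conjI)
    fix x d assume d: "0 \<le> d \<and> d \<le> L"
    show "\<bar>f (x + d) - f x\<bar> \<le> max 0 (max C1 C2) * d powr min 1 \<gamma>"
      by (rule order_trans[OF 1]) (use d in \<open>auto intro!: mult_right_mono\<close>)
    show "\<bar>f (x + d) + f (x - d) - 2 * f x\<bar> \<le> max 0 (max C1 C2) * d powr \<gamma>"
      by (rule order_trans[OF 2]) (use d in \<open>auto intro!: mult_right_mono\<close>)
  qed
  then show ?thesis by (intro exI[of _ "max 0 (max C1 C2)"]) auto
qed

text \<open>The mean value theorem on both sides of \<open>x\<close> writes the symmetric second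
  difference as \<open>d\<close> times a difference of derivatives at points at most
  \<open>2 * d\<close> apart.\<close>

lemma smooth_bound_C1:
  assumes d: "\<And>x. (f has_real_derivative f' x) (at x)" and b: "\<And>x. \<bar>f' x\<bar> \<le> K1"
    and h: "\<And>x y. \<bar>f' x - f' y\<bar> \<le> K * \<bar>x - y\<bar> powr \<alpha>"
    and \<alpha>: "0 < \<alpha>" "\<gamma> \<le> 1 + \<alpha>" and K: "0 \<le> K"
  shows "\<exists>C\<ge>0. smooth_bound L \<gamma> C f"
proof (rule smooth_boundI)
  have K1: "0 \<le> K1" using b[of 0] by linarith
  have mvt: "\<exists>z. x \<le> z \<and> z \<le> x + d \<and> f (x + d) - f x = d * f' z" if "0 \<le> d" for x d
  proof (cases "d = 0")
    case False
    then have "x < x + d" using that by simp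
    from MVT2[OF this, of f f'] d obtain z where "x < z" "z < x + d" "f (x + d) - f x = (x + d - x) * f' z" by blast
    then show ?thesis by (intro exI[of _ z]) auto
  qed auto
  fix x d assume D: "0 \<le> d" "d \<le> L"
  show "\<bar>f (x + d) - f x\<bar> \<le> K1 * L powr (1 - min 1 \<gamma>) * d powr min 1 \<gamma>"
  proof -
    obtain z where "f (x + d) - f x = d * f' z" using mvt[OF D(1), of x] by blast
    then have "\<bar>f (x + d) - f x\<bar> = d * \<bar>f' z\<bar>" using D by (simp add: abs_mult)
    also have "\<dots> \<le> d * K1" using D b by (intro mult_left_mono) auto
    also have "\<dots> = K1 * d powr 1" using D by simp
    also have "\<dots> \<le> K1 * (L powr (1 - min 1 \<gamma>) * d powr min 1 \<gamma>)"
      using K1 D by (intro mult_left_mono powr_le_scale) auto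
    finally show ?thesis by simp
  qed
  show "\<bar>f (x + d) + f (x - d) - 2 * f x\<bar> \<le> K * 2 powr \<alpha> * L powr (1 + \<alpha> - \<gamma>) * d powr \<gamma>"
  proof -
    obtain z where z: "x \<le> z" "z \<le> x + d" "f (x + d) - f x = d * f' z" using mvt[OF D(1), of x] by blast
    obtain w where w: "x - d \<le> w" "w \<le> x" "f x - f (x - d) = d * f' w" using mvt[OF D(1), of "x - d"] by auto
    have "f (x + d) + f (x - d) - 2 * f x = d * (f' z - f' w)" using z(3) w(3) by (simp add: algebra_simps)
    then have "\<bar>f (x + d) + f (x - d) - 2 * f x\<bar> = d * \<bar>f' z - f' w\<bar>" using D by (simp add: abs_mult)
    also have "\<dots> \<le> d * (K * (2 * d) powr \<alpha>)"
    proof (intro mult_left_mono D order_trans[OF h] K powr_mono2)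
      show "\<bar>z - w\<bar> \<le> 2 * d" using z w by linarith
    qed (use \<alpha> in auto)
    also have "\<dots> = K * 2 powr \<alpha> * (d powr 1 * d powr \<alpha>)" using D by (simp add: powr_mult mult_ac)
    also have "\<dots> = K * 2 powr \<alpha> * d powr (1 + \<alpha>)" unfolding powr_add ..
    also have "\<dots> \<le> K * 2 powr \<alpha> * (L powr (1 + \<alpha> - \<gamma>) * d powr \<gamma>)"
      using K D \<alpha> by (intro mult_left_mono powr_le_scale) auto
    finally show ?thesis by simp
  qed
qed

lemma periodic_iff: "periodic_fun_simple f T \<longleftrightarrow> (\<forall>x. f (x + T) = f (x::real))"
  by (simp add: periodic_fun_simple_def)

lemma periodic_int:
  assumes "periodic_fun_simple f (T::real)"
  shows "f (x + T * of_int n) = f x"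
proof -
  interpret periodic_fun_simple f T by (rule assms)
  show ?thesis using plus_of_int[of x n] by (simp add: mult.commute)
qed

lemma periodic_continuous_bounds:
  fixes f :: "real \<Rightarrow> real"
  assumes T: "0 < T" and p: "periodic_fun_simple f T" and c: "continuous_on UNIV f"
  shows "\<exists>x y. \<forall>z. f x \<le> f z \<and> f z \<le> (f y :: real)"
proof -
  have red: "\<exists>w\<in>{0..T}. f z = f w" for z
  proof
    let ?n = "\<lfloor>z / T\<rfloor>"
    have "T * of_int ?n \<le> z" "z < T * (of_int ?n + 1)"
      using T floor_correct[of "z / T"] by (simp_all only: pos_le_divide_eq pos_divide_less_eq of_int_add of_int_1 mult.commute[of T])
    then show "z + T * of_int (- ?n) \<in> {0..T}" by (simp add: distrib_left)
    show "f z = f (z + T * of_int (- ?n))" using periodic_int[OF p, of z "- ?n"] by simp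
  qed
  have c': "continuous_on {0..T} f" using c by (rule continuous_on_subset) auto
  obtain x where x: "\<And>z. z \<in> {0..T} \<Longrightarrow> f x \<le> f z"
    using continuous_attains_inf[OF compact_Icc _ c'] T by fastforce
  obtain y where y: "\<And>z. z \<in> {0..T} \<Longrightarrow> f z \<le> f y"
    using continuous_attains_sup[OF compact_Icc _ c'] T by fastforce
  have "f x \<le> f z \<and> f z \<le> f y" for z using red[of z] x y by auto
  then show ?thesis by blast
qed

lemma periodic_continuous_abs_bound:
  fixes f :: "real \<Rightarrow> real"
  assumes "0 < T" "periodic_fun_simple f T" "continuous_on UNIV f"
  shows "\<exists>K\<ge>0. \<forall>z. \<bar>f z\<bar> \<le> (K::real)"
proof -
  obtain x y where "\<And>z. f x \<le> f z \<and> f z \<le> f y" using periodic_continuous_bounds[OF assms] by blast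
  then have "\<bar>f z\<bar> \<le> max \<bar>f x\<bar> \<bar>f y\<bar>" for z by (smt (verit))
  then show ?thesis by (intro exI[of _ "max \<bar>f x\<bar> \<bar>f y\<bar>"]) auto
qed

lemma deriv_periodic:
  assumes "periodic_fun_simple f (T::real)"
  shows "periodic_fun_simple (deriv f) T"
proof -
  have "(\<lambda>x. f (x + T)) = f" using assms by (auto simp: periodic_iff)
  then have "(f has_field_derivative D) (at (x + T)) \<longleftrightarrow> (f has_field_derivative D) (at x)" for x D
    using DERIV_shift[of f D x T] by simp
  then show ?thesis unfolding periodic_iff deriv_def by simp
qed

lemma Holder_space_continuous:
  assumes "f \<in> Holder_space L k \<alpha>"
  shows "continuous_on UNIV f"
proof (cases k)
  case 0
  then show ?thesis using assms by (simp add: Holder_space_def)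
next
  case (Suc n)
  then have "\<forall>x. f field_differentiable at x" using assms by (force simp: Holder_space_def)
  then show ?thesis by (simp add: continuous_on_eq_continuous_at field_differentiable_imp_continuous_at)
qed

text \<open>For \<open>k = 0\<close> the triangle inequality is enough, and \<open>k = 1\<close> is
  the mean value argument. For larger \<open>k\<close> the cap \<gamma> \<le> 2 makes a Lipschitz
  derivative sufficient, with exponent 1 in place of \<alpha>. Periodicity bounds the continuous
  derivatives.\<close>

lemma Holder_space_smooth_bound:
  assumes L: "0 < L" and f: "f \<in> Holder_space L k \<alpha>" and \<alpha>: "0 < \<alpha>" "\<alpha> \<le> 1"
    and \<gamma>: "0 < \<gamma>" "\<gamma> \<le> 2" "\<gamma> \<le> real k + \<alpha>"
  shows "\<exists>C\<ge>0. smooth_bound L \<gamma> C f"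
proof -
  have per: "periodic_fun_simple f (2 * L)" using f by (simp add: Holder_space_def)
  have diff: "\<And>i x. i < k \<Longrightarrow> (deriv ^^ i) f field_differentiable at x" using f by (simp add: Holder_space_def)
  have cont: "continuous_on UNIV ((deriv ^^ k) f)" using f by (simp add: Holder_space_def)
  obtain c where c: "0 < c" "\<And>x y. \<bar>(deriv ^^ k) f x - (deriv ^^ k) f y\<bar> \<le> c * per_dist L x y powr \<alpha>"
    using f by (auto simp: Holder_space_def)
  have hold: "\<bar>(deriv ^^ k) f x - (deriv ^^ k) f y\<bar> \<le> c * \<bar>x - y\<bar> powr \<alpha>" for x y
  proof -
    have "0 \<le> per_dist L x y" using per_dist_attained(1)[OF L, of x y] by auto
    moreover have "per_dist L x y \<le> \<bar>x - y\<bar>" using per_dist_attained(2)[OF L, of x y 0] by simp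
    ultimately have "per_dist L x y powr \<alpha> \<le> \<bar>x - y\<bar> powr \<alpha>" using \<alpha> by (intro powr_mono2) auto
    then show ?thesis using c(1) by (intro order_trans[OF c(2)] mult_left_mono) auto
  qed
  have per_d: "periodic_fun_simple ((deriv ^^ i) f) (2 * L)" for i
    by (induction i) (auto intro: per deriv_periodic)
  show ?thesis
  proof (cases "k = 0")
    case True
    then have m: "min 1 \<gamma> = \<gamma>" using \<gamma> \<alpha> by (simp add: min_def)
    have h: "\<bar>f x - f y\<bar> \<le> c * \<bar>x - y\<bar> powr \<alpha>" for x y using hold[of x y] True by simp
    have s: "c * d powr \<alpha> \<le> c * L powr (\<alpha> - \<gamma>) * d powr \<gamma>" if "0 \<le> d" "d \<le> L" for d
      using mult_left_mono[OF powr_le_scale[of d L \<gamma> \<alpha>], of c] that c(1) \<gamma> True by simp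
    show ?thesis
    proof (rule smooth_boundI)
      fix x d assume d: "0 \<le> d" "d \<le> L"
      show "\<bar>f (x + d) - f x\<bar> \<le> c * L powr (\<alpha> - \<gamma>) * d powr min 1 \<gamma>"
        unfolding m using h[of "x + d" x] s[OF d] d by simp
      show "\<bar>f (x + d) + f (x - d) - 2 * f x\<bar> \<le> 2 * (c * L powr (\<alpha> - \<gamma>)) * d powr \<gamma>"
        using h[of "x + d" x] h[of x "x - d"] s[OF d] d by simp
    qed
  next
    case False
    then have k: "0 < k" by simp
    have d1: "(f has_real_derivative deriv f x) (at x)" for x
      using diff[OF k, of x] by (simp add: DERIV_deriv_iff_field_differentiable)
    show ?thesis
    proof (cases "k = 1")
      case True
      then have df: "(deriv ^^ k) f = deriv f" by simp
      obtain K1 where K1: "\<And>x. \<bar>deriv f x\<bar> \<le> K1"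
        using periodic_continuous_abs_bound[of "2 * L" "deriv f"] L per_d[of 1] cont df by auto
      show ?thesis
        by (rule smooth_bound_C1[OF d1 K1 hold[unfolded df]]) (use c(1) \<alpha> \<gamma> True in auto)
    next
      case False
      then have k2: "2 \<le> k" using k by simp
      have d2: "(deriv f has_real_derivative deriv (deriv f) x) (at x)" for x
        using diff[of 1 x] k2 by (simp add: DERIV_deriv_iff_field_differentiable)
      have c1: "continuous_on UNIV (deriv f)"
        using d2 by (meson DERIV_continuous_on has_field_derivative_at_within)
      have c2: "continuous_on UNIV (deriv (deriv f))"
      proof (cases "k = 2")
        case True
        then show ?thesis using cont by (simp add: numeral_2_eq_2)
      next
        case False
        then have "deriv (deriv f) field_differentiable at x" for x using diff[of 2 x] k2 by (simp add: numeral_2_eq_2)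
        then show ?thesis by (simp add: continuous_on_eq_continuous_at field_differentiable_imp_continuous_at)
      qed
      obtain K1 where K1: "\<And>x. \<bar>deriv f x\<bar> \<le> K1"
        using periodic_continuous_abs_bound[of "2 * L" "deriv f"] L per_d[of 1] c1 by auto
      obtain K2 where K2: "0 \<le> K2" "\<And>x. \<bar>deriv (deriv f) x\<bar> \<le> K2"
        using periodic_continuous_abs_bound[of "2 * L" "deriv (deriv f)"] L per_d[of 2] c2
        by (auto simp: numeral_2_eq_2)
      have lip: "\<bar>deriv f x - deriv f y\<bar> \<le> K2 * \<bar>x - y\<bar> powr 1" for x y
        using field_differentiable_bound[of UNIV "deriv f" "deriv (deriv f)" K2 y x] d2 K2(2)
        by (simp add: abs_minus_commute)
      show ?thesis by (rule smooth_bound_C1[OF d1 K1 lip]) (use K2(1) \<gamma> in auto)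
    qed
  qed
qed

lemma smooth_bound_cmult:
  assumes "smooth_bound L \<gamma> C f"
  shows "\<exists>C\<ge>0. smooth_bound L \<gamma> C (\<lambda>x. c * f x)"
proof (rule smooth_boundI)
  fix x d :: real assume d: "0 \<le> d" "d \<le> L"
  have "\<bar>c * (f (x + d) - f x)\<bar> \<le> \<bar>c\<bar> * (C * d powr min 1 \<gamma>)"
    unfolding abs_mult using assms d by (intro mult_left_mono) (auto simp: smooth_bound_def)
  then show "\<bar>c * f (x + d) - c * f x\<bar> \<le> \<bar>c\<bar> * C * d powr min 1 \<gamma>" by (simp add: right_diff_distrib)
  have "\<bar>c * (f (x + d) + f (x - d) - 2 * f x)\<bar> \<le> \<bar>c\<bar> * (C * d powr \<gamma>)"
    unfolding abs_mult using assms d by (intro mult_left_mono) (auto simp: smooth_bound_def)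
  then show "\<bar>c * f (x + d) + c * f (x - d) - 2 * (c * f x)\<bar> \<le> \<bar>c\<bar> * C * d powr \<gamma>"
    by (simp add: algebra_simps)
qed

lemma smooth_boundD:
  assumes "smooth_bound L \<gamma> C f" "0 \<le> d" "d \<le> L"
  shows "\<bar>f (x + d) - f x\<bar> \<le> C * d powr min 1 \<gamma>" "\<bar>f (x - d) - f x\<bar> \<le> C * d powr min 1 \<gamma>"
    "\<bar>f (x + d) + f (x - d) - 2 * f x\<bar> \<le> C * d powr \<gamma>"
proof -
  have "\<bar>f (x - d + d) - f (x - d)\<bar> \<le> C * d powr min 1 \<gamma>" using assms unfolding smooth_bound_def by blast
  then show "\<bar>f (x - d) - f x\<bar> \<le> C * d powr min 1 \<gamma>" by (simp add: abs_minus_commute)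
qed (use assms in \<open>auto simp: smooth_bound_def\<close>)

text \<open>Since \<gamma> \<le> 2, twice the exponent of a first difference is at least \<gamma>:
  products of two increments are as small as a second difference. This keeps the class stable under
  products and reciprocals.\<close>

lemma sq_powr_le:
  assumes "0 \<le> d" "d \<le> L" "\<gamma> \<le> 2" "0 < \<gamma>"
  shows "(d::real) powr min 1 \<gamma> * d powr min 1 \<gamma> \<le> L powr (2 * min 1 \<gamma> - \<gamma>) * d powr \<gamma>"
  using powr_le_scale[of d L \<gamma> "2 * min 1 \<gamma>"] assms by (simp flip: powr_add add: min_def split: if_splits)

lemma smooth_bound_mult:
  assumes f: "smooth_bound L \<gamma> C1 f" "\<And>x. \<bar>f x\<bar> \<le> F" and g: "smooth_bound L \<gamma> C2 g" "\<And>x. \<bar>g x\<bar> \<le> G"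
    and \<gamma>: "0 < \<gamma>" "\<gamma> \<le> 2" and C: "0 \<le> C1" "0 \<le> C2"
  shows "\<exists>C\<ge>0. smooth_bound L \<gamma> C (\<lambda>x. f x * g x)"
proof (rule smooth_boundI)
  have F: "0 \<le> F" using f(2)[of 0] by linarith
  have G: "0 \<le> G" using g(2)[of 0] by linarith
  fix x d assume d: "0 \<le> d" "d \<le> L"
  let ?D = "d powr min 1 \<gamma>"
  note fd = smooth_boundD[OF f(1) d, of x] and gd = smooth_boundD[OF g(1) d, of x]
  have e: "f (x + d) * g (x + d) - f x * g x = f (x + d) * (g (x + d) - g x) + (f (x + d) - f x) * g x"
    by (simp add: algebra_simps)
  have "\<bar>f (x + d) * g (x + d) - f x * g x\<bar> \<le> \<bar>f (x + d) * (g (x + d) - g x)\<bar> + \<bar>(f (x + d) - f x) * g x\<bar>"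
    unfolding e by (rule abs_triangle_ineq)
  also have "\<dots> \<le> F * (C2 * ?D) + C1 * ?D * G"
    unfolding abs_mult using fd gd f(2) g(2) C F by (intro add_mono mult_mono) auto
  finally show "\<bar>f (x + d) * g (x + d) - f x * g x\<bar> \<le> (F * C2 + C1 * G) * ?D" by (simp add: algebra_simps)
  let ?S = "L powr (2 * min 1 \<gamma> - \<gamma>)"
  have cross: "\<bar>(f y - f x) * (g y - g x)\<bar> \<le> C1 * C2 * (?S * d powr \<gamma>)"
    if "\<bar>f y - f x\<bar> \<le> C1 * ?D" "\<bar>g y - g x\<bar> \<le> C2 * ?D" for y
  proof -
    have "\<bar>(f y - f x) * (g y - g x)\<bar> \<le> (C1 * ?D) * (C2 * ?D)"
      unfolding abs_mult using that C by (intro mult_mono) auto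
    also have "\<dots> = C1 * C2 * (?D * ?D)" by simp
    also have "\<dots> \<le> C1 * C2 * (?S * d powr \<gamma>)" using C d \<gamma> by (intro mult_left_mono sq_powr_le) auto
    finally show ?thesis .
  qed
  have e: "f (x + d) * g (x + d) + f (x - d) * g (x - d) - 2 * (f x * g x)
    = f x * (g (x + d) + g (x - d) - 2 * g x) + g x * (f (x + d) + f (x - d) - 2 * f x)
      + ((f (x + d) - f x) * (g (x + d) - g x) + (f (x - d) - f x) * (g (x - d) - g x))"
    by (simp add: algebra_simps)
  have 1: "\<bar>f x * (g (x + d) + g (x - d) - 2 * g x)\<bar> \<le> F * (C2 * d powr \<gamma>)"
    unfolding abs_mult using gd f(2) F by (intro mult_mono) auto
  have 2: "\<bar>g x * (f (x + d) + f (x - d) - 2 * f x)\<bar> \<le> G * (C1 * d powr \<gamma>)"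
    unfolding abs_mult using fd g(2) G by (intro mult_mono) auto
  have "\<bar>f (x + d) * g (x + d) + f (x - d) * g (x - d) - 2 * (f x * g x)\<bar>
    \<le> F * (C2 * d powr \<gamma>) + G * (C1 * d powr \<gamma>) + (C1 * C2 * (?S * d powr \<gamma>) + C1 * C2 * (?S * d powr \<gamma>))"
    unfolding e using 1 2 cross[OF fd(1) gd(1)] cross[OF fd(2) gd(2)] by linarith
  then show "\<bar>f (x + d) * g (x + d) + f (x - d) * g (x - d) - 2 * (f x * g x)\<bar>
    \<le> (F * C2 + G * C1 + 2 * (C1 * C2 * ?S)) * d powr \<gamma>" by (simp add: algebra_simps)
qed

lemma smooth_bound_inverse:
  assumes f: "smooth_bound L \<gamma> C f" "\<And>x. c \<le> f x" and c: "0 < c" and C: "0 \<le> C"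
    and \<gamma>: "0 < \<gamma>" "\<gamma> \<le> 2"
  shows "\<exists>C\<ge>0. smooth_bound L \<gamma> C (\<lambda>x. 1 / f x)"
proof (rule smooth_boundI)
  have fp: "0 < f x" for x using f(2)[of x] c by linarith
  have inv: "\<bar>y / (f v * f w)\<bar> \<le> Y / (c * c)" if "\<bar>y\<bar> \<le> Y" for y Y v w
  proof -
    have "c * c \<le> f v * f w" using c f(2) by (intro mult_mono) (auto intro: less_imp_le fp)
    then show ?thesis unfolding abs_divide using that c fp[of v] fp[of w]
      by (intro frac_le) (auto simp: abs_mult)
  qed
  fix x d assume d: "0 \<le> d" "d \<le> L"
  let ?D = "d powr min 1 \<gamma>" and ?S = "L powr (2 * min 1 \<gamma> - \<gamma>)"
  note fd = smooth_boundD[OF f(1) d, of x]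
  have diff: "1 / f y - 1 / f x = - (f y - f x) / (f y * f x)" for y
    using fp[of x] fp[of y] by (simp add: field_simps)
  show "\<bar>1 / f (x + d) - 1 / f x\<bar> \<le> C / (c * c) * ?D"
    unfolding diff using inv[of "- (f (x + d) - f x)" "C * ?D" "x + d" x] fd by simp
  \<comment> \<open>Expansion of the reciprocal at \<open>f x\<close> with exact quadratic
    remainder; summed over both sides, the linear parts form the second difference of
    \<open>f\<close>.\<close>
  have sq: "1 / f y - 1 / f x = - (f y - f x) / (f x * f x) + (f y - f x)\<^sup>2 / (f x * f x) / f y" for y
    using fp[of x] fp[of y] by (simp add: field_simps power2_eq_square)
  have 1: "\<bar>(f y - f x)\<^sup>2 / (f x * f x) / f y\<bar> \<le> C * C * ?S * d powr \<gamma> / (c * c) / c"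
    if "\<bar>f y - f x\<bar> \<le> C * ?D" for y
  proof -
    have "\<bar>(f y - f x)\<^sup>2\<bar> = \<bar>f y - f x\<bar> * \<bar>f y - f x\<bar>" by (simp add: power2_eq_square)
    also have "\<dots> \<le> (C * ?D) * (C * ?D)" using that C by (intro mult_mono) auto
    also have "\<dots> = C * C * (?D * ?D)" by simp
    also have "\<dots> \<le> C * C * (?S * d powr \<gamma>)" using C d \<gamma> by (intro mult_left_mono sq_powr_le) auto
    finally have "\<bar>(f y - f x)\<^sup>2 / (f x * f x)\<bar> \<le> C * C * ?S * d powr \<gamma> / (c * c)"
      by (intro inv) simp
    then show ?thesis unfolding abs_divide[of _ "f y"] using fp[of y] f(2)[of y] c by (intro frac_le) auto
  qed
  have 2: "\<bar>- (f (x + d) + f (x - d) - 2 * f x) / (f x * f x)\<bar> \<le> C * d powr \<gamma> / (c * c)"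
    using fd(3) by (intro inv) simp
  have "1 / f (x + d) + 1 / f (x - d) - 2 * (1 / f x) = (1 / f (x + d) - 1 / f x) + (1 / f (x - d) - 1 / f x)" by simp
  also have "\<dots> = - (f (x + d) + f (x - d) - 2 * f x) / (f x * f x)
     + ((f (x + d) - f x)\<^sup>2 / (f x * f x) / f (x + d) + (f (x - d) - f x)\<^sup>2 / (f x * f x) / f (x - d))"
    unfolding sq by (simp add: diff_divide_distrib add_divide_distrib)
  finally have e: "1 / f (x + d) + 1 / f (x - d) - 2 * (1 / f x) = - (f (x + d) + f (x - d) - 2 * f x) / (f x * f x)
     + ((f (x + d) - f x)\<^sup>2 / (f x * f x) / f (x + d) + (f (x - d) - f x)\<^sup>2 / (f x * f x) / f (x - d))" .
  have "\<bar>1 / f (x + d) + 1 / f (x - d) - 2 * (1 / f x)\<bar> \<le> C * d powr \<gamma> / (c * c)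
      + (C * C * ?S * d powr \<gamma> / (c * c) / c + C * C * ?S * d powr \<gamma> / (c * c) / c)"
    unfolding e by (intro order_trans[OF abs_triangle_ineq] add_mono 1 2 fd)
  then show "\<bar>1 / f (x + d) + 1 / f (x - d) - 2 * (1 / f x)\<bar> \<le> (C / (c * c) + 2 * (C * C * ?S / (c * c) / c)) * d powr \<gamma>"
    by (simp add: algebra_simps)
qed


section \<open>Grid points of the circle as integers modulo \<open>npts\<close>\<close>

lemma gen_eq_Aop:
  assumes "\<And>x. \<mu> x = (\<sigma> x)\<^sup>2 / 2 * c x"
  shows "gen L \<sigma> \<mu> m f (mesh L m * of_int i)
    = Aop (mesh L m) (sample L m (\<lambda>x. (\<sigma> x)\<^sup>2 / 2)) (sample L m c) (\<lambda>i. f (mesh L m * of_int i)) i"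
  unfolding gen_def lapl_def grad_def Aop_def lp_def cd_def sample_def assms
  by (simp add: algebra_simps add_divide_distrib diff_divide_distrib)

lemma grid_points:
  assumes L: "0 < L"
  shows "grid L m = (\<lambda>i. mesh L m * of_int i) ` {- (2 ^ m)..<2 ^ m}"
proof -
  have h: "0 < mesh L m" using L by (rule mesh_pos)
  have e: "L = mesh L m * of_int (2 ^ m)" by (simp add: mesh_def)
  have key: "- L \<le> mesh L m * of_int n \<and> mesh L m * of_int n < L \<longleftrightarrow> n \<in> {- (2 ^ m)..<2 ^ m}" for n
  proof -
    have "- L = mesh L m * of_int (- (2 ^ m))" using e by simp
    then have "- L \<le> mesh L m * of_int n \<longleftrightarrow> - (2 ^ m) \<le> n"
      using h by (simp only: mult_le_cancel_left_pos of_int_le_iff)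
    moreover have "mesh L m * of_int n < L \<longleftrightarrow> n < 2 ^ m"
      using h by (subst e) (simp only: mult_less_cancel_left_pos of_int_less_iff)
    ultimately show ?thesis by simp
  qed
  have "x \<in> grid L m \<longleftrightarrow> (\<exists>n. x = mesh L m * of_int n \<and> n \<in> {- (2 ^ m)..<2 ^ m})" for x
  proof -
    have "x \<in> grid L m \<longleftrightarrow> (\<exists>n. x = mesh L m * of_int n \<and> (- L \<le> mesh L m * of_int n \<and> mesh L m * of_int n < L))"
      unfolding grid_def by auto
    then show ?thesis unfolding key .
  qed
  then show ?thesis by blast
qed

lemma sum_grid:
  assumes L: "0 < L" and p: "per (npts m) (\<lambda>i. F (mesh L m * of_int i))"
  shows "(\<Sum>z\<in>grid L m. F z) = (\<Sum>i\<in>{0..<npts m}. F (mesh L m * of_int i))"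
proof -
  have "inj_on (\<lambda>i. mesh L m * of_int i) {- (2 ^ m)..<2 ^ m}"
    using mesh_pos[OF L, of m] by (auto simp: inj_on_def)
  then have "(\<Sum>z\<in>grid L m. F z) = (\<Sum>i\<in>{- (2 ^ m)..<2 ^ m}. F (mesh L m * of_int i))"
    unfolding grid_points[OF L] by (simp add: sum.reindex)
  also have "\<dots> = (\<Sum>i\<in>{0..<npts m}. F (mesh L m * of_int (i + - (2 ^ m))))"
    by (rule sum.reindex_bij_witness[of _ "\<lambda>i. i + - (2 ^ m)" "\<lambda>i. i + 2 ^ m"]) (auto simp: npts_def)
  also have "\<dots> = (\<Sum>i\<in>{0..<npts m}. F (mesh L m * of_int i))"
    by (rule psum_shift[OF npts_pos p])
  finally show ?thesis .
qed

lemma mesh_congruent: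
  assumes L: "0 < L"
  shows "(\<exists>n::int. mesh L m * of_int i - mesh L m * of_int j = 2 * L * of_int n) \<longleftrightarrow> npts m dvd i - j"
proof -
  have "mesh L m * of_int i - mesh L m * of_int j = 2 * L * of_int n \<longleftrightarrow> i - j = npts m * n" for n
  proof -
    have "mesh L m * of_int i - mesh L m * of_int j = mesh L m * of_int (i - j)" by (simp add: right_diff_distrib)
    moreover have "2 * L * of_int n = mesh L m * of_int (npts m * n)"
      unfolding npts_mesh[of m L, symmetric] by simp
    ultimately show ?thesis using mesh_pos[OF L, of m] by (simp only: mult_cancel_left of_int_eq_iff) auto
  qed
  then show ?thesis by (simp add: dvd_def)
qed

lemma periodic_sample:
  assumes "periodic_fun_simple f (2 * L)"
  shows "per (npts m) (\<lambda>i. f (mesh L m * of_int i))"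
proof -
  have "mesh L m * of_int (i + npts m) = mesh L m * of_int i + 2 * L" for i
    using npts_mesh[of m L] by (simp add: distrib_left mult.commute)
  then show ?thesis using assms by (simp add: per_def periodic_iff)
qed

lemma delta_kernel_eq: "0 < L \<Longrightarrow> delta_kernel L m (mesh L m * of_int i) (mesh L m * of_int j) = unit_at (npts m) (mesh L m) j i"
  by (simp add: delta_kernel_def mesh_congruent unit_at_def)

lemma per_unit_eq: "0 < L \<Longrightarrow> per_unit L (mesh L m * of_int j) (mesh L m * of_int i) = mesh L m * unit_at (npts m) (mesh L m) j i"
  using mesh_pos[of L m] by (simp add: per_unit_def mesh_congruent unit_at_def)

lemma mesh_in_grid:
  assumes L: "0 < L"
  obtains i' where "mesh L m * of_int i' \<in> grid L m" "npts m dvd i - i'"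
proof
  \<comment> \<open>The shift by \<open>2 ^ m\<close> moves the residues to the window that
    represents the half-open interval from \<open>-L\<close> to \<open>L\<close>.\<close>
  let ?i = "(i + 2 ^ m) mod npts m - 2 ^ m"
  have "0 \<le> (i + 2 ^ m) mod npts m" "(i + 2 ^ m) mod npts m < npts m" using npts_pos[of m] by auto
  then have "?i \<in> {- (2 ^ m)..<2 ^ m}" by (simp add: npts_def)
  then show "mesh L m * of_int ?i \<in> grid L m" unfolding grid_points[OF L] by (rule imageI)
  have "npts m dvd (i + 2 ^ m) - (i + 2 ^ m) mod npts m" by (rule dvd_minus_mod)
  then show "npts m dvd i - ?i" by (simp add: algebra_simps)
qed

lemma per_cong:
  assumes "per N f" "N dvd i - i'"
  shows "f i = f i'"
proof -
  obtain k where "i - i' = N * k" using assms(2) by (auto elim: dvdE)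
  then have "i = i' + N * k" by simp
  then show ?thesis using per_mult_int[OF assms(1)] by simp
qed

text \<open>A column of the matrix is the generator applied to \<open>h\<close> times a periodic
  delta; adjointness moves the operator to \<phi>, and the delta then picks out the value at
  \<open>j\<close>.\<close>

lemma gen_adj_eq_Adj:
  assumes sc: "scheme (npts m) (mesh L m) (2 * L) a0 a1 B (sample L m (\<lambda>x. (\<sigma> x)\<^sup>2 / 2)) (sample L m c)"
    and L: "0 < L" and \<mu>: "\<And>x. \<mu> x = (\<sigma> x)\<^sup>2 / 2 * c x" and \<phi>: "periodic_fun_simple \<phi> (2 * L)"
  shows "gen_adj L \<sigma> \<mu> m \<phi> (mesh L m * of_int j)
    = Adj (mesh L m) (sample L m (\<lambda>x. (\<sigma> x)\<^sup>2 / 2)) (sample L m c) (\<lambda>i. \<phi> (mesh L m * of_int i)) j"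
proof -
  interpret scheme "npts m" "mesh L m" "2 * L" a0 a1 B "sample L m (\<lambda>x. (\<sigma> x)\<^sup>2 / 2)" "sample L m c"
    by (rule sc)
  let ?h = "mesh L m"
  let ?e = "\<lambda>i. ?h * unit_at (npts m) ?h j i" and ?\<phi> = "\<lambda>i. \<phi> (?h * of_int i)"
  have pe: "per (npts m) ?e" using per_unit_at[of "npts m" ?h j] by (simp add: per_def)
  have p\<phi>: "per (npts m) ?\<phi>" by (rule periodic_sample[OF \<phi>])
  have gm: "gen_mat L \<sigma> \<mu> m (?h * of_int i) (?h * of_int j) = A ?e i" for i
    unfolding gen_mat_def gen_eq_Aop[OF \<mu>] per_unit_eq[OF L] ..
  have "gen_adj L \<sigma> \<mu> m \<phi> (?h * of_int j)
      = (\<Sum>i\<in>{0..<npts m}. gen_mat L \<sigma> \<mu> m (?h * of_int i) (?h * of_int j) * ?\<phi> i)"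
    unfolding gen_adj_def
  proof (rule sum_grid[OF L])
    show "per (npts m) (\<lambda>i. gen_mat L \<sigma> \<mu> m (?h * of_int i) (?h * of_int j) * ?\<phi> i)"
      unfolding gm by (rule per_mult[OF per_A[OF pe] p\<phi>])
  qed
  also have "\<dots> = (\<Sum>i\<in>{0..<npts m}. ?\<phi> i * A ?e i)" unfolding gm by (simp add: mult.commute)
  also have "\<dots> = (\<Sum>i\<in>{0..<npts m}. A' ?\<phi> i * ?e i)" by (rule adjoint[OF p\<phi> pe])
  also have "\<dots> = ?h * (\<Sum>i\<in>{0..<npts m}. unit_at (npts m) ?h j i * A' ?\<phi> i)"
    by (simp add: sum_distrib_left mult_ac)
  also have "\<dots> = A' ?\<phi> j" using h_pos by (simp add: psum_unit_at[OF N_pos per_A'[OF p\<phi>]])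
  finally show ?thesis .
qed

text \<open>The defining property speaks of representatives in the grid and of positive times.
  Periodicity extends it to all integer indices, and setting the kernel to the delta otherwise turns
  the initial limit into continuity at zero.\<close>

lemma is_kernel_kernel:
  assumes sc: "scheme (npts m) (mesh L m) (2 * L) a0 a1 B (sample L m (\<lambda>x. (\<sigma> x)\<^sup>2 / 2)) (sample L m c)"
    and L: "0 < L" and \<mu>: "\<And>x. \<mu> x = (\<sigma> x)\<^sup>2 / 2 * c x" and u: "is_kernel L \<sigma> \<mu> m u"
  shows "transition_kernel (npts m) (mesh L m) (2 * L) a0 a1 B (sample L m (\<lambda>x. (\<sigma> x)\<^sup>2 / 2)) (sample L m c)
    (\<lambda>i j t. if 0 < t then u (mesh L m * of_int i) (mesh L m * of_int j) t else unit_at (npts m) (mesh L m) j i)"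
    (is "transition_kernel _ _ _ _ _ _ _ _ ?p")
proof -
  let ?h = "mesh L m"
  interpret scheme "npts m" ?h "2 * L" a0 a1 B "sample L m (\<lambda>x. (\<sigma> x)\<^sup>2 / 2)" "sample L m c"
    by (rule sc)
  define P where "P = ?p"
  have P_pos: "P i j s = u (?h * of_int i) (?h * of_int j) s" if "0 < s" for i j s
    using that by (simp add: P_def)
  have P_0: "P i j s = unit_at (npts m) ?h j i" if "\<not> 0 < s" for i j s
    using that by (simp add: P_def)
  have pu: "periodic_fun_simple (\<lambda>x. u x y t) (2 * L)" "periodic_fun_simple (\<lambda>y. u x y t) (2 * L)" if "0 < t" for t x y
    using u that by (auto simp: is_kernel_def)
  have p1: "per (npts m) (\<lambda>i. P i j s)" for j s
  proof (cases "0 < s")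
    case True
    then show ?thesis using periodic_sample[OF pu(1)[OF True, of "?h * of_int j"], of m] by (simp add: P_pos)
  next
    case False
    then show ?thesis using per_unit_at[of "npts m" ?h j] by (simp add: P_0)
  qed
  have p2: "per (npts m) (\<lambda>j. P i j s)" for i s
  proof (cases "0 < s")
    case True
    then show ?thesis using periodic_sample[OF pu(2)[OF True, of "?h * of_int i"], of m] by (simp add: P_pos)
  next
    case False
    then show ?thesis using per_unit_at[of "npts m" ?h i] by (simp add: P_0 unit_at_sym[of _ _ _ i])
  qed
  have D: "(P i j has_real_derivative A' (\<lambda>z. P i z s) j) (at s)" if s: "0 < s" for i j s
  proof -
    obtain i' where i': "?h * of_int i' \<in> grid L m" "npts m dvd i - i'" by (rule mesh_in_grid[OF L])
    obtain j' where j': "?h * of_int j' \<in> grid L m" "npts m dvd j - j'" by (rule mesh_in_grid[OF L])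
    have e: "P i z = P i' z" for z by (rule ext) (rule per_cong[OF p1 i'(2)])
    have e': "P i' j = P i' j'" by (rule ext) (rule per_cong[OF p2 j'(2)])
    have "((\<lambda>s. u (?h * of_int i') (?h * of_int j') s) has_real_derivative
        gen_adj L \<sigma> \<mu> m (\<lambda>z. u (?h * of_int i') z s) (?h * of_int j')) (at s)"
      using u s i'(1) j'(1) by (simp add: is_kernel_def)
    also have "gen_adj L \<sigma> \<mu> m (\<lambda>z. u (?h * of_int i') z s) (?h * of_int j') = A' (\<lambda>z. P i' z s) j'"
      using s by (simp add: gen_adj_eq_Adj[OF sc L \<mu> pu(2)[OF s]] P_pos)
    \<comment> \<open>The two functions agree only at positive times, but that is an open
      neighbourhood of \<open>s\<close>.\<close>
    finally have "(P i' j' has_real_derivative A' (\<lambda>z. P i' z s) j') (at s)"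
      by (rule has_field_derivative_transform_within_open[of _ _ _ "{0<..}"]) (use s in \<open>auto simp: P_pos\<close>)
    moreover have "A' (\<lambda>z. P i' z s) j' = A' (\<lambda>z. P i' z s) j"
      by (rule per_cong[OF per_A'[OF p2] j'(2), symmetric])
    ultimately show ?thesis unfolding e e' by simp
  qed
  have cont: "continuous_on {0..} (P i j)" for i j
    unfolding continuous_on_eq_continuous_within
  proof
    fix s :: real assume "s \<in> {0..}"
    then consider "s = 0" | "0 < s" by force
    then show "continuous (at s within {0..}) (P i j)"
    proof cases
      case 2
      then show ?thesis using DERIV_isCont[OF D[OF 2]] continuous_at_imp_continuous_at_within by blast
    next
      case 1
      obtain i' where i': "?h * of_int i' \<in> grid L m" "npts m dvd i - i'" by (rule mesh_in_grid[OF L])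
      obtain j' where j': "?h * of_int j' \<in> grid L m" "npts m dvd j - j'" by (rule mesh_in_grid[OF L])
      have e: "P i j = P i' j" by (rule ext) (rule per_cong[OF p1 i'(2)])
      have e': "P i' j = P i' j'" by (rule ext) (rule per_cong[OF p2 j'(2)])
      have "((\<lambda>t. u (?h * of_int i') (?h * of_int j') t) \<longlongrightarrow> unit_at (npts m) ?h j' i') (at_right 0)"
        using u i'(1) j'(1) by (simp add: is_kernel_def delta_kernel_eq[OF L, symmetric])
      then have "(P i' j' \<longlongrightarrow> unit_at (npts m) ?h j' i') (at_right 0)"
        by (rule Lim_transform_eventually) (auto simp: eventually_at_filter P_pos)
      then have "(P i' j' \<longlongrightarrow> P i' j' 0) (at 0 within {0..})"
        by (simp add: at_within_Ici_at_right P_0)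
      then show ?thesis unfolding 1 e e' continuous_within .
    qed
  qed
  have "transition_kernel (npts m) ?h (2 * L) a0 a1 B (sample L m (\<lambda>x. (\<sigma> x)\<^sup>2 / 2)) (sample L m c) P"
    by unfold_locales (use p1 p2 cont D in \<open>auto simp: P_0\<close>)
  then show ?thesis unfolding P_def .
qed


lemma smooth_bound_mono:
  assumes "smooth_bound L \<gamma> C f" "C \<le> C'"
  shows "smooth_bound L \<gamma> C' f"
  using assms unfolding smooth_bound_def
  by (meson mult_right_mono order_trans powr_ge_zero)

lemma mesh_refine_point: "m \<le> m' \<Longrightarrow> mesh L m * of_int i = mesh L m' * of_int (int (2 ^ (m' - m)) * i)"
  unfolding mesh_refine[of m m' L] by (simp add: mult_ac)

lemma grid_mono:
  assumes "m \<le> m'" shows "grid L m \<subseteq> grid L m'"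
proof
  fix x assume x: "x \<in> grid L m"
  then obtain n :: int where "x = mesh L m * of_int n" by (auto simp: grid_def)
  then have "x = mesh L m' * of_int (int (2 ^ (m' - m)) * n)" using mesh_refine_point[OF assms] by simp
  then show "x \<in> grid L m'" using x unfolding grid_def by blast
qed

theorem theorem1:
  fixes L \<alpha> \<beta> \<gamma> t :: real and k j :: nat and \<sigma> \<mu> :: "real \<Rightarrow> real"
    and u :: "nat \<Rightarrow> real \<Rightarrow> real \<Rightarrow> real \<Rightarrow> real"
  assumes "L > 0"
    and "periodic_fun_simple \<sigma> (2 * L)" and "periodic_fun_simple \<mu> (2 * L)"
    and "\<And>x. \<sigma> x > 0"
    and "0 < \<alpha>" "\<alpha> \<le> 1" and "0 < \<beta>" "\<beta> \<le> 1"
    and "(\<lambda>x. (\<sigma> x)\<^sup>2) \<in> Holder_space L k \<alpha>"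
    and "\<mu> \<in> Holder_space L j \<beta>"
    and "\<gamma> = Min {2, real k + \<alpha>, real j + \<beta>}"
    and "\<gamma> > 0"
    and "\<And>m. is_kernel L \<sigma> \<mu> m (u m)"
    and "t > 0"
  shows "\<exists>c>0. \<forall>m m'. min_level L \<sigma> \<mu> \<le> m \<and> m \<le> m' \<longrightarrow>
    (\<forall>x\<in>grid L m. \<forall>y\<in>grid L m.
       \<bar>u m x y t - u m' x y t\<bar> \<le> c * mesh L m powr \<gamma> \<and>
       \<bar>deriv (\<lambda>s. u m x y s) t - deriv (\<lambda>s. u m' x y s) t\<bar> =
         \<bar>gen_adj L \<sigma> \<mu> m (\<lambda>z. u m x z t) y - gen_adj L \<sigma> \<mu> m' (\<lambda>z. u m' x z t) y\<bar> \<and>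
       \<bar>gen_adj L \<sigma> \<mu> m (\<lambda>z. u m x z t) y - gen_adj L \<sigma> \<mu> m' (\<lambda>z. u m' x z t) y\<bar> =
         \<bar>gen L \<sigma> \<mu> m (\<lambda>z. u m z y t) x - gen L \<sigma> \<mu> m' (\<lambda>z. u m' z y t) x\<bar> \<and>
       \<bar>gen L \<sigma> \<mu> m (\<lambda>z. u m z y t) x - gen L \<sigma> \<mu> m' (\<lambda>z. u m' z y t) x\<bar>
         \<le> c * mesh L m powr \<gamma>)"
proof -
  have L: "0 < L" and \<alpha>: "0 < \<alpha>" "\<alpha> \<le> 1" and \<beta>: "0 < \<beta>" "\<beta> \<le> 1" and t: "0 < t" by fact+
  have \<sigma>_pos: "0 < \<sigma> x" for x by fact
  have \<gamma>: "0 < \<gamma>" "\<gamma> \<le> 2" "\<gamma> \<le> real k + \<alpha>" "\<gamma> \<le> real j + \<beta>" using assms(11,12) by auto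
  have per: "periodic_fun_simple \<sigma> (2 * L)" "periodic_fun_simple \<mu> (2 * L)" by fact+
  have H\<sigma>: "(\<lambda>x. (\<sigma> x)\<^sup>2) \<in> Holder_space L k \<alpha>" and H\<mu>: "\<mu> \<in> Holder_space L j \<beta>" by fact+
  have ker: "is_kernel L \<sigma> \<mu> m (u m)" for m by fact
  define a where "a x = (\<sigma> x)\<^sup>2 / 2" for x
  define b where "b x = \<mu> x / a x" for x
  have a_pos: "0 < a x" for x using \<sigma>_pos[of x] by (simp add: a_def)
  have a_eq: "a = (\<lambda>x. (\<sigma> x)\<^sup>2 / 2)" by (rule ext) (rule a_def)
  have \<mu>_eq: "\<mu> x = (\<sigma> x)\<^sup>2 / 2 * b x" for x using a_pos[of x] by (simp add: b_def a_def)
  have pa: "periodic_fun_simple a (2 * L)" and pb: "periodic_fun_simple b (2 * L)"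
    using per by (simp_all add: periodic_iff a_def b_def)
  have p\<sigma>: "periodic_fun_simple (\<lambda>x. (\<sigma> x)\<^sup>2) (2 * L)" using per by (simp add: periodic_iff)
  \<comment> \<open>Extrema are attained on the circle, so pointwise positivity of \<sigma> becomes
    a uniform lower bound.\<close>
  obtain x0 y0 where xy: "\<And>z. (\<sigma> x0)\<^sup>2 \<le> (\<sigma> z)\<^sup>2 \<and> (\<sigma> z)\<^sup>2 \<le> (\<sigma> y0)\<^sup>2"
    using periodic_continuous_bounds[OF _ p\<sigma> Holder_space_continuous[OF H\<sigma>]] L by auto
  define a0 a1 where "a0 = a x0" and "a1 = a y0"
  have a0: "0 < a0" "\<And>x. a0 \<le> a x" and a1: "\<And>x. a x \<le> a1"
    using xy a_pos unfolding a0_def a1_def by (auto simp: a_def)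
  obtain K\<mu> where K\<mu>: "0 \<le> K\<mu>" "\<And>x. \<bar>\<mu> x\<bar> \<le> K\<mu>"
    using periodic_continuous_abs_bound[OF _ per(2) Holder_space_continuous[OF H\<mu>]] L by auto
  have bB: "\<bar>b x\<bar> \<le> K\<mu> / a0" for x
    unfolding b_def abs_divide using K\<mu> a0 a_pos[of x] by (intro frac_le) auto
  obtain C1 where C1: "0 \<le> C1" "smooth_bound L \<gamma> C1 (\<lambda>x. (\<sigma> x)\<^sup>2)"
    using Holder_space_smooth_bound[OF L H\<sigma> \<alpha> \<gamma>(1-3)] by blast
  obtain C2 where C2: "0 \<le> C2" "smooth_bound L \<gamma> C2 \<mu>"
    using Holder_space_smooth_bound[OF L H\<mu> \<beta> \<gamma>(1,2,4)] by blast
  \<comment> \<open>The difference moduli pass to the reciprocal, then to \<open>1 / a\<close> by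
    scaling, then to \<open>b\<close> as the product of \<mu> and \<open>1 / a\<close>.\<close>
  have "(\<sigma> x0)\<^sup>2 > 0" using \<sigma>_pos[of x0] by simp
  then obtain C3 where C3: "0 \<le> C3" "smooth_bound L \<gamma> C3 (\<lambda>x. 1 / (\<sigma> x)\<^sup>2)"
    using smooth_bound_inverse[OF C1(2) _ _ C1(1) \<gamma>(1,2), of "(\<sigma> x0)\<^sup>2"] xy by blast
  have g_eq: "(\<lambda>x. 2 * (1 / (\<sigma> x)\<^sup>2)) = (\<lambda>x. 1 / a x)" by (rule ext) (simp add: a_def)
  obtain C4 where C4: "0 \<le> C4" "smooth_bound L \<gamma> C4 (\<lambda>x. 1 / a x)"
    using smooth_bound_cmult[OF C3(2), of 2] unfolding g_eq by blast
  have gB: "\<bar>1 / a x\<bar> \<le> 1 / a0" for x using a0 a_pos[of x] by (simp add: frac_le)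
  have b_eq: "(\<lambda>x. \<mu> x * (1 / a x)) = b" by (rule ext) (simp add: b_def)
  obtain C5 where C5: "0 \<le> C5" "smooth_bound L \<gamma> C5 b"
    using smooth_bound_mult[OF C2(2) K\<mu>(2) C4(2) gB \<gamma>(1,2) C2(1) C4(1)] unfolding b_eq by blast
  define p where "p m i j s = (if 0 < s then u m (mesh L m * of_int i) (mesh L m * of_int j) s
    else unit_at (npts m) (mesh L m) j i)" for m i j s
  have sc: "scheme (npts m) (mesh L m) (2 * L) a0 (a1) (K\<mu> / a0) (sample L m a) (sample L m b)" for m
  proof
    show "per (npts m) (sample L m a)" "per (npts m) (sample L m b)"
      using periodic_sample[OF pa, of m] periodic_sample[OF pb, of m] by (simp_all add: sample_def[abs_def])
  qed (use npts_pos[of m] mesh_pos[OF L, of m] npts_mesh[of m L] a0 a1 bB in \<open>auto simp: sample_def\<close>)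
  have kernels: "transition_kernel (npts m) (mesh L m) (2 * L) a0 a1 (K\<mu> / a0) (sample L m a) (sample L m b) (p m)" for m
  proof -
    have "p m = (\<lambda>i j s. if 0 < s then u m (mesh L m * of_int i) (mesh L m * of_int j) s
        else unit_at (npts m) (mesh L m) j i)" by (intro ext) (rule p_def)
    then show ?thesis
      using is_kernel_kernel[OF sc[of m, unfolded a_eq] L \<mu>_eq ker[of m]] unfolding a_eq by simp
  qed
  interpret smooth_kernel_family L a0 a1 "K\<mu> / a0" a b p \<gamma> "max C4 C5"
  proof (intro smooth_kernel_family.intro kernel_family.intro smooth_kernel_family_axioms.intro)
    show "smooth_bound L \<gamma> (max C4 C5) (\<lambda>x. 1 / a x)" by (rule smooth_bound_mono[OF C4(2)]) simp
    show "smooth_bound L \<gamma> (max C4 C5) b" by (rule smooth_bound_mono[OF C5(2)]) simp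
  qed (use L kernels \<gamma>(1,2) C4(1) in auto)
  obtain K where K: "0 \<le> K" "\<And>m m' i j. m \<le> m' \<Longrightarrow>
    \<bar>p m i j t - p m' (int (2 ^ (m' - m)) * i) (int (2 ^ (m' - m)) * j) t\<bar> \<le> K * mesh L m powr \<gamma> \<and>
    \<bar>lev.pk m 1 i j t - lev.pk m' 1 (int (2 ^ (m' - m)) * i) (int (2 ^ (m' - m)) * j) t\<bar> \<le> K * mesh L m powr \<gamma>"
    using kernel_convergence[OF t] by blast
  have pu: "periodic_fun_simple (\<lambda>z. u m x z t) (2 * L)" for m x
    using ker[of m] t by (simp add: is_kernel_def)
  have p_u: "p m i j t = u m (mesh L m * of_int i) (mesh L m * of_int j) t" for m i j
    using t by (simp add: p_def)
  have adj: "gen_adj L \<sigma> \<mu> m (\<lambda>z. u m (mesh L m * of_int i) z t) (mesh L m * of_int j) = lev.pk m 1 i j t" for m i j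
    using gen_adj_eq_Adj[OF sc[of m, unfolded a_eq] L \<mu>_eq pu[of m "mesh L m * of_int i"], of j] lev.pk_forward[of t m 0 i j] t
    by (simp add: lev.pk_0 p_u a_eq[symmetric])
  have gen: "gen L \<sigma> \<mu> m (\<lambda>z. u m z (mesh L m * of_int j) t) (mesh L m * of_int i) = lev.pk m 1 i j t" for m i j
    unfolding gen_eq_Aop[OF \<mu>_eq] a_eq[symmetric] by (simp add: lev.pk_Suc lev.pk_0 p_u)
  have der: "deriv (\<lambda>s. u m x y s) t = gen_adj L \<sigma> \<mu> m (\<lambda>z. u m x z t) y" if "x \<in> grid L m" "y \<in> grid L m" for m x y
    using ker[of m] that t by (intro DERIV_imp_deriv) (simp add: is_kernel_def)
  show ?thesis
  \<comment> \<open>The constant must be strictly positive, while \<open>K\<close> may be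
    zero.\<close>
  proof (intro exI[of _ "K + 1"] conjI allI impI ballI)
    show "0 < K + 1" using K(1) by simp
    fix m m' x y
    assume "min_level L \<sigma> \<mu> \<le> m \<and> m \<le> m'" and x: "x \<in> grid L m" and y: "y \<in> grid L m"
    then have m: "m \<le> m'" by simp
    obtain i i' where i: "x = mesh L m * of_int i" "x = mesh L m' * of_int i'" "i' = int (2 ^ (m' - m)) * i"
      using x mesh_refine_point[OF m, of L] unfolding grid_def by blast
    obtain l l' where l: "y = mesh L m * of_int l" "y = mesh L m' * of_int l'" "l' = int (2 ^ (m' - m)) * l"
      using y mesh_refine_point[OF m, of L] unfolding grid_def by blast
    have x': "x \<in> grid L m'" and y': "y \<in> grid L m'" using x y grid_mono[OF m, of L] by auto
    have 1: "gen_adj L \<sigma> \<mu> m (\<lambda>z. u m x z t) y = lev.pk m 1 i l t"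
      "gen L \<sigma> \<mu> m (\<lambda>z. u m z y t) x = lev.pk m 1 i l t" "u m x y t = p m i l t"
      unfolding i(1) l(1) by (rule adj gen p_u[symmetric])+
    have 2: "gen_adj L \<sigma> \<mu> m' (\<lambda>z. u m' x z t) y = lev.pk m' 1 i' l' t"
      "gen L \<sigma> \<mu> m' (\<lambda>z. u m' z y t) x = lev.pk m' 1 i' l' t" "u m' x y t = p m' i' l' t"
      unfolding i(2) l(2) by (rule adj gen p_u[symmetric])+
    have le: "K * mesh L m powr \<gamma> \<le> (K + 1) * mesh L m powr \<gamma>" by (intro mult_right_mono) auto
    show "\<bar>u m x y t - u m' x y t\<bar> \<le> (K + 1) * mesh L m powr \<gamma>"
      unfolding 1 2 i(3) l(3) using K(2)[OF m, of i l] le by linarith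
    show "\<bar>deriv (\<lambda>s. u m x y s) t - deriv (\<lambda>s. u m' x y s) t\<bar> =
         \<bar>gen_adj L \<sigma> \<mu> m (\<lambda>z. u m x z t) y - gen_adj L \<sigma> \<mu> m' (\<lambda>z. u m' x z t) y\<bar>"
      unfolding der[OF x y] der[OF x' y'] ..
    show "\<bar>gen_adj L \<sigma> \<mu> m (\<lambda>z. u m x z t) y - gen_adj L \<sigma> \<mu> m' (\<lambda>z. u m' x z t) y\<bar> =
         \<bar>gen L \<sigma> \<mu> m (\<lambda>z. u m z y t) x - gen L \<sigma> \<mu> m' (\<lambda>z. u m' z y t) x\<bar>"
      unfolding 1 2 ..
    show "\<bar>gen L \<sigma> \<mu> m (\<lambda>z. u m z y t) x - gen L \<sigma> \<mu> m' (\<lambda>z. u m' z y t) x\<bar> \<le> (K + 1) * mesh L m powr \<gamma>"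
      unfolding 1 2 i(3) l(3) using K(2)[OF m, of i l] le by linarith
  qed
qed

end
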